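(* (1) For every $n\ge1$ and $q\in(0,\infty]$ there is a constant $C_{q,n}>0$, depending only on $q$ and $n$, such that for every $p\in(1,\infty)$ and every $w\in A_p$ on $\mathbb R^n$, with $\sigma:=w^{1-p'}$, $$\|\mathrm M\|_{L^{p,q}(w)}\le C_{q,n}\,(p')^{\frac1{\min(p,q)}}\,[w]_{A_p}^{\frac1p}\,[\sigma]_{A_\infty}^{\frac1{\min(p,q)}}.$$ (2) The exponents of the weight constants in (1) are optimal: let $n\ge 1$, $p\in(1,\infty)$, $q\in(0,\infty]$, and let $\alpha\le\frac1p$ and $\beta\le\frac1{\min(p,q)}$ with at least one of the two inequalities strict. Then there is no constant $C$ (independent of $w$) such that $$\|\mathrm M\|_{L^{p,q}(w)}\le C\,[w]_{A_p}^{\alpha}\,[\sigma]_{A_\infty}^{\beta}\qquad\text{for all } w\in A_p,\ \sigma=w^{1-p'}.$$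
   Context: Cubes are cubes in $\mathbb R^n$, and $\frac1{|Q|}\int_Q$ denotes the average over $Q$. The Hardy–Littlewood maximal operator is $\mathrm Mf(x)=\sup_{Q\ni x}\frac1{|Q|}\int_Q|f(y)|\,dy$, the supremum over all cubes $Q$ containing $x$. A weight is a locally integrable function positive a.e.; $w(E)=\int_E w\,dx$. For $1<p<\infty$, $p'=\frac p{p-1}$ and $$[w]_{A_p}:=\sup_Q\Big(\frac1{|Q|}\int_Q w\,dx\Big)\Big(\frac1{|Q|}\int_Q w^{1-p'}\,dx\Big)^{p-1};$$ $w\in A_p$ means $[w]_{A_p}<\infty$. The $A_\infty$ constant is the Fujii–Wilson constant $$[w]_{A_\infty}:=\sup_Q\frac1{w(Q)}\int_Q\mathrm M(w\chi_Q)\,dx.$$ Lorentz spaces: for $p,q\in(0,\infty)$, $\|f\|_{L^{p,q}(w)}:=\big(p\int_0^\infty s^q\,w(\{|f|>s\})^{q/p}\frac{ds}s\big)^{1/q}$, and $\|f\|_{L^{p,\infty}(w)}:=\sup_{s>0}s\,w(\{|f|>s\})^{1/p}$. The operator norm is $\|\mathrm M\|_{L^{p,q}(w)}:=\sup_{f\ne0}\|\mathrm Mf\|_{L^{p,q}(w)}/\|f\|_{L^{p,q}(w)}$. If $q=\infty$, $\min(p,q)=p$. *)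

theory Defs
  imports "HOL-Analysis.Analysis"
begin

text \<open>Real powers of extended nonnegative numbers, with the usual conventions
  \<open>\<infinity> ^ r = \<infinity>\<close>, \<open>0 ^ r = 0\<close> for \<open>r > 0\<close>, \<open>\<infinity> ^ r = 0\<close>, \<open>0 ^ r = \<infinity>\<close> for \<open>r < 0\<close>, and \<open>x ^ 0 = 1\<close>.\<close>

definition epowr :: "ennreal \<Rightarrow> real \<Rightarrow> ennreal" where
  "epowr x r =
     (if r = 0 then 1
      else if x = top then (if r > 0 then top else 0)
      else if x = 0 then (if r > 0 then 0 else top)
      else ennreal (enn2real x powr r))"

text \<open>Closed nondegenerate cubes with sides parallel to the coordinate axes.\<close>

definition cubes :: "(real ^ 'n) set set" where
  "cubes = {cbox a (a + vec l) | a l. l > 0}"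

definition avg :: "(real ^ 'n) set \<Rightarrow> (real ^ 'n \<Rightarrow> ennreal) \<Rightarrow> ennreal" where
  "avg Q f = (\<integral>\<^sup>+ x\<in>Q. f x \<partial>lebesgue) / emeasure lebesgue Q"

definition hl_maximal :: "(real ^ 'n \<Rightarrow> real) \<Rightarrow> real ^ 'n \<Rightarrow> ennreal" where
  "hl_maximal f x = (SUP Q\<in>{Q \<in> cubes. x \<in> Q}. avg Q (\<lambda>y. ennreal \<bar>f y\<bar>))"

definition locally_integrable :: "(real ^ 'n \<Rightarrow> real) \<Rightarrow> bool" where
  "locally_integrable f \<longleftrightarrow>
     f \<in> borel_measurable lebesgue \<and> (\<forall>K. compact K \<longrightarrow> set_integrable lebesgue K f)"

definition weight :: "(real ^ 'n \<Rightarrow> real) \<Rightarrow> bool" where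
  "weight w \<longleftrightarrow> locally_integrable w \<and> (AE x in lebesgue. w x > 0)"

definition wmeasure :: "(real ^ 'n \<Rightarrow> real) \<Rightarrow> (real ^ 'n) set \<Rightarrow> ennreal" where
  "wmeasure w E = (\<integral>\<^sup>+ x\<in>E. ennreal (w x) \<partial>lebesgue)"

definition conj_exp :: "real \<Rightarrow> real" where
  "conj_exp p = p / (p - 1)"

definition dual_weight :: "real \<Rightarrow> (real ^ 'n \<Rightarrow> real) \<Rightarrow> real ^ 'n \<Rightarrow> real" where
  "dual_weight p w x = w x powr (1 - conj_exp p)"

definition Ap_const :: "real \<Rightarrow> (real ^ 'n \<Rightarrow> real) \<Rightarrow> ennreal" where
  "Ap_const p w =
     (SUP Q\<in>cubes. avg Q (\<lambda>x. ennreal (w x)) *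
        epowr (avg Q (\<lambda>x. ennreal (w x powr (1 - conj_exp p)))) (p - 1))"

definition Ap :: "real \<Rightarrow> (real ^ 'n \<Rightarrow> real) set" where
  "Ap p = {w. weight w \<and> Ap_const p w < top}"

definition Ainf_const :: "(real ^ 'n \<Rightarrow> real) \<Rightarrow> ennreal" where
  "Ainf_const w =
     (SUP Q\<in>cubes. (\<integral>\<^sup>+ x\<in>Q. hl_maximal (\<lambda>y. w y * indicator Q y) x \<partial>lebesgue) / wmeasure w Q)"

text \<open>The Lorentz quasinorm is a functional of \<open>\<bar>f\<bar>\<close>. It is stated for functions with values
  in \<open>[0, \<infinity>]\<close>, so that it also applies to maximal functions. The second exponent ranges over \<open>(0, \<infinity>]\<close>.\<close>

definition lorentz_norm ::
    "real \<Rightarrow> ennreal \<Rightarrow> (real ^ 'n \<Rightarrow> real) \<Rightarrow> (real ^ 'n \<Rightarrow> ennreal) \<Rightarrow> ennreal" where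
  "lorentz_norm p q w F =
     (if q = top
      then (SUP s\<in>{0<..}. ennreal s * epowr (wmeasure w {x. F x > ennreal s}) (1 / p))
      else epowr
        (ennreal p * (\<integral>\<^sup>+ s\<in>{0<..}. ennreal (s powr enn2real q) *
            epowr (wmeasure w {x. F x > ennreal s}) (enn2real q / p) / ennreal s \<partial>lborel))
        (1 / enn2real q))"

text \<open>The supremum runs over the nonzero elements of \<open>L\<^sup>p\<^sup>,\<^sup>q(w)\<close>; functions are identified when equal
  almost everywhere. Only \<open>\<bar>f\<bar>\<close> matters, so real-valued \<open>f\<close> suffice.\<close>

definition maximal_opnorm :: "real \<Rightarrow> ennreal \<Rightarrow> (real ^ 'n \<Rightarrow> real) \<Rightarrow> ennreal" where
  "maximal_opnorm p q w =
     (SUP f\<in>{f \<in> borel_measurable lebesgue. \<not> (AE x in lebesgue. f x = 0) \<and>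
                lorentz_norm p q w (\<lambda>x. ennreal \<bar>f x\<bar>) < top}.
        lorentz_norm p q w (hl_maximal f) / lorentz_norm p q w (\<lambda>x. ennreal \<bar>f x\<bar>))"

text \<open>\<open>min(p, q)\<close>, which equals \<open>p\<close> for \<open>q = \<infinity>\<close>.\<close>

definition min_exp :: "real \<Rightarrow> ennreal \<Rightarrow> real" where
  "min_exp p q = enn2real (min (ennreal p) q)"

end

theory Submission
  imports Defs
begin

text \<open>
  Why the upper bound holds. Fix \<open>w \<in> A\<^sub>p\<close>, put \<open>\<sigma> = w powr (1 - p')\<close> and let \<open>H\<close> be the Fujii-Wilson
  constant of \<open>\<sigma>\<close>. The maximal operator satisfies a weak-type inequality
  \<open>s\<^sup>r w(M f > s) \<le> c\<^sup>r [w]\<^bsub>A_r\<^esub> \<integral> |f|\<^sup>r w\<close> for every \<open>r > 1\<close>, with the weight constant to the first power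
  (\<open>hl_maximal_weak_type\<close>). It is used not at \<open>r = p\<close> but slightly below: a reverse Hoelder
  inequality for \<open>\<sigma>\<close> with exponent \<open>1 + e\<close>, \<open>e\<close> comparable to \<open>1 / H\<close> (\<open>reverse_Hoelder_Ainf\<close>), gives
  \<open>[w]\<^bsub>A_r\<^esub> \<le> 2 powr (p - 1) [w]\<^bsub>A_p\<^esub>\<close> for an \<open>r < p\<close> with \<open>p / (p - r)\<close> comparable to \<open>p' H\<close>
  (\<open>Ap_const_self_improvement\<close>). Applying the weak-type inequality to the part of \<open>f\<close> above the height \<open>s\<close>
  and cutting that part into dyadic layers yields
  \<open>w(M f > 2 s) \<le> B \<Sum>k. 2 powr (k r) w(|f| > 2\<^sup>k s)\<close>, where the p-th root of \<open>B\<close> is at most a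
  dimensional multiple of the p-th root of \<open>[w]\<^bsub>A_p\<^esub>\<close>. In \<open>L\<^sup>p\<^sup>,\<^sup>q\<close> the k-th term costs \<open>2 powr (- k (p - r))\<close>. If \<open>q \<ge> p\<close> these
  weights are summed before the p-th root is taken, and if \<open>q < p\<close> their powers with exponent \<open>q / p\<close> are summed
  before the q-th root is taken, so the geometric series contributes \<open>(p' H) powr (1 / min p q)\<close>
  (\<open>lorentz_functional_dyadic_domination\<close>).

  Why the reverse Hoelder inequality is linear in \<open>H\<close>. For a cube \<open>Q\<close> let \<open>F = M(\<sigma> \<chi>\<^sub>Q)\<close>. On the set
  \<open>E = {x \<in> Q. F x > \<lambda>}\<close>, with \<open>\<lambda>\<close> at least the mean of \<open>\<sigma>\<close> over \<open>Q\<close>, one covers by cubes of nearly maximal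
  side on which the mean exceeds \<open>\<lambda>\<close>; maximality makes \<open>F\<close> a local maximal function there, up to the level
  \<open>\<lambda>\<close>, and the definition of \<open>H\<close> gives \<open>\<integral>\<^sub>E F \<le> c H \<lambda> |E|\<close>, while \<open>\<sigma>(E) \<le> c \<lambda> |E|\<close>
  without \<open>H\<close> (\<open>hl_maximal_level_sets\<close>). Integrating the first estimate against \<open>d(\<lambda>\<^sup>e)\<close> controls
  \<open>\<integral> F\<^sup>1\<^sup>+\<^sup>e\<close> at the cost of one factor \<open>H\<close>; the second estimate then carries a factor \<open>e\<close>, which
  cancels this \<open>H\<close> (\<open>reverse_Hoelder_from_level_sets\<close>).

  Why the exponents are optimal. All examples depend on one coordinate \<open>t\<close> of \<open>x\<close>, so that averages over cubes
  are averages over intervals, and are built from \<open>A\<^sub>1\<close> weights \<open>g\<close> on the line, for which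
  \<open>[g]\<^bsub>A_\<infinity>\<^esub>\<close>, \<open>[g]\<^bsub>A_p\<^esub>\<close> and \<open>[g powr (1 - p)]\<^bsub>A_p\<^esub>\<close> are bounded by the \<open>A\<^sub>1\<close> constant, respectively by its power
  with exponent \<open>p - 1\<close> for the last one. For \<open>w = |t| powr (e - 1)\<close> the dual weight
  has a bounded \<open>A\<^sub>\<infinity>\<close> constant and \<open>[w]\<^bsub>A_p\<^esub>\<close> is at most a multiple of \<open>1 / e\<close>; testing on a slab away from \<open>t = 0\<close>
  shows that the norm is at least a multiple of \<open>(1 / e) powr (1 / p)\<close>, which fixes the first exponent
  (\<open>maximal_opnorm_singular_weight\<close>). For the second exponent take \<open>\<sigma>\<close> in \<open>A\<^sub>1\<close> with constant at most
  a multiple of \<open>1 / e\<close> and \<open>w = \<sigma> powr (1 - p)\<close>. If \<open>q \<ge> p\<close>, \<open>\<sigma> = |t| powr (e - 1)\<close> restricted to a cube is a function with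
  \<open>M f \<ge> f / e\<close> (\<open>maximal_opnorm_degenerate_weight\<close>). If \<open>q < p\<close>, flatten this \<open>\<sigma>\<close> near \<open>t = 0\<close> and
  test on the indicator of the flat slab: it is cheap for \<open>w\<close>, and its maximal function has the critical decay over
  a range of levels of logarithmic length comparable to \<open>1 / e\<close>, which produces the factor \<open>(1 / e) powr (1 / q)\<close>
  (\<open>maximal_opnorm_plateau_weight\<close>). Letting \<open>e\<close> tend to 0 gives \<open>maximal_opnorm_exponents_optimal\<close>.
\<close>

section \<open>Powers of extended nonnegative numbers and Hoelder's inequality\<close>

lemma epowr_ennreal: "a > 0 \<Longrightarrow> epowr (ennreal a) r = ennreal (a powr r)"
  by (auto simp: epowr_def)

lemma epowr_zero [simp]: "r > 0 \<Longrightarrow> epowr 0 r = 0"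
  by (auto simp: epowr_def)

lemma epowr_top [simp]: "r > 0 \<Longrightarrow> epowr top r = top"
  by (auto simp: epowr_def)

lemma epowr_one [simp]: "epowr x 1 = x"
  by (cases x) (auto simp: epowr_def ennreal_eq_0_iff)

lemma epowr_one_base [simp]: "epowr 1 r = 1"
  by (simp add: epowr_def)

lemma epowr_ennreal': "a \<ge> 0 \<Longrightarrow> r > 0 \<Longrightarrow> epowr (ennreal a) r = ennreal (a powr r)"
  by (cases "a = 0") (auto simp: epowr_ennreal)

lemma epowr_eq_0_iff: "r > 0 \<Longrightarrow> epowr x r = 0 \<longleftrightarrow> x = 0"
  by (cases x) (auto simp: epowr_ennreal' ennreal_eq_0_iff)

lemma epowr_eq_top_iff: "r > 0 \<Longrightarrow> epowr x r = top \<longleftrightarrow> x = top"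
  by (cases x) (auto simp: epowr_ennreal')

lemma epowr_less_top_iff: "r > 0 \<Longrightarrow> epowr x r < top \<longleftrightarrow> x < top"
  using epowr_eq_top_iff less_top by metis

lemma epowr_mono:
  assumes "x \<le> y" "r > 0"
  shows "epowr x r \<le> epowr y r"
  using assms by (cases x; cases y) (auto simp: epowr_ennreal' powr_mono2 top_unique)

lemma epowr_mult:
  assumes "r > 0"
  shows "epowr (x * y) r = epowr x r * epowr y r"
proof (cases "x = 0 \<or> y = 0")
  case False
  then have "x > 0" "y > 0" by (auto simp: zero_less_iff_neq_zero)
  with assms show ?thesis
    by (cases x; cases y)
      (auto simp: epowr_ennreal' powr_mult ennreal_mult_top ennreal_top_mult
             ennreal_eq_0_iff simp flip: ennreal_mult)
qed (use assms in auto)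

lemma epowr_epowr:
  assumes "r > 0" "s > 0"
  shows "epowr (epowr x r) s = epowr x (r * s)"
  using assms by (cases x) (auto simp: epowr_ennreal' powr_powr)

lemma epowr_add:
  assumes "r > 0" "s > 0"
  shows "epowr x (r + s) = epowr x r * epowr x s"
  using assms by (cases x) (auto simp: epowr_ennreal' powr_add simp flip: ennreal_mult)

lemma epowr_inverse:
  assumes "r > 0"
  shows "epowr (epowr x r) (1 / r) = x" "epowr (epowr x (1 / r)) r = x"
  using assms by (simp_all add: epowr_epowr)

lemma epowr_le_iff:
  assumes "r > 0"
  shows "epowr x r \<le> y \<longleftrightarrow> x \<le> epowr y (1 / r)"
proof
  assume "epowr x r \<le> y"
  then have "epowr (epowr x r) (1/r) \<le> epowr y (1/r)" using assms by (intro epowr_mono) auto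
  then show "x \<le> epowr y (1/r)" using assms by (simp add: epowr_inverse)
next
  assume "x \<le> epowr y (1/r)"
  then have "epowr x r \<le> epowr (epowr y (1/r)) r" using assms by (intro epowr_mono) auto
  then show "epowr x r \<le> y" using assms by (simp add: epowr_inverse)
qed

lemma borel_measurable_epowr [measurable]:
  assumes [measurable]: "f \<in> borel_measurable M"
  shows "(\<lambda>x. epowr (f x) r) \<in> borel_measurable M"
  unfolding epowr_def by measurable

lemma epowr_ge_1:
  assumes "r > 0" "x \<ge> 1" shows "epowr x r \<ge> 1"
  using epowr_mono[OF assms(2,1)] by simp

lemma epowr_exponent_mono:
  assumes "x \<ge> 1" "r \<le> s"
  shows "epowr x r \<le> epowr x s"
proof (cases "x = top")
  case False
  then obtain a where a: "x = ennreal a" "a \<ge> 0" by (cases x) auto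
  with assms have "a \<ge> 1" by simp
  with a assms show ?thesis by (simp add: epowr_ennreal powr_mono)
qed (use assms in \<open>auto simp: epowr_def\<close>)

lemma weighted_arith_geo_mean_ennreal:
  assumes "0 < t" "t < 1"
  shows "epowr x t * epowr y (1 - t) \<le> ennreal t * x + ennreal (1 - t) * y"
proof -
  consider "x = 0 \<or> y = 0" | "x \<noteq> 0" "y \<noteq> 0" "x = top \<or> y = top"
    | a b where "x = ennreal a" "y = ennreal b" "a > 0" "b > 0"
    by (cases x; cases y) (auto simp: ennreal_eq_0_iff le_less)
  then show ?thesis
  proof cases
    case 1 then show ?thesis using assms by auto
  next
    case 2 then show ?thesis using assms by (auto simp: ennreal_mult_top)
  next
    case 3
    then show ?thesis using assms Youngs_inequality_0[of t "1 - t" a b]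
      by (simp add: epowr_ennreal flip: ennreal_mult ennreal_plus)
  qed
qed

text \<open>Both integrals are normalised to 1, and the arithmetic-geometric mean inequality is integrated. If one of
  them is 0 or \<open>\<infinity>\<close> this normalisation is impossible and the claim is seen directly.\<close>

theorem nn_integral_Holder:
  assumes [measurable]: "f \<in> borel_measurable M" "g \<in> borel_measurable M"
    and t: "0 < t" "t < 1"
  shows "(\<integral>\<^sup>+x. epowr (f x) t * epowr (g x) (1 - t) \<partial>M)
      \<le> epowr (\<integral>\<^sup>+x. f x \<partial>M) t * epowr (\<integral>\<^sup>+x. g x \<partial>M) (1 - t)"
proof -
  define F where "F = (\<integral>\<^sup>+x. f x \<partial>M)"
  define G where "G = (\<integral>\<^sup>+x. g x \<partial>M)"
  consider "F = 0" | "G = 0" | "F \<noteq> 0" "G \<noteq> 0" "F = top \<or> G = top"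
    | a b where "F = ennreal a" "G = ennreal b" "a > 0" "b > 0"
    by (cases F; cases G) (auto simp: ennreal_eq_0_iff le_less)
  then show ?thesis
  proof cases
    case 1
    then have "AE x in M. f x = 0" unfolding F_def by (subst (asm) nn_integral_0_iff_AE) auto
    then have "AE x in M. epowr (f x) t * epowr (g x) (1 - t) = 0"
      by eventually_elim (use t in auto)
    then have "(\<integral>\<^sup>+x. epowr (f x) t * epowr (g x) (1 - t) \<partial>M) = 0"
      by (subst nn_integral_0_iff_AE) auto
    then show ?thesis by simp
  next
    case 2
    then have "AE x in M. g x = 0" unfolding G_def by (subst (asm) nn_integral_0_iff_AE) auto
    then have "AE x in M. epowr (f x) t * epowr (g x) (1 - t) = 0"
      by eventually_elim (use t in auto)
    then have "(\<integral>\<^sup>+x. epowr (f x) t * epowr (g x) (1 - t) \<partial>M) = 0"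
      by (subst nn_integral_0_iff_AE) auto
    then show ?thesis by simp
  next
    case 3
    then have "epowr F t * epowr G (1 - t) = top"
      using t by (auto simp: ennreal_mult_top ennreal_top_mult epowr_eq_0_iff)
    then show ?thesis by (simp add: F_def G_def)
  next
    case 4
    define c where "c = ennreal (a powr t) * ennreal (b powr (1 - t))"
    have split: "epowr (f x) t * epowr (g x) (1 - t)
        = c * (epowr (f x / F) t * epowr (g x / G) (1 - t))" for x
    proof -
      have "epowr (f x / F * F) t = epowr (f x / F) t * ennreal (a powr t)"
        using 4 t by (simp add: epowr_mult epowr_ennreal)
      moreover have "f x / F * F = f x"
        using 4 by (simp add: ennreal_divide_times)
      moreover have "epowr (g x / G * G) (1-t) = epowr (g x / G) (1-t) * ennreal (b powr (1-t))"
        using 4 t by (simp add: epowr_mult epowr_ennreal)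
      moreover have "g x / G * G = g x"
        using 4 by (simp add: ennreal_divide_times)
      ultimately show ?thesis by (simp add: c_def mult_ac)
    qed
    have "(\<integral>\<^sup>+x. epowr (f x) t * epowr (g x) (1 - t) \<partial>M)
        = c * (\<integral>\<^sup>+x. epowr (f x / F) t * epowr (g x / G) (1 - t) \<partial>M)"
      unfolding split by (intro nn_integral_cmult) measurable
    also have "\<dots> \<le> c * (\<integral>\<^sup>+x. ennreal t * (f x / F) + ennreal (1 - t) * (g x / G) \<partial>M)"
      by (intro mult_left_mono nn_integral_mono weighted_arith_geo_mean_ennreal t) auto
    also have "(\<integral>\<^sup>+x. ennreal t * (f x / F) + ennreal (1 - t) * (g x / G) \<partial>M)
        = ennreal t * (F / F) + ennreal (1 - t) * (G / G)"
      by (simp add: nn_integral_add nn_integral_cmult nn_integral_divide F_def[symmetric] G_def[symmetric])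
    also have "\<dots> = 1"
      using 4 t by (simp add: ennreal_divide_self flip: ennreal_plus)
    also have "c * 1 = epowr F t * epowr G (1 - t)"
      using 4 by (simp add: c_def epowr_ennreal)
    finally show ?thesis by (simp add: F_def G_def)
  qed
qed

text \<open>If \<open>S\<close> is the right-hand side, every term satisfies
  \<open>x\<^sub>k = (x\<^sub>k powr t) * (x\<^sub>k powr t) powr (1/t - 1) \<le> (x\<^sub>k powr t) * S powr (1/t - 1)\<close>. Summing over \<open>k\<close> bounds the
  sum of the \<open>x\<^sub>k\<close> by \<open>S powr (1/t)\<close>, with no passage through partial sums.\<close>

lemma epowr_suminf_le:
  assumes t: "0 < t" "t \<le> 1"
  shows "epowr (\<Sum>k. x k) t \<le> (\<Sum>k. epowr (x k) t)"
proof (cases "t = 1")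
  case False
  with t have t: "0 < t" "t < 1" by auto
  define S where "S = (\<Sum>k. epowr (x k) t)"
  have le: "x k \<le> epowr (x k) t * epowr S (1/t - 1)" for k
  proof -
    have u: "1/t - 1 > 0" using t by simp
    have "epowr (x k) t = sum (\<lambda>k. epowr (x k) t) {k}" by simp
    also have "\<dots> \<le> S" unfolding S_def by (intro sum_le_suminf) auto
    finally have *: "epowr (x k) t \<le> S" .
    have "x k = epowr (epowr (x k) t) (1 + (1/t - 1))"
      using t by (simp add: epowr_epowr)
    also have "\<dots> = epowr (x k) t * epowr (epowr (x k) t) (1/t - 1)"
      using u by (subst epowr_add) auto
    also have "\<dots> \<le> epowr (x k) t * epowr S (1/t - 1)"
      using * u by (intro mult_left_mono epowr_mono) auto
    finally show ?thesis .
  qed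
  have "(\<Sum>k. x k) \<le> (\<Sum>k. epowr (x k) t * epowr S (1/t - 1))"
    by (intro suminf_le le) auto
  also have "\<dots> = S * epowr S (1/t - 1)" by (simp add: S_def)
  also have "\<dots> = epowr S (1 / t)"
    using t epowr_add[of 1 "1/t - 1" S] by simp
  finally show ?thesis using t by (simp add: epowr_le_iff S_def)
qed simp

text \<open>Jensen's inequality for the weights \<open>a\<^sub>k\<close>, in the form of Hoelder's inequality for the counting measure. In the
  case \<open>q > p\<close> of the Lorentz estimate it plays the role of Minkowski's inequality in \<open>L\<^sup>q\<^sup>/\<^sup>p\<close>.\<close>

lemma epowr_suminf_convex:
  assumes t: "1 < t"
  shows "epowr (\<Sum>k. a k * b k) t \<le> epowr (\<Sum>k. a k) (t - 1) * (\<Sum>k. a k * epowr (b k) t)"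
proof -
  have eq: "a k * b k = epowr (a k * epowr (b k) t) (1/t) * epowr (a k) (1 - 1/t)" for k
  proof -
    have "epowr (a k * epowr (b k) t) (1/t) * epowr (a k) (1 - 1/t)
       = (epowr (a k) (1/t) * epowr (a k) (1 - 1/t)) * b k"
      using t by (simp add: epowr_mult epowr_inverse mult_ac)
    also have "epowr (a k) (1/t) * epowr (a k) (1 - 1/t) = a k"
      using t epowr_add[of "1/t" "1 - 1/t" "a k"] by simp
    finally show ?thesis by simp
  qed
  have "(\<Sum>k. a k * b k) \<le> epowr (\<Sum>k. a k * epowr (b k) t) (1/t) * epowr (\<Sum>k. a k) (1 - 1/t)"
    using nn_integral_Holder[of "\<lambda>k. a k * epowr (b k) t" "count_space UNIV" a "1/t"] t
    by (simp add: nn_integral_count_space_nat flip: eq)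
  then have "epowr (\<Sum>k. a k * b k) t
     \<le> epowr (epowr (\<Sum>k. a k * epowr (b k) t) (1/t) * epowr (\<Sum>k. a k) (1 - 1/t)) t"
    using t by (intro epowr_mono) auto
  also have "\<dots> = (\<Sum>k. a k * epowr (b k) t) * epowr (\<Sum>k. a k) (t - 1)"
  proof -
    have "(1 - 1/t) * t = t - 1" using t by (simp add: field_simps)
    then show ?thesis using t by (simp add: epowr_mult epowr_epowr)
  qed
  finally show ?thesis by (simp add: mult.commute)
qed

section \<open>Cubes, averages and the maximal function\<close>

abbreviation cube :: "real ^ 'n \<Rightarrow> real \<Rightarrow> (real ^ 'n) set" where
  "cube a l \<equiv> cbox a (a + vec l)"

lemma mem_cube: "x \<in> cube a l \<longleftrightarrow> (\<forall>i. a $ i \<le> x $ i \<and> x $ i \<le> a $ i + l)"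
  by (simp add: mem_box_cart)

lemma cubesE: assumes "Q \<in> cubes" obtains a l where "Q = cube a l" "l > 0"
  using assms by (auto simp: cubes_def)

lemma cube_in_cubes [intro]: "l > 0 \<Longrightarrow> cube a l \<in> cubes"
  by (auto simp: cubes_def)

lemma emeasure_cube:
  fixes a :: "real ^ 'n"
  assumes "l \<ge> 0"
  shows "emeasure lebesgue (cube a l) = ennreal (l ^ CARD('n))"
proof -
  have "measure lborel (cube a l) = l ^ CARD('n)"
    using assms by (subst content_cbox_cart) (auto simp: interval_eq_empty_cart not_less)
  moreover have "emeasure lborel (cube a l) \<noteq> top"
    using emeasure_lborel_cbox_finite[of a "a + vec l"] by (simp add: less_top)
  ultimately show ?thesis
    using emeasure_eq_ennreal_measure[of lborel "cube a l"] by simp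
qed

lemma ennreal_divide_le_iff:
  fixes a c :: ennreal
  assumes "b > 0"
  shows "a / ennreal b \<le> c \<longleftrightarrow> a \<le> c * ennreal b"
proof -
  have "a = a / ennreal b * ennreal b" using assms by (simp add: ennreal_divide_times)
  moreover have "c * ennreal b / ennreal b = c" using assms by (simp add: ennreal_mult_divide_eq)
  ultimately show ?thesis
    by (metis divide_right_mono_ennreal mult_right_mono zero_le)
qed

lemma avg_cube:
  fixes a :: "real ^ 'n"
  assumes "l \<ge> 0"
  shows "avg (cube a l) f = (\<integral>\<^sup>+ x\<in>cube a l. f x \<partial>lebesgue) / ennreal (l ^ CARD('n))"
  unfolding avg_def emeasure_cube[OF assms] ..

lemma avg_le_iff:
  fixes a :: "real ^ 'n"
  assumes "l > 0"
  shows "avg (cube a l) f \<le> c \<longleftrightarrow> (\<integral>\<^sup>+ x\<in>cube a l. f x \<partial>lebesgue) \<le> c * ennreal (l ^ CARD('n))"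
  using assms by (simp add: avg_cube ennreal_divide_le_iff)

lemma less_avg_iff:
  fixes a :: "real ^ 'n"
  assumes "l > 0"
  shows "c < avg (cube a l) f \<longleftrightarrow> c * ennreal (l ^ CARD('n)) < (\<integral>\<^sup>+ x\<in>cube a l. f x \<partial>lebesgue)"
  using avg_le_iff[OF assms, of a f c] by (simp flip: not_le)

lemma set_nn_integral_subset:
  assumes "A \<subseteq> B"
  shows "(\<integral>\<^sup>+ x\<in>A. f x \<partial>M) \<le> (\<integral>\<^sup>+ x\<in>B. f x \<partial>M)"
  using assms by (intro nn_integral_mono) (auto simp: indicator_def)

lemma avg_cube_mono:
  assumes "\<And>x. x \<in> Q \<Longrightarrow> f x \<le> g x"
  shows "avg Q f \<le> avg Q g"
  unfolding avg_def using assms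
  by (intro divide_right_mono_ennreal nn_integral_mono) (auto simp: indicator_def)

lemma less_hl_maximal_iff:
  "c < hl_maximal f x \<longleftrightarrow>
     (\<exists>a l. l > 0 \<and> x \<in> cube a l \<and> c < avg (cube a l) (\<lambda>y. ennreal \<bar>f y\<bar>))"
  unfolding hl_maximal_def less_SUP_iff by (auto simp: cubes_def)

lemma avg_le_hl_maximal:
  "l > 0 \<Longrightarrow> x \<in> cube a l \<Longrightarrow> avg (cube a l) (\<lambda>y. ennreal \<bar>f y\<bar>) \<le> hl_maximal f x"
  unfolding hl_maximal_def by (rule SUP_upper) auto

text \<open>Fattening a cube a little does not decrease the integral and hardly changes the volume, so a strict lower bound
  for the average survives. This is why superlevel sets of maximal functions are open although the cubes are closed.\<close>

lemma enlarge_cube: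
  fixes a :: "real ^ 'n"
  assumes l: "l > 0" and s: "s \<ge> 0" "ennreal s < avg (cube a l) g" and \<eta>: "\<eta> > 0"
  obtains a' l' where "l < l'" "l' < l + \<eta>" "cube a l \<subseteq> box a' (a' + vec l')"
    "ennreal s < avg (cube a' l') g"
proof -
  define I where "I = (\<integral>\<^sup>+ x\<in>cube a l. g x \<partial>lebesgue)"
  have I: "ennreal (s * l ^ CARD('n)) < I"
    using s l by (simp add: less_avg_iff I_def ennreal_mult)
  obtain t where t: "s * l ^ CARD('n) < t" "ennreal t \<le> I"
  proof (cases I)
    case (real r)
    with I that[of r] show ?thesis by (auto simp: ennreal_less_iff s l less_imp_le)
  next
    case top
    then show ?thesis by (intro that[of "s * l ^ CARD('n) + 1"]) auto
  qed
  have "((\<lambda>u. s * u ^ CARD('n)) \<longlongrightarrow> s * l ^ CARD('n)) (at_right l)"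
    by (intro tendsto_intros)
  then have "eventually (\<lambda>u. s * u ^ CARD('n) < t) (at_right l)"
    using t by (intro order_tendstoD)
  moreover have "eventually (\<lambda>u. u \<in> {l<..<l + \<eta>}) (at_right l)"
    using \<eta> by (intro eventually_at_right_real) auto
  ultimately have "eventually (\<lambda>u. s * u ^ CARD('n) < t \<and> u \<in> {l<..<l + \<eta>}) (at_right l)"
    by eventually_elim auto
  then obtain u where u: "s * u ^ CARD('n) < t" "l < u" "u < l + \<eta>"
    using eventually_happens' trivial_limit_at_right_real by fastforce
  define a' where "a' = a - vec ((u - l) / 2)"
  have sub: "cube a l \<subseteq> box a' (a' + vec u)"
  proof
    fix x assume x: "x \<in> cube a l"
    have "a' $ i < x $ i \<and> x $ i < a' $ i + u" for i
      using x u by (auto simp: mem_cube a'_def field_simps dest!: spec[of _ i])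
    then show "x \<in> box a' (a' + vec u)" by (simp add: mem_box_cart)
  qed
  also have "\<dots> \<subseteq> cube a' u" by (rule box_subset_cbox)
  finally have "I \<le> (\<integral>\<^sup>+ x\<in>cube a' u. g x \<partial>lebesgue)"
    unfolding I_def by (rule set_nn_integral_subset)
  moreover have "ennreal s * ennreal (u ^ CARD('n)) < ennreal t"
    using u l s by (simp add: ennreal_less_iff flip: ennreal_mult)
  ultimately have "ennreal s < avg (cube a' u) g"
    using u l t by (subst less_avg_iff) (auto intro: order.strict_trans2)
  then show ?thesis using that[OF u(2,3) sub] by blast
qed

lemma open_hl_maximal: "open {x. c < hl_maximal f x}"
proof (cases c)
  case (real s)
  show ?thesis
  proof (subst open_subopen, safe)
    fix x assume "c < hl_maximal f x"
    then obtain a l where al: "l > 0" "x \<in> cube a l" "ennreal s < avg (cube a l) (\<lambda>y. ennreal \<bar>f y\<bar>)"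
      by (auto simp: less_hl_maximal_iff real)
    then obtain a' l' where al': "l < l'" "cube a l \<subseteq> box a' (a' + vec l')"
      "ennreal s < avg (cube a' l') (\<lambda>y. ennreal \<bar>f y\<bar>)"
      using enlarge_cube[of l s a _ 1] real by (metis zero_less_one)
    show "\<exists>T. open T \<and> x \<in> T \<and> T \<subseteq> {x. c < hl_maximal f x}"
    proof (intro exI conjI subsetI)
      show "open (box a' (a' + vec l'))" by (rule open_box)
      show "x \<in> box a' (a' + vec l')" using al al' by auto
      fix y assume "y \<in> box a' (a' + vec l')"
      then have "y \<in> cube a' l'" using box_subset_cbox by blast
      then show "y \<in> {x. c < hl_maximal f x}"
        using al al' real by (auto simp: less_hl_maximal_iff intro!: exI[of _ a'] exI[of _ l'])
    qed
  qed
qed auto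

lemma borel_measurable_hl_maximal_borel: "hl_maximal f \<in> borel_measurable borel"
  by (rule borel_measurableI_greater) (auto intro: borel_open open_hl_maximal)

lemma borel_measurable_hl_maximal [measurable]: "hl_maximal f \<in> borel_measurable lebesgue"
  using borel_measurable_hl_maximal_borel by (intro measurable_completion) simp

text \<open>The factor by which cubes have to be dilated in the covering lemma below.\<close>

definition dilation_factor :: "'n itself \<Rightarrow> real" where "dilation_factor _ = 5 * real CARD('n)"

text \<open>The cube with this lower corner and side \<open>dilation_factor * l\<close> is concentric with the cube with corner \<open>a\<close> and
  side \<open>l\<close>.\<close>

definition dilated_corner :: "real ^ 'n \<Rightarrow> real \<Rightarrow> real ^ 'n" where
  "dilated_corner a l = a - vec ((dilation_factor TYPE('n) - 1) / 2 * l)"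

lemma dilation_factor_ge: "dilation_factor TYPE('n::finite) \<ge> 5"
proof -
  have "CARD('n) \<ge> 1" by (simp add: Suc_leI)
  then have "real CARD('n) \<ge> 1" by linarith
  then show ?thesis by (simp add: dilation_factor_def)
qed

lemma mem_dilated_cube:
  fixes a :: "real ^ 'n"
  shows "x \<in> cube (dilated_corner a l) (dilation_factor TYPE('n) * l) \<longleftrightarrow>
     (\<forall>i. \<bar>x $ i - (a $ i + l / 2)\<bar> \<le> dilation_factor TYPE('n) * l / 2)"
proof -
  have "(dilated_corner a l $ i \<le> x $ i \<and> x $ i \<le> dilated_corner a l $ i + dilation_factor TYPE('n) * l) \<longleftrightarrow>
     \<bar>x $ i - (a $ i + l / 2)\<bar> \<le> dilation_factor TYPE('n) * l / 2" for i
    by (simp add: dilated_corner_def abs_le_iff field_simps) linarith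
  then show ?thesis by (simp add: mem_cube)
qed

text \<open>Every cube is replaced by a concentric Euclidean ball of radius \<open>n * l / 2\<close>, which contains it since the Euclidean
  norm is at most the sum of the absolute values of the coordinates. Vitali's lemma for balls then applies: cubes
  inside disjoint balls are disjoint, and the ball of five times the radius lies in the concentric cube of side
  \<open>5 * n * l\<close>.\<close>

lemma Vitali_cubes:
  fixes K :: "((real ^ 'n) \<times> real) set"
  assumes K: "\<And>a l. (a, l) \<in> K \<Longrightarrow> 0 < l \<and> l \<le> B"
  obtains C where "countable C" "C \<subseteq> K" "disjoint_family_on (\<lambda>(a, l). cube a l) C"
    "(\<Union>(a, l)\<in>K. cube a l) \<subseteq> (\<Union>(a, l)\<in>C. cube (dilated_corner a l) (dilation_factor TYPE('n) * l))"
proof -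
  define n where "n = real CARD('n)"
  have n: "n > 0" by (simp add: n_def)
  define ctr where "ctr = (\<lambda>(a :: real ^ 'n, l). a + vec (l / 2))"
  define rad where "rad = (\<lambda>(a :: real ^ 'n, l :: real). n * l / 2)"
  have sub: "cube a l \<subseteq> cball (ctr (a, l)) (rad (a, l))" for a :: "real ^ 'n" and l
  proof
    fix x assume "x \<in> cube a l"
    then have A: "a $ i \<le> x $ i \<and> x $ i \<le> a $ i + l" for i by (auto simp: mem_cube)
    have "\<bar>(a + vec (l/2) - x) $ i\<bar> \<le> l / 2" for i
    proof -
      have "(a + vec (l/2) - x) $ i = a $ i + l / 2 - x $ i" by simp
      then show ?thesis using A[of i] unfolding abs_le_iff by linarith
    qed
    then have "(\<Sum>i\<in>UNIV. \<bar>(a + vec (l/2) - x) $ i\<bar>) \<le> (\<Sum>i\<in>(UNIV :: 'n set). l / 2)"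
      by (intro sum_mono) auto
    then have "norm (a + vec (l/2) - x) \<le> n * l / 2"
      using norm_le_l1_cart[of "a + vec (l/2) - x"] by (simp add: n_def)
    then show "x \<in> cball (ctr (a, l)) (rad (a, l))"
      by (simp add: ctr_def rad_def dist_norm)
  qed
  have bd: "0 < rad i \<and> rad i \<le> n * B / 2" if "i \<in> K" for i
    using K[of "fst i" "snd i"] that n by (auto simp: rad_def split: prod.splits)
  obtain C where C: "countable C" "C \<subseteq> K"
     "pairwise (\<lambda>i j. disjnt (cball (ctr i) (rad i)) (cball (ctr j) (rad j))) C"
     "(\<Union>i\<in>K. cball (ctr i) (rad i)) \<subseteq> (\<Union>i\<in>C. cball (ctr i) (5 * rad i))"
    by (rule Vitali_covering_lemma_cballs[of "\<Union>i\<in>K. cball (ctr i) (rad i)" ctr rad K],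
        rule order_refl, erule bd, erule (3) that)
  show ?thesis
  proof (rule that[OF C(1,2)])
    show "disjoint_family_on (\<lambda>(a, l). cube a l) C"
      unfolding disjoint_family_on_def
    proof (intro ballI impI)
      fix i j assume "i \<in> C" "j \<in> C" "i \<noteq> j"
      then have "disjnt (cball (ctr i) (rad i)) (cball (ctr j) (rad j))"
        using C(3) by (rule_tac pairwiseD)
      moreover obtain a l b m where "i = (a, l)" "j = (b, m)" by (cases i, cases j)
      ultimately show "(case i of (a, l) \<Rightarrow> cube a l) \<inter> (case j of (a, l) \<Rightarrow> cube a l) = {}"
        using sub[of a l] sub[of b m] by (auto simp: disjnt_iff simp del: mem_cball)
    qed
    have "cball (ctr (a, l)) (5 * rad (a, l)) \<subseteq> cube (dilated_corner a l) (dilation_factor TYPE('n) * l)"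
      for a :: "real ^ 'n" and l
    proof
      fix x assume "x \<in> cball (ctr (a, l)) (5 * rad (a, l))"
      then have "norm (x - (a + vec (l/2))) \<le> 5 * (n * l / 2)"
        by (simp add: ctr_def rad_def dist_norm norm_minus_commute)
      then have "\<bar>(x - (a + vec (l/2))) $ i\<bar> \<le> 5 * (n * l / 2)" for i
        using component_le_norm_cart order_trans by blast
      then show "x \<in> cube (dilated_corner a l) (dilation_factor TYPE('n) * l)"
        unfolding mem_dilated_cube by (simp add: dilation_factor_def n_def mult.assoc)
    qed
    then have "(\<Union>i\<in>C. cball (ctr i) (5 * rad i)) \<subseteq> (\<Union>(a, l)\<in>C. cube (dilated_corner a l) (dilation_factor TYPE('n) * l))"
      by (intro UN_mono) (auto simp del: mem_cball)
    moreover have "(\<Union>(a, l)\<in>K. cube a l) \<subseteq> (\<Union>i\<in>K. cball (ctr i) (rad i))"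
      using sub by (intro UN_mono) (auto simp del: mem_cball)
    ultimately show "(\<Union>(a, l)\<in>K. cube a l) \<subseteq> (\<Union>(a, l)\<in>C. cube (dilated_corner a l) (dilation_factor TYPE('n) * l))"
      using C(4) by (meson order_trans)
  qed
qed

text \<open>Clamping each coordinate of the corner moves a cube into a larger one without losing any of the points that they
  had in common.\<close>

lemma shift_cube:
  fixes a b :: "real ^ 'n"
  assumes "0 < l" "l \<le> L"
  obtains a' where "cube a' l \<subseteq> cube b L" "cube a l \<inter> cube b L \<subseteq> cube a' l"
proof
  let ?a = "\<chi> i. max (b $ i) (min (a $ i) (b $ i + L - l))"
  show "cube ?a l \<subseteq> cube b L"
  proof
    fix x assume "x \<in> cube ?a l"
    then have "max (b $ i) (min (a $ i) (b $ i + L - l)) \<le> x $ i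
        \<and> x $ i \<le> max (b $ i) (min (a $ i) (b $ i + L - l)) + l" for i
      by (simp add: mem_cube)
    then have "b $ i \<le> x $ i \<and> x $ i \<le> b $ i + L" for i
      using assms by (smt (verit))
    then show "x \<in> cube b L" by (simp add: mem_cube)
  qed
  show "cube a l \<inter> cube b L \<subseteq> cube ?a l"
  proof
    fix x assume "x \<in> cube a l \<inter> cube b L"
    then have "a $ i \<le> x $ i \<and> x $ i \<le> a $ i + l" "b $ i \<le> x $ i \<and> x $ i \<le> b $ i + L" for i
      by (auto simp: mem_cube)
    then have "max (b $ i) (min (a $ i) (b $ i + L - l)) \<le> x $ i
        \<and> x $ i \<le> max (b $ i) (min (a $ i) (b $ i + L - l)) + l" for i
      using assms by (smt (verit))
    then show "x \<in> cube ?a l" by (simp add: mem_cube)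
  qed
qed

lemma One_cart: "h *\<^sub>R (One :: real ^ 'n) = vec h"
proof -
  have "(One :: real ^ 'n) $ i = 1" for i
  proof -
    have "(\<Sum>b\<in>Basis. 1 *\<^sub>R b :: real ^ 'n) \<bullet> axis i 1 = 1"
      by (rule inner_sum_left_Basis) simp
    then show ?thesis by (simp only: inner_axis scaleR_one) simp
  qed
  then show ?thesis by (simp add: vec_eq_iff)
qed

lemma locally_integrable_cbox:
  assumes "locally_integrable v"
  shows "set_integrable lebesgue (cbox a b) v" "v integrable_on cbox a b"
proof -
  show "set_integrable lebesgue (cbox a b) v"
    using assms by (auto simp: locally_integrable_def)
  then show "v integrable_on cbox a b"
    using set_lebesgue_integral_eq_integral(1) by blast
qed

lemma locally_integrable_imp_finite:
  assumes "locally_integrable v"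
  shows "(\<integral>\<^sup>+ x\<in>cbox a b. ennreal (v x) \<partial>lebesgue) < top"
proof -
  have "integrable lebesgue (\<lambda>x. indicat_real (cbox a b) x * v x)"
    using locally_integrable_cbox(1)[OF assms] by (simp add: set_integrable_def)
  then have "(\<integral>\<^sup>+ x. ennreal (norm (indicat_real (cbox a b) x * v x)) \<partial>lebesgue) < top"
    by (simp add: integrable_iff_bounded top.not_eq_extremum)
  moreover have "(\<integral>\<^sup>+ x\<in>cbox a b. ennreal (v x) \<partial>lebesgue)
      \<le> (\<integral>\<^sup>+ x. ennreal (norm (indicat_real (cbox a b) x * v x)) \<partial>lebesgue)"
    by (intro nn_integral_mono) (auto simp: indicator_def intro!: ennreal_leI)
  ultimately show ?thesis by (rule order.strict_trans1[rotated])
qed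

text \<open>Lebesgue's differentiation theorem along the cubes with lower corner \<open>x\<close>: once small, they are contained in the
  given cube because \<open>x\<close> is an interior point of it.\<close>

lemma AE_le_hl_maximal:
  fixes v :: "real ^ 'n \<Rightarrow> real"
  assumes v: "locally_integrable v"
  shows "AE x in lebesgue. \<forall>b L. x \<in> box b (b + vec L) \<longrightarrow>
           ennreal (v x) \<le> hl_maximal (\<lambda>y. v y * indicator (cube b L) y) x"
proof -
  obtain N where N: "negligible N" and
    lim: "\<And>x e. \<lbrakk>x \<notin> N; 0 < e\<rbrakk> \<Longrightarrow>
       \<exists>d>0. \<forall>h. 0 < h \<and> h < d \<longrightarrow>
          norm (integral (cbox x (x + h *\<^sub>R One)) v /\<^sub>R h ^ DIM(real ^ 'n) - v x) < e"
    using integrable_ccontinuous_explicit[OF locally_integrable_cbox(2)[OF v]] by metis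
  have "ennreal (v x) \<le> hl_maximal (\<lambda>y. v y * indicator (cube b L) y) x"
    if x: "x \<notin> N" "x \<in> box b (b + vec L)" for x b L
  proof (rule ennreal_le_epsilon)
    fix e :: real assume e: "e > 0"
    obtain d where d: "d > 0" "\<And>h. 0 < h \<Longrightarrow> h < d \<Longrightarrow>
          norm (integral (cbox x (x + h *\<^sub>R One)) v /\<^sub>R h ^ DIM(real ^ 'n) - v x) < e"
      using lim[OF x(1) e] by blast
    obtain r where r: "r > 0" "cball x r \<subseteq> box b (b + vec L)"
      using x(2) open_contains_cball open_box by blast
    define h where "h = min (d / 2) (r / CARD('n))"
    have h: "0 < h" "h < d" "CARD('n) * h \<le> r"
      using d r by (auto simp: h_def min_def field_simps)
    have sub: "cube x h \<subseteq> cube b L"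
    proof
      fix y assume y: "y \<in> cube x h"
      then have "(\<Sum>i\<in>UNIV. \<bar>(x - y) $ i\<bar>) \<le> (\<Sum>i\<in>(UNIV :: 'n set). h)"
      proof (intro sum_mono)
        fix i have "x $ i \<le> y $ i" "y $ i \<le> x $ i + h" using y by (auto simp: mem_cube)
        then show "\<bar>(x - y) $ i\<bar> \<le> h" by simp
      qed
      then have "norm (x - y) \<le> r"
        using norm_le_l1_cart[of "x - y"] h by simp
      then have "y \<in> cball x r" by (simp add: dist_norm)
      then show "y \<in> cube b L" using r(2) box_subset_cbox by blast
    qed
    have int: "set_integrable lebesgue (cube x h) v" by (rule locally_integrable_cbox[OF v])
    define J where "J = integral (cube x h) v"
    define A where "A = (\<integral>y. \<bar>indicator (cube x h) y * v y\<bar> \<partial>lebesgue)"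
    have A0: "A \<ge> 0" by (simp add: A_def)
    have int': "integrable lebesgue (\<lambda>y. indicat_real (cube x h) y * v y)"
      using int by (simp add: set_integrable_def)
    have "J = (\<integral>y. indicator (cube x h) y * v y \<partial>lebesgue)"
      using set_lebesgue_integral_eq_integral(2)[OF int]
      by (simp add: J_def set_lebesgue_integral_def)
    also have "\<dots> \<le> A"
      unfolding A_def using int' by (intro integral_mono) auto
    finally have JA: "J / h ^ CARD('n) \<le> A / h ^ CARD('n)"
      using h by (intro divide_right_mono) auto
    have "norm (J /\<^sub>R h ^ DIM(real ^ 'n) - v x) < e"
      using d(2)[OF h(1,2)] unfolding One_cart J_def .
    then have "\<bar>J / h ^ CARD('n) - v x\<bar> < e" by (simp add: divide_inverse mult.commute)
    then have "v x \<le> A / h ^ CARD('n) + e" using JA by linarith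
    then have "ennreal (v x) \<le> ennreal (A / h ^ CARD('n) + e)"
      by (rule ennreal_leI)
    also have "\<dots> = ennreal (A / h ^ CARD('n)) + ennreal e"
      using e h A0 by (intro ennreal_plus) auto
    also have "ennreal (A / h ^ CARD('n)) = avg (cube x h) (\<lambda>y. ennreal \<bar>v y * indicator (cube b L) y\<bar>)"
    proof -
      have "ennreal A = (\<integral>\<^sup>+ y. ennreal \<bar>indicator (cube x h) y * v y\<bar> \<partial>lebesgue)"
        unfolding A_def using int' by (intro nn_integral_eq_integral[symmetric]) auto
      also have "\<dots> = (\<integral>\<^sup>+ y\<in>cube x h. ennreal \<bar>v y * indicator (cube b L) y\<bar> \<partial>lebesgue)"
        using sub by (intro nn_integral_cong) (auto simp: indicator_def)
      finally have "avg (cube x h) (\<lambda>y. ennreal \<bar>v y * indicator (cube b L) y\<bar>)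
          = ennreal A / ennreal (h ^ CARD('n))"
        using h by (simp add: avg_cube)
      then show ?thesis using h A0 by (simp add: divide_ennreal)
    qed
    also have "\<dots> \<le> hl_maximal (\<lambda>y. v y * indicator (cube b L) y) x"
      using h by (intro avg_le_hl_maximal) (auto simp: mem_cube)
    finally show "ennreal (v x) \<le> hl_maximal (\<lambda>y. v y * indicator (cube b L) y) x + ennreal e"
      by (simp add: add_mono)
  qed
  then have "{x. \<not> (\<forall>b L. x \<in> box b (b + vec L) \<longrightarrow>
           ennreal (v x) \<le> hl_maximal (\<lambda>y. v y * indicator (cube b L) y) x)} \<subseteq> N"
    by auto
  then show ?thesis using N
    by (intro AE_I'[of N]) (auto simp: negligible_iff_null_sets)
qed

lemma AE_cube_le_hl_maximal:
  fixes v :: "real ^ 'n \<Rightarrow> real"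
  assumes v: "locally_integrable v"
  shows "AE x in lebesgue. x \<in> cube b L \<longrightarrow>
           ennreal (v x) \<le> hl_maximal (\<lambda>y. v y * indicator (cube b L) y) x"
proof -
  have "cube b L - box b (b + vec L) \<in> null_sets lebesgue"
    using negligible_frontier_interval negligible_iff_null_sets by blast
  then have "AE x in lebesgue. x \<notin> cube b L - box b (b + vec L)" by (rule AE_not_in)
  then show ?thesis using AE_le_hl_maximal[OF v] by eventually_elim blast
qed

section \<open>The weighted weak-type inequality\<close>

text \<open>The summation step of a Vitali argument: an estimate that compares each \<open>P c\<close> with \<open>Q c\<close> is summed, the \<open>P c\<close>
  being a covering of \<open>S\<close> and the \<open>Q c\<close> disjoint subsets of \<open>E\<close>.\<close>

lemma set_nn_integral_countable_cover:
  assumes C: "countable C"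
    and cover: "S \<subseteq> (\<Union>c\<in>C. P c)"
    and disj: "disjoint_family_on Q C" and sub: "\<And>c. c \<in> C \<Longrightarrow> Q c \<subseteq> E"
    and PQ: "\<And>c. c \<in> C \<Longrightarrow> P c \<in> sets M" "\<And>c. c \<in> C \<Longrightarrow> Q c \<in> sets M"
    and g [measurable]: "g \<in> borel_measurable M" and h [measurable]: "h \<in> borel_measurable M"
    and le: "\<And>c. c \<in> C \<Longrightarrow> k * (\<integral>\<^sup>+ x\<in>P c. g x \<partial>M) \<le> K * (\<integral>\<^sup>+ x\<in>Q c. h x \<partial>M)"
  shows "k * (\<integral>\<^sup>+ x\<in>S. g x \<partial>M) \<le> K * (\<integral>\<^sup>+ x\<in>E. h x \<partial>M)"
proof -
  have [measurable]: "c \<in> C \<Longrightarrow> (\<lambda>x. g x * indicator (P c) x) \<in> borel_measurable M"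
    "c \<in> C \<Longrightarrow> (\<lambda>x. h x * indicator (Q c) x) \<in> borel_measurable M" for c
    using PQ by auto
  have "(\<integral>\<^sup>+ x\<in>S. g x \<partial>M) \<le> (\<integral>\<^sup>+ x. \<integral>\<^sup>+ c. g x * indicator (P c) x \<partial>count_space C \<partial>M)"
  proof (rule nn_integral_mono)
    fix x
    show "g x * indicator S x \<le> (\<integral>\<^sup>+ c. g x * indicator (P c) x \<partial>count_space C)"
    proof (cases "x \<in> S")
      case True
      then obtain c where "c \<in> C" "x \<in> P c" using cover by auto
      then have "g x * indicator S x \<le> g x * indicator (P c) x" by (auto simp: indicator_def)
      also have "\<dots> \<le> (\<integral>\<^sup>+ c. g x * indicator (P c) x \<partial>count_space C)"
        using \<open>c \<in> C\<close> by (rule nn_integral_ge_point)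
      finally show ?thesis .
    qed auto
  qed
  also have "\<dots> = (\<integral>\<^sup>+ c. (\<integral>\<^sup>+ x\<in>P c. g x \<partial>M) \<partial>count_space C)"
    using C by (intro nn_integral_count_space_nn_integral) auto
  finally have "k * (\<integral>\<^sup>+ x\<in>S. g x \<partial>M) \<le> k * \<dots>" by (rule mult_left_mono) simp
  also have "\<dots> = (\<integral>\<^sup>+ c. k * (\<integral>\<^sup>+ x\<in>P c. g x \<partial>M) \<partial>count_space C)"
    by (simp add: nn_integral_cmult)
  also have "\<dots> \<le> (\<integral>\<^sup>+ c. K * (\<integral>\<^sup>+ x\<in>Q c. h x \<partial>M) \<partial>count_space C)"
    by (intro nn_integral_mono) (auto intro: le)
  also have "\<dots> = K * (\<integral>\<^sup>+ c. (\<integral>\<^sup>+ x\<in>Q c. h x \<partial>M) \<partial>count_space C)"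
    by (simp add: nn_integral_cmult)
  also have "(\<integral>\<^sup>+ c. (\<integral>\<^sup>+ x\<in>Q c. h x \<partial>M) \<partial>count_space C)
      = (\<integral>\<^sup>+ x. \<integral>\<^sup>+ c. h x * indicator (Q c) x \<partial>count_space C \<partial>M)"
    using C by (intro nn_integral_count_space_nn_integral[symmetric]) auto
  also have "\<dots> \<le> (\<integral>\<^sup>+ x\<in>E. h x \<partial>M)"
  proof (rule nn_integral_mono)
    fix x
    show "(\<integral>\<^sup>+ c. h x * indicator (Q c) x \<partial>count_space C) \<le> h x * indicator E x"
    proof (cases "\<exists>c\<in>C. x \<in> Q c")
      case True
      then obtain c0 where c0: "c0 \<in> C" "x \<in> Q c0" by auto
      have "(\<integral>\<^sup>+ c. h x * indicator (Q c) x \<partial>count_space C)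
          = (\<integral>\<^sup>+ c. h x * indicator {c0} c \<partial>count_space C)"
        using c0 disj by (intro nn_integral_cong) (auto simp: indicator_def disjoint_family_on_def)
      also have "\<dots> = h x" using c0 by (simp add: nn_integral_cmult)
      finally show ?thesis using c0 sub by (auto simp: indicator_def)
    next
      case False
      then have "(\<integral>\<^sup>+ c. h x * indicator (Q c) x \<partial>count_space C) = (\<integral>\<^sup>+ c. 0 \<partial>count_space C)"
        by (intro nn_integral_cong) auto
      then show ?thesis by simp
    qed
  qed
  finally show ?thesis by (simp add: mult_left_mono)
qed

lemma wmeasure_mono: "A \<subseteq> B \<Longrightarrow> wmeasure w A \<le> wmeasure w B"
  unfolding wmeasure_def by (rule set_nn_integral_subset)

lemma wmeasure_eq_emeasure_density:
  assumes "w \<in> borel_measurable lebesgue" "A \<in> sets lebesgue"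
  shows "wmeasure w A = emeasure (density lebesgue (\<lambda>x. ennreal (w x))) A"
  using assms by (simp add: wmeasure_def emeasure_density)

text \<open>Hoelder's inequality for the factorisation
  \<open>|f| = (|f|\<^sup>r w) powr (1/r) * (w powr (1 - r')) powr (1 - 1/r)\<close>.\<close>

lemma set_nn_integral_Holder_weighted:
  fixes w f :: "real ^ 'n \<Rightarrow> real"
  assumes r: "1 < r" and [measurable]: "f \<in> borel_measurable lebesgue" "w \<in> borel_measurable lebesgue"
    and Q[measurable]: "Q \<in> sets lebesgue" and pos: "AE x in lebesgue. w x > 0"
  shows "epowr (\<integral>\<^sup>+ x\<in>Q. ennreal \<bar>f x\<bar> \<partial>lebesgue) r
    \<le> (\<integral>\<^sup>+ x\<in>Q. epowr (ennreal \<bar>f x\<bar>) r * ennreal (w x) \<partial>lebesgue) *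
       epowr (\<integral>\<^sup>+ x\<in>Q. ennreal (w x powr (1 - conj_exp r)) \<partial>lebesgue) (r - 1)"
proof -
  define \<phi> where "\<phi> = (\<lambda>x. epowr (ennreal \<bar>f x\<bar>) r * ennreal (w x) * indicator Q x)"
  define \<psi> where "\<psi> = (\<lambda>x. ennreal (w x powr (1 - conj_exp r)) * indicator Q x)"
  have [measurable]: "\<phi> \<in> borel_measurable lebesgue" "\<psi> \<in> borel_measurable lebesgue"
    by (auto simp: \<phi>_def \<psi>_def)
  have e: "(1 - conj_exp r) * (1 - 1/r) = - (1/r)"
    using r by (simp add: conj_exp_def field_simps)
  have "AE x in lebesgue. ennreal \<bar>f x\<bar> * indicator Q x = epowr (\<phi> x) (1/r) * epowr (\<psi> x) (1 - 1/r)"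
    using pos
  proof eventually_elim
    case (elim x)
    show ?case
    proof (cases "x \<in> Q")
      case True
      have "epowr (\<phi> x) (1/r) * epowr (\<psi> x) (1 - 1/r)
         = ennreal \<bar>f x\<bar> * (ennreal (w x powr (1/r)) * ennreal ((w x powr (1 - conj_exp r)) powr (1 - 1/r)))"
        using True elim r
        by (simp add: \<phi>_def \<psi>_def epowr_mult epowr_inverse epowr_ennreal mult.assoc)
      also have "ennreal (w x powr (1/r)) * ennreal ((w x powr (1 - conj_exp r)) powr (1 - 1/r)) = 1"
        unfolding powr_powr e using elim by (simp add: powr_add[symmetric] flip: ennreal_mult)
      finally show ?thesis using True by simp
    next
      case False then show ?thesis using r by (simp add: \<phi>_def)
    qed
  qed
  then have "(\<integral>\<^sup>+ x\<in>Q. ennreal \<bar>f x\<bar> \<partial>lebesgue) = (\<integral>\<^sup>+ x. epowr (\<phi> x) (1/r) * epowr (\<psi> x) (1 - 1/r) \<partial>lebesgue)"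
    by (rule nn_integral_cong_AE)
  also have "\<dots> \<le> epowr (integral\<^sup>N lebesgue \<phi>) (1/r) * epowr (integral\<^sup>N lebesgue \<psi>) (1 - 1/r)"
    using r by (intro nn_integral_Holder) auto
  finally have "epowr (\<integral>\<^sup>+ x\<in>Q. ennreal \<bar>f x\<bar> \<partial>lebesgue) r
      \<le> epowr (epowr (integral\<^sup>N lebesgue \<phi>) (1/r) * epowr (integral\<^sup>N lebesgue \<psi>) (1 - 1/r)) r"
    using r by (intro epowr_mono) auto
  also have "\<dots> = integral\<^sup>N lebesgue \<phi> * epowr (integral\<^sup>N lebesgue \<psi>) ((1 - 1/r) * r)"
    using r by (simp add: epowr_mult epowr_inverse epowr_epowr)
  also have "(1 - 1/r) * r = r - 1" using r by (simp add: field_simps)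
  finally show ?thesis by (simp add: \<phi>_def \<psi>_def)
qed

lemma Ap_const_cube_le:
  fixes a :: "real ^ 'n"
  assumes r: "1 < r" and l: "l > 0"
  shows "wmeasure w (cube a l) * epowr (\<integral>\<^sup>+ x\<in>cube a l. ennreal (w x powr (1 - conj_exp r)) \<partial>lebesgue) (r - 1)
     \<le> Ap_const r w * ennreal ((l ^ CARD('n)) powr r)"
proof -
  define L where "L = l ^ CARD('n)"
  have L: "L > 0" using l by (simp add: L_def)
  define W where "W = wmeasure w (cube a l)"
  define V where "V = (\<integral>\<^sup>+ x\<in>cube a l. ennreal (w x powr (1 - conj_exp r)) \<partial>lebesgue)"
  have "W / ennreal L * epowr (V / ennreal L) (r - 1) \<le> Ap_const r w"
    unfolding Ap_const_def using l
    by (intro SUP_upper2[OF cube_in_cubes]) (auto simp: avg_cube W_def V_def L_def wmeasure_def)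
  then have "W / ennreal L * epowr (V / ennreal L) (r - 1) * ennreal (L powr r)
      \<le> Ap_const r w * ennreal (L powr r)"
    by (rule mult_right_mono) simp
  also have "ennreal (L powr r) = ennreal L * epowr (ennreal L) (r - 1)"
    using L r by (simp add: epowr_ennreal powr_mult_base flip: ennreal_mult)
  also have "W / ennreal L * epowr (V / ennreal L) (r - 1) * (ennreal L * epowr (ennreal L) (r - 1))
     = (W / ennreal L * ennreal L) * epowr (V / ennreal L * ennreal L) (r - 1)"
    using r by (simp add: epowr_mult mult_ac)
  also have "\<dots> = W * epowr V (r - 1)"
    using L by (simp add: ennreal_divide_times)
  finally show ?thesis
    using L r by (simp add: W_def V_def L_def epowr_ennreal powr_mult_base flip: ennreal_mult)
qed

definition dilation_volume :: "'n::finite itself \<Rightarrow> real" where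
  "dilation_volume _ = dilation_factor TYPE('n) ^ CARD('n)"

lemma dilation_volume_ge_1: "dilation_volume TYPE('n::finite) \<ge> 1"
  using dilation_factor_ge[where 'n = 'n] by (simp add: dilation_volume_def)

lemma ennreal_mult_right_le_cancel:
  fixes x y :: ennreal
  assumes "x * ennreal c \<le> y * ennreal c" "c > 0"
  shows "x \<le> y"
  using assms by (metis ennreal_divide_le_iff ennreal_mult_divide_eq divide_right_mono_ennreal
      ennreal_less_zero_iff ennreal_neq_top order_less_irrefl)

lemma cube_subset_dilated_cube:
  fixes a :: "real ^ 'n"
  assumes "l > 0" shows "cube a l \<subseteq> cube (dilated_corner a l) (dilation_factor TYPE('n) * l)"
proof
  fix x assume x: "x \<in> cube a l"
  have D: "dilation_factor TYPE('n) * l \<ge> 5 * l" using dilation_factor_ge[where 'n = 'n] assms by (intro mult_right_mono) auto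
  have "\<bar>x $ i - (a $ i + l / 2)\<bar> \<le> dilation_factor TYPE('n) * l / 2" for i
    using x[unfolded mem_cube, rule_format, of i] D assms unfolding abs_le_iff by linarith
  then show "x \<in> cube (dilated_corner a l) (dilation_factor TYPE('n) * l)" unfolding mem_dilated_cube by blast
qed

text \<open>On a cube \<open>Q\<close> where the mean of \<open>|f|\<close> exceeds \<open>s\<close>, Hoelder's inequality gives
  \<open>(s |Q|)\<^sup>r \<le> (\<integral>\<^sub>Q |f|\<^sup>r w) \<sigma>(P) powr (r - 1)\<close> already with the dilated cube \<open>P\<close> in place of \<open>Q\<close> in the last factor.
  The \<open>A\<^sub>r\<close> condition is then used once, on \<open>P\<close>, where it controls \<open>w(P) \<sigma>(P) powr (r - 1)\<close>; comparing
  \<open>w(P)\<close> with \<open>w(Q)\<close> by doubling would cost a second factor of the weight constant.\<close>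

theorem hl_maximal_weak_type:
  fixes w f :: "real ^ 'n \<Rightarrow> real"
  assumes r: "1 < r" and f[measurable]: "f \<in> borel_measurable lebesgue"
    and w[measurable]: "w \<in> borel_measurable lebesgue" and pos: "AE x in lebesgue. w x > 0"
    and s: "s > 0"
  shows "ennreal (s powr r) * wmeasure w {x. ennreal s < hl_maximal f x}
     \<le> ennreal (dilation_volume TYPE('n) powr r) * Ap_const r w *
         (\<integral>\<^sup>+ x. epowr (ennreal \<bar>f x\<bar>) r * ennreal (w x) \<partial>lebesgue)"
proof -
  define D where "D = dilation_factor TYPE('n)"
  have D: "D > 0" using dilation_factor_ge[where 'n = 'n] by (simp add: D_def)
  define \<phi> where "\<phi> = (\<lambda>x. epowr (ennreal \<bar>f x\<bar>) r * ennreal (w x))"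
  have [measurable]: "\<phi> \<in> borel_measurable lebesgue" unfolding \<phi>_def by measurable
  define K where "K = ennreal (dilation_volume TYPE('n) powr r) * Ap_const r w"
  have single: "ennreal (s powr r) * wmeasure w (cube (dilated_corner a l) (D * l)) \<le> K * (\<integral>\<^sup>+ x\<in>cube a l. \<phi> x \<partial>lebesgue)"
    if al: "l > 0" "ennreal s < avg (cube a l) (\<lambda>y. ennreal \<bar>f y\<bar>)" for a l
  proof -
    define P where "P = cube (dilated_corner a l) (D * l)"
    define V where "V = (\<lambda>Q. \<integral>\<^sup>+ x\<in>Q. ennreal (w x powr (1 - conj_exp r)) \<partial>lebesgue)"
    define L where "L = l ^ CARD('n)"
    have L: "L > 0" using al by (simp add: L_def)
    have "ennreal (s * L) \<le> (\<integral>\<^sup>+ x\<in>cube a l. ennreal \<bar>f x\<bar> \<partial>lebesgue)"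
      using al s by (simp add: less_avg_iff L_def ennreal_mult less_imp_le)
    then have "epowr (ennreal (s * L)) r \<le> epowr (\<integral>\<^sup>+ x\<in>cube a l. ennreal \<bar>f x\<bar> \<partial>lebesgue) r"
      using r by (intro epowr_mono) auto
    also have "\<dots> \<le> (\<integral>\<^sup>+ x\<in>cube a l. \<phi> x \<partial>lebesgue) * epowr (V (cube a l)) (r - 1)"
      unfolding \<phi>_def V_def using r pos by (intro set_nn_integral_Holder_weighted) auto
    also have "\<dots> \<le> (\<integral>\<^sup>+ x\<in>cube a l. \<phi> x \<partial>lebesgue) * epowr (V P) (r - 1)"
      unfolding V_def P_def D_def using r cube_subset_dilated_cube[OF al(1)]
      by (intro mult_left_mono epowr_mono set_nn_integral_subset) auto
    finally have 1: "ennreal (s powr r) * ennreal (L powr r)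
        \<le> (\<integral>\<^sup>+ x\<in>cube a l. \<phi> x \<partial>lebesgue) * epowr (V P) (r - 1)"
      using s L by (simp add: epowr_ennreal powr_mult flip: ennreal_mult)
    have "ennreal (s powr r) * wmeasure w P * ennreal (L powr r)
        = wmeasure w P * (ennreal (s powr r) * ennreal (L powr r))" by (simp add: mult_ac)
    also have "\<dots> \<le> wmeasure w P * ((\<integral>\<^sup>+ x\<in>cube a l. \<phi> x \<partial>lebesgue) * epowr (V P) (r - 1))"
      by (intro mult_left_mono 1) auto
    also have "\<dots> = (wmeasure w P * epowr (V P) (r - 1)) * (\<integral>\<^sup>+ x\<in>cube a l. \<phi> x \<partial>lebesgue)"
      by (simp add: mult_ac)
    also have "\<dots> \<le> (Ap_const r w * ennreal (((D * l) ^ CARD('n)) powr r)) * (\<integral>\<^sup>+ x\<in>cube a l. \<phi> x \<partial>lebesgue)"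
      unfolding P_def V_def using r D al by (intro mult_right_mono Ap_const_cube_le) auto
    also have "((D * l) ^ CARD('n)) powr r = dilation_volume TYPE('n) powr r * L powr r"
      using D L by (simp add: power_mult_distrib powr_mult L_def dilation_volume_def D_def)
    also have "(Ap_const r w * ennreal (dilation_volume TYPE('n) powr r * L powr r)) * (\<integral>\<^sup>+ x\<in>cube a l. \<phi> x \<partial>lebesgue)
        = K * (\<integral>\<^sup>+ x\<in>cube a l. \<phi> x \<partial>lebesgue) * ennreal (L powr r)"
      by (simp add: K_def ennreal_mult mult_ac)
    finally show ?thesis
      unfolding P_def by (rule ennreal_mult_right_le_cancel) (use L in auto)
  qed
  \<comment> \<open>The covering lemma needs bounded sides. The interiors of the cubes of side at most \<open>k\<close> form open sets whose
    union over \<open>k\<close> contains the superlevel set, so the bound on the sides can be removed by monotone convergence.\<close>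
  define G where "G = (\<lambda>k::nat. {(a, l). 0 < l \<and> l \<le> real k \<and> ennreal s < avg (cube a l) (\<lambda>y. ennreal \<bar>f y\<bar>)})"
  define V where "V = (\<lambda>k. \<Union>(a, l)\<in>G k. box a (a + vec l))"
  have openV: "open (V k)" for k by (auto simp: V_def intro!: open_UN open_box)
  have Vk: "ennreal (s powr r) * wmeasure w (V k) \<le> K * integral\<^sup>N lebesgue \<phi>" for k
  proof -
    obtain C where C: "countable C" "C \<subseteq> G k" "disjoint_family_on (\<lambda>(a, l). cube a l) C"
      "(\<Union>(a, l)\<in>G k. cube a l) \<subseteq> (\<Union>(a, l)\<in>C. cube (dilated_corner a l) (D * l))"
      unfolding D_def by (rule Vitali_cubes[of "G k" "real k"]) (auto simp: G_def)
    have "V k \<subseteq> (\<Union>(a, l)\<in>G k. cube a l)"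
      unfolding V_def by (intro UN_mono) (auto intro: box_subset_cbox[THEN subsetD])
    then have cov: "V k \<subseteq> (\<Union>c\<in>C. case c of (a, l) \<Rightarrow> cube (dilated_corner a l) (D * l))" using C(4) by blast
    have "ennreal (s powr r) * (\<integral>\<^sup>+ x\<in>V k. ennreal (w x) \<partial>lebesgue) \<le> K * (\<integral>\<^sup>+ x\<in>UNIV. \<phi> x \<partial>lebesgue)"
    proof (rule set_nn_integral_countable_cover[OF C(1) cov C(3)])
      fix c assume "c \<in> C"
      then obtain a l where "c = (a, l)" "l > 0" "ennreal s < avg (cube a l) (\<lambda>y. ennreal \<bar>f y\<bar>)"
        using C(2) by (cases c) (auto simp: G_def)
      then show "ennreal (s powr r) * (\<integral>\<^sup>+ x\<in>(case c of (a, l) \<Rightarrow> cube (dilated_corner a l) (D * l)). ennreal (w x) \<partial>lebesgue)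
          \<le> K * (\<integral>\<^sup>+ x\<in>(case c of (a, l) \<Rightarrow> cube a l). \<phi> x \<partial>lebesgue)"
        using single[of l a] by (simp add: wmeasure_def)
    qed (auto split: prod.splits)
    then show ?thesis by (simp add: wmeasure_def)
  qed
  have inc: "incseq V"
    unfolding V_def incseq_def by (intro allI impI UN_mono) (auto simp: G_def)
  have "{x. ennreal s < hl_maximal f x} \<subseteq> (\<Union>k. V k)"
  proof
    fix x assume "x \<in> {x. ennreal s < hl_maximal f x}"
    then obtain a l where al: "l > 0" "x \<in> cube a l" "ennreal s < avg (cube a l) (\<lambda>y. ennreal \<bar>f y\<bar>)"
      by (auto simp: less_hl_maximal_iff)
    obtain a' l' where *: "l < l'" "l' < l + 1" "cube a l \<subseteq> box a' (a' + vec l')"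
      "ennreal s < avg (cube a' l') (\<lambda>y. ennreal \<bar>f y\<bar>)"
      by (rule enlarge_cube[of l s a _ 1]) (use al s in auto)
    obtain k :: nat where "l' \<le> real k" using real_arch_simple by blast
    then have "(a', l') \<in> G k" using * al by (auto simp: G_def)
    then show "x \<in> (\<Union>k. V k)" using * al by (auto simp: V_def)
  qed
  then have "ennreal (s powr r) * wmeasure w {x. ennreal s < hl_maximal f x}
      \<le> ennreal (s powr r) * wmeasure w (\<Union>k. V k)"
    by (intro mult_left_mono wmeasure_mono) auto
  also have "wmeasure w (\<Union>k. V k) = (SUP k. wmeasure w (V k))"
  proof -
    have "V k \<in> sets lebesgue" for k using openV by auto
    then show ?thesis
      using inc by (simp add: wmeasure_eq_emeasure_density SUP_emeasure_incseq image_subset_iff)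
  qed
  also have "ennreal (s powr r) * \<dots> = (SUP k. ennreal (s powr r) * wmeasure w (V k))"
    by (simp add: SUP_mult_left_ennreal)
  also have "\<dots> \<le> K * integral\<^sup>N lebesgue \<phi>"
    by (intro SUP_least Vk)
  finally show ?thesis by (simp add: K_def \<phi>_def)
qed

section \<open>Level sets of the local maximal function\<close>

lemma sets_lebesgue_cbox [measurable, simp]: "cbox a b \<in> sets lebesgue"
  using lmeasurable_cbox by (rule fmeasurableD)

lemma wmeasure_cube_pos:
  fixes a :: "real ^ 'n"
  assumes w[measurable]: "w \<in> borel_measurable lebesgue" and pos: "AE x in lebesgue. w x > 0" and l: "l > 0"
  shows "wmeasure w (cube a l) > 0"
proof (rule ccontr)
  assume "\<not> ?thesis"
  then have "(\<integral>\<^sup>+ x. ennreal (w x) * indicator (cube a l) x \<partial>lebesgue) = 0" by (simp add: wmeasure_def)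
  then have "AE x in lebesgue. ennreal (w x) * indicator (cube a l) x = 0"
    by (subst (asm) nn_integral_0_iff_AE) auto
  with pos have "AE x in lebesgue. x \<notin> cube a l"
    by eventually_elim (auto simp: indicator_def ennreal_eq_0_iff split: if_splits)
  then have "emeasure lebesgue (cube a l) = 0"
    by (subst (asm) AE_iff_measurable[OF _ refl]) auto
  then show False using emeasure_cube[of l a] l by simp
qed

lemma weightD:
  assumes "weight w"
  shows "w \<in> borel_measurable lebesgue" "locally_integrable w" "AE x in lebesgue. w x > 0"
    "wmeasure w (cbox a b) < top"
  using assms locally_integrable_imp_finite[of w a b]
  by (auto simp: weight_def locally_integrable_def wmeasure_def)

lemma Ainf_const_le_iff:
  fixes v :: "real ^ 'n \<Rightarrow> real"
  assumes v: "weight v"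
  shows "Ainf_const v \<le> K \<longleftrightarrow> (\<forall>a l. l > 0 \<longrightarrow>
     (\<integral>\<^sup>+ x\<in>cube a l. hl_maximal (\<lambda>y. v y * indicator (cube a l) y) x \<partial>lebesgue)
       \<le> K * wmeasure v (cube a l))"
proof -
  have "(\<integral>\<^sup>+ x\<in>cube a l. hl_maximal (\<lambda>y. v y * indicator (cube a l) y) x \<partial>lebesgue) / wmeasure v (cube a l) \<le> K
     \<longleftrightarrow> (\<integral>\<^sup>+ x\<in>cube a l. hl_maximal (\<lambda>y. v y * indicator (cube a l) y) x \<partial>lebesgue) \<le> K * wmeasure v (cube a l)"
    if "l > 0" for a l
  proof -
    have "0 < wmeasure v (cube a l)" "wmeasure v (cube a l) < top"
      using wmeasure_cube_pos[of v l a] weightD[OF v] that by auto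
    then obtain c where "wmeasure v (cube a l) = ennreal c" "c > 0"
      by (cases "wmeasure v (cube a l)") (auto simp: ennreal_eq_0_iff)
    then show ?thesis by (simp add: ennreal_divide_le_iff)
  qed
  note * = this
  have "Ainf_const v \<le> K \<longleftrightarrow> (\<forall>a l. l > 0 \<longrightarrow>
     (\<integral>\<^sup>+ x\<in>cube a l. hl_maximal (\<lambda>y. v y * indicator (cube a l) y) x \<partial>lebesgue) / wmeasure v (cube a l) \<le> K)"
    unfolding Ainf_const_def SUP_le_iff cubes_def by blast
  with * show ?thesis by simp
qed

text \<open>A locally integrable function is almost everywhere bounded by its local maximal function.\<close>

lemma Ainf_const_ge_1:
  assumes v: "weight v"
  shows "Ainf_const v \<ge> 1"
proof -
  let ?Q = "cube (0 :: real ^ 'n) 1"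
  let ?I = "(\<integral>\<^sup>+ x\<in>?Q. hl_maximal (\<lambda>y. v y * indicator ?Q y) x \<partial>lebesgue)"
  have W: "0 < wmeasure v ?Q" "wmeasure v ?Q < top"
    using wmeasure_cube_pos[of v 1 0] weightD[OF v] by auto
  have "wmeasure v ?Q \<le> ?I"
    unfolding wmeasure_def
  proof (rule nn_integral_mono_AE)
    show "AE x in lebesgue. ennreal (v x) * indicator ?Q x
        \<le> hl_maximal (\<lambda>y. v y * indicator ?Q y) x * indicator ?Q x"
      using AE_cube_le_hl_maximal[OF weightD(2)[OF v], of 0 1]
      by eventually_elim (auto simp: indicator_def)
  qed
  also have "?I \<le> Ainf_const v * wmeasure v ?Q"
    using Ainf_const_le_iff[OF v, of "Ainf_const v"] zero_less_one by blast
  finally have "1 * wmeasure v ?Q \<le> Ainf_const v * wmeasure v ?Q" by simp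
  moreover obtain c where "wmeasure v ?Q = ennreal c" "c > 0"
    using W by (cases "wmeasure v ?Q") (auto simp: ennreal_eq_0_iff)
  ultimately show ?thesis by (metis ennreal_mult_right_le_cancel)
qed

text \<open>The constant of the level set estimates. The first factor is the volume of a cube that contains the dilate of a
  unit cube together with all unit cubes that meet it; the second one bounds the ratio of volumes between a cube of side at
  least 1 that meets this dilate and a cube containing both of them, plus 1 for the local part.\<close>

definition level_const :: "'n::finite itself \<Rightarrow> real" where
  "level_const _ = (dilation_factor TYPE('n) + 2) ^ CARD('n) * ((2 * dilation_factor TYPE('n) + 1) ^ CARD('n) + 1)"

text \<open>Cover \<open>E\<close> by cubes in \<open>Q0\<close> with mean above \<open>lam\<close> whose side is at least half of the largest possible one for
  some point \<open>x\<close>. All cubes through \<open>x\<close> of at least twice the side have mean at most \<open>lam\<close>. For a point \<open>y\<close> of the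
  dilated cube, a cube \<open>R\<close> around \<open>y\<close> that is not smaller than the selected one lies in a cube of comparable size through \<open>x\<close>,
  so its mean is at most a multiple of \<open>lam\<close>; a smaller \<open>R\<close> sees only \<open>v\<close> on a slightly larger cube \<open>S\<close>. Hence
  \<open>F \<le> c lam + M(v \<chi>\<^sub>S)\<close> there, and the definition of \<open>[v]\<^bsub>A_\<infinity>\<^esub>\<close> on \<open>S\<close> gives the second estimate, since the mean of \<open>v\<close>
  over \<open>S\<close> is again at most \<open>lam\<close>; this last fact alone gives the first one.\<close>

lemma hl_maximal_level_sets:
  fixes v :: "real ^ 'n \<Rightarrow> real"
  assumes v: "weight v" and nonneg: "\<And>x. v x \<ge> 0"
    and H: "Ainf_const v \<le> ennreal H" "H \<ge> 1"
    and L: "L > 0" and lam0: "wmeasure v (cube b L) = ennreal (lam0 * L ^ CARD('n))" "lam0 > 0"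
    and lam: "lam \<ge> lam0"
  defines "F \<equiv> hl_maximal (\<lambda>y. v y * indicator (cube b L) y)"
  defines "E \<equiv> {x \<in> cube b L. ennreal lam < F x}"
  shows "wmeasure v E \<le> ennreal (level_const TYPE('n) * lam) * emeasure lebesgue E"
    and "(\<integral>\<^sup>+ x\<in>E. F x \<partial>lebesgue) \<le> ennreal (level_const TYPE('n) * H * lam) * emeasure lebesgue E"
proof -
  define D where "D = dilation_factor TYPE('n)"
  have D: "D \<ge> 5" using dilation_factor_ge[where 'n = 'n] by (simp add: D_def)
  define n where "n = CARD('n)"
  define c1 where "c1 = (D + 2) ^ n"
  define c2 where "c2 = (2 * D + 1) ^ n"
  have c: "c1 \<ge> 1" "c2 \<ge> 1" using D by (auto simp: c1_def c2_def)
  have big: "level_const TYPE('n) = c1 * (c2 + 1)" by (simp add: level_const_def c1_def c2_def D_def n_def)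
  define Q0 where "Q0 = cube b L"
  define v0 where "v0 = (\<lambda>y. v y * indicator Q0 y)"
  have [measurable]: "v \<in> borel_measurable lebesgue" using weightD[OF v] by simp
  have [measurable]: "Q0 \<in> sets lebesgue" by (simp add: Q0_def)
  have F[measurable]: "F \<in> borel_measurable lebesgue" unfolding F_def by measurable
  have Fv0: "F = hl_maximal v0" by (simp add: F_def v0_def Q0_def)
  have E[measurable]: "E \<in> sets lebesgue" unfolding E_def by measurable
  have lam_pos: "lam > 0" using lam lam0 by simp
  define vm where "vm = (\<lambda>R. \<integral>\<^sup>+ x\<in>R. ennreal \<bar>v0 x\<bar> \<partial>lebesgue)"
  have vm_wm: "vm R = wmeasure v R" if "R \<subseteq> Q0" for R
    unfolding vm_def wmeasure_def using that nonneg
    by (intro nn_integral_cong) (auto simp: v0_def indicator_def)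
  have vm_le: "vm R \<le> ennreal (lam * L ^ n)" for R
  proof -
    have "vm R \<le> vm Q0" unfolding vm_def by (intro nn_integral_mono) (auto simp: v0_def indicator_def)
    also have "\<dots> = ennreal (lam0 * L ^ n)" using vm_wm[of Q0] lam0 by (simp add: Q0_def n_def)
    also have "\<dots> \<le> ennreal (lam * L ^ n)" using lam L by (intro ennreal_leI mult_right_mono) auto
    finally show ?thesis .
  qed
  have avg_iff: "ennreal lam < avg (cube a l) (\<lambda>y. ennreal \<bar>v0 y\<bar>) \<longleftrightarrow> ennreal (lam * l ^ n) < vm (cube a l)"
    if "l > 0" for a l
    using that lam_pos by (simp add: less_avg_iff vm_def ennreal_mult n_def)
  \<comment> \<open>The side \<open>l\<close> is nearly maximal at \<open>x\<close>: no cube through \<open>x\<close> of at least twice this side has mean above \<open>lam\<close>.\<close>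
  define maxl where "maxl = (\<lambda>x l. \<forall>a' l'. l' \<ge> 2 * l \<longrightarrow> l' > 0 \<longrightarrow> x \<in> cube a' l' \<longrightarrow> vm (cube a' l') \<le> ennreal (lam * l' ^ n))"
  define K where "K = {(a, l). 0 < l \<and> l \<le> L \<and> cube a l \<subseteq> Q0 \<and>
      ennreal (lam * l ^ n) < vm (cube a l) \<and> (\<exists>x\<in>cube a l. maxl x l)}"
  have EK: "E \<subseteq> (\<Union>(a, l)\<in>K. cube a l)"
  proof
    fix x assume "x \<in> E"
    then have x: "x \<in> Q0" "ennreal lam < hl_maximal v0 x" by (auto simp: E_def Q0_def Fv0)
    define T where "T = {l. l > 0 \<and> (\<exists>a. x \<in> cube a l \<and> ennreal (lam * l ^ n) < vm (cube a l))}"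
    obtain a1 l1 where "l1 > 0" "x \<in> cube a1 l1" "ennreal lam < avg (cube a1 l1) (\<lambda>y. ennreal \<bar>v0 y\<bar>)"
      using x(2) unfolding less_hl_maximal_iff by blast
    then have "l1 \<in> T" unfolding T_def using avg_iff[of l1 a1] by blast
    then have "T \<noteq> {}" by blast
    have TL: "l < L" if lT: "l \<in> T" for l
    proof (rule ccontr)
      assume "\<not> l < L"
      then have "ennreal (lam * L ^ n) \<le> ennreal (lam * l ^ n)"
        using L lam_pos by (intro ennreal_leI mult_left_mono power_mono) auto
      moreover obtain a where "ennreal (lam * l ^ n) < vm (cube a l)" using lT unfolding T_def by blast
      ultimately have "ennreal (lam * L ^ n) < vm (cube a l)" by (rule order.strict_trans1)
      then show False using vm_le[of "cube a l"] by (simp add: not_less[symmetric])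
    qed
    then have bdd: "bdd_above T" by (intro bdd_aboveI[of _ L]) (auto intro: less_imp_le)
    have "Sup T > 0"
      using \<open>T \<noteq> {}\<close> bdd less_cSup_iff[of T 0] by (auto simp: T_def)
    then obtain l where l: "l \<in> T" "Sup T / 2 < l"
      using less_cSup_iff[of T "Sup T / 2"] \<open>T \<noteq> {}\<close> bdd by auto
    then obtain a where a: "l > 0" "x \<in> cube a l" "ennreal (lam * l ^ n) < vm (cube a l)"
      by (auto simp: T_def)
    \<comment> \<open>Since \<open>v0\<close> vanishes outside \<open>Q0\<close>, shifting the cube into \<open>Q0\<close> does not decrease its mean.\<close>
    obtain a' where a': "cube a' l \<subseteq> Q0" "cube a l \<inter> Q0 \<subseteq> cube a' l"
      unfolding Q0_def by (rule shift_cube[OF a(1) less_imp_le[OF TL[OF l(1)]]])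
    have "vm (cube a l) \<le> vm (cube a' l)"
      unfolding vm_def using a' by (intro nn_integral_mono) (auto simp: v0_def indicator_def)
    then have big: "ennreal (lam * l ^ n) < vm (cube a' l)" using a by simp
    have "maxl x l"
      unfolding maxl_def
    proof (intro allI impI)
      fix d l' assume *: "2 * l \<le> l'" "0 < l'" "x \<in> cube d l'"
      then have "l' \<notin> T" using l cSup_upper[of l' T] bdd by auto
      then show "vm (cube d l') \<le> ennreal (lam * l' ^ n)"
        using * unfolding T_def by (auto simp: not_less)
    qed
    then have "(a', l) \<in> K" using a a' x big TL[OF l(1)] by (auto simp: K_def)
    moreover have "x \<in> cube a' l" using a a' x by auto
    ultimately show "x \<in> (\<Union>(a, l)\<in>K. cube a l)" by auto
  qed
  have KE: "cube a l \<subseteq> E" if "(a, l) \<in> K" for a l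
  proof
    fix y assume y: "y \<in> cube a l"
    have al: "l > 0" "cube a l \<subseteq> Q0" "ennreal (lam * l ^ n) < vm (cube a l)" using that by (auto simp: K_def)
    then have "ennreal lam < avg (cube a l) (\<lambda>y. ennreal \<bar>v0 y\<bar>)" by (simp add: avg_iff)
    also have "\<dots> \<le> hl_maximal v0 y" using al y by (intro avg_le_hl_maximal)
    finally show "y \<in> E" using al y by (auto simp: E_def Fv0 Q0_def)
  qed
  have single: "wmeasure v (Q0 \<inter> cube (dilated_corner a l) (D * l)) \<le> ennreal (c1 * lam * l ^ n) \<and>
     (\<integral>\<^sup>+ x\<in>Q0 \<inter> cube (dilated_corner a l) (D * l). F x \<partial>lebesgue) \<le> ennreal (c1 * (c2 + 1) * H * lam * l ^ n)"
    if alK: "(a, l) \<in> K" for a l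
  proof -
    obtain x where x: "x \<in> cube a l" "maxl x l" using alK by (auto simp: K_def)
    have al: "0 < l" "l \<le> L" "cube a l \<subseteq> Q0" using alK by (auto simp: K_def)
    define P where "P = cube (dilated_corner a l) (D * l)"
    define P' where "P' = cube (dilated_corner a l - vec l) ((D + 2) * l)"
    have xP: "x \<in> P" using cube_subset_dilated_cube[OF al(1), of a] x by (auto simp: P_def D_def)
    have PP': "P \<subseteq> P'"
    proof
      fix y assume y: "y \<in> P"
      have "dilated_corner a l $ i - l \<le> y $ i \<and> y $ i \<le> dilated_corner a l $ i - l + (D + 2) * l" for i
        using y[unfolded P_def mem_cube, rule_format, of i] al by (simp add: algebra_simps)
      then show "y \<in> P'" by (simp add: P'_def mem_cube)
    qed
    have D2: "(D + 2) * l > 0" using al D by simp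
    \<comment> \<open>The constant of \<open>v\<close> refers to \<open>v\<close> and not to \<open>v0\<close>, so the cube on which it is used has to lie in \<open>Q0\<close>.
      It contains \<open>x\<close> and has side at least \<open>2 l\<close>, or else it is \<open>Q0\<close> itself; either way its mean is at most \<open>lam\<close>.\<close>
    obtain e m where S: "m > 0" "cube e m \<subseteq> Q0" "P' \<inter> Q0 \<subseteq> cube e m"
        "vm (cube e m) \<le> ennreal (lam * ((D + 2) * l) ^ n)"
    proof (cases "(D + 2) * l \<le> L")
      case True
      obtain e where e: "cube e ((D + 2) * l) \<subseteq> Q0" "P' \<inter> Q0 \<subseteq> cube e ((D + 2) * l)"
        unfolding P'_def Q0_def by (rule shift_cube[OF D2 True, where a = "dilated_corner a l - vec l" and b = b])
      have "2 * l \<le> (D + 2) * l" using al D by (intro mult_right_mono) auto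
      moreover have "x \<in> cube e ((D + 2) * l)" using xP PP' e x al by auto
      ultimately have "vm (cube e ((D + 2) * l)) \<le> ennreal (lam * ((D + 2) * l) ^ n)"
        using x(2) D2 unfolding maxl_def by blast
      then show ?thesis by (rule that[OF D2 e])
    next
      case False
      have "vm (cube b L) \<le> ennreal (lam * L ^ n)" by (rule vm_le)
      also have "\<dots> \<le> ennreal (lam * ((D + 2) * l) ^ n)"
        using False lam_pos L by (intro ennreal_leI mult_left_mono power_mono) auto
      finally show ?thesis using L by (intro that[of L b]) (auto simp: Q0_def)
    qed
    define S where "S = cube e m"
    have PS: "Q0 \<inter> P \<subseteq> S" using PP' S by (auto simp: S_def)
    have wS: "wmeasure v S \<le> ennreal (c1 * lam * l ^ n)"
      using vm_wm[of S] S by (simp add: S_def c1_def power_mult_distrib mult_ac)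
    have FS: "F y \<le> ennreal (c2 * lam) + hl_maximal (\<lambda>z. v z * indicator S z) y" if y: "y \<in> Q0 \<inter> P" for y
      unfolding Fv0 hl_maximal_def[of v0]
    proof (rule SUP_least, safe)
      fix R :: "(real ^ 'n) set" assume R: "R \<in> cubes" "y \<in> R"
      then obtain a' l' where R': "R = cube a' l'" "l' > 0" by (auto elim: cubesE)
      show "avg R (\<lambda>y. ennreal \<bar>v0 y\<bar>) \<le> ennreal (c2 * lam) + hl_maximal (\<lambda>z. v z * indicator S z) y"
      proof (cases "l' \<ge> l")
        case True
        \<comment> \<open>A cube that contains both \<open>R\<close> and \<open>x\<close> and is large enough for the maximality at \<open>x\<close> to apply.\<close>
        define R2 where "R2 = cube (a' - vec (D * l')) ((2 * D + 1) * l')"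
        have DD: "D * l \<le> D * l'" using True D by (intro mult_left_mono) auto
        have pos: "D * l' \<ge> 0" using D R' by simp
        have "x \<in> R2"
        proof -
          have "a' $ i - D * l' \<le> x $ i \<and> x $ i \<le> a' $ i - D * l' + (2 * D + 1) * l'" for i
            using xP[unfolded P_def mem_cube, rule_format, of i] y[THEN IntD2, unfolded P_def mem_cube, rule_format, of i]
              R(2)[unfolded R' mem_cube, rule_format, of i] DD by (simp add: algebra_simps)
          then show ?thesis by (simp add: R2_def mem_cube)
        qed
        moreover have "R \<subseteq> R2"
        proof
          fix z assume z: "z \<in> R"
          have "a' $ i - D * l' \<le> z $ i \<and> z $ i \<le> a' $ i - D * l' + (2 * D + 1) * l'" for i
            using z[unfolded R' mem_cube, rule_format, of i] pos by (simp add: algebra_simps)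
          then show "z \<in> R2" by (simp add: R2_def mem_cube)
        qed
        moreover have "2 * l \<le> (2 * D + 1) * l'" using True D al by (intro mult_mono) auto
        moreover have "(2 * D + 1) * l' > 0" using D R' by simp
        ultimately have "vm R2 \<le> ennreal (lam * ((2 * D + 1) * l') ^ n)"
          using x(2) unfolding maxl_def R2_def by blast
        moreover have "vm R \<le> vm R2" unfolding vm_def using \<open>R \<subseteq> R2\<close> by (rule set_nn_integral_subset)
        ultimately have "vm R \<le> ennreal (c2 * lam) * ennreal (l' ^ n)"
          using R' lam_pos c by (simp add: c2_def power_mult_distrib mult_ac flip: ennreal_mult)
        then have "avg R (\<lambda>y. ennreal \<bar>v0 y\<bar>) \<le> ennreal (c2 * lam)"
          using R' by (simp add: avg_le_iff vm_def n_def)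
        then show ?thesis by (rule order_trans) simp
      next
        case False
        have "R \<subseteq> P'"
        proof
          fix z assume z: "z \<in> R"
          have "dilated_corner a l $ i - l \<le> z $ i \<and> z $ i \<le> dilated_corner a l $ i - l + (D + 2) * l" for i
            using z[unfolded R' mem_cube, rule_format, of i] y[THEN IntD2, unfolded P_def mem_cube, rule_format, of i]
              R(2)[unfolded R' mem_cube, rule_format, of i] False by (simp add: algebra_simps)
          then show "z \<in> P'" by (simp add: P'_def mem_cube)
        qed
        then have "avg R (\<lambda>y. ennreal \<bar>v0 y\<bar>) \<le> avg R (\<lambda>z. ennreal \<bar>v z * indicator S z\<bar>)"
          using S nonneg by (intro avg_cube_mono ennreal_leI) (auto simp: v0_def S_def indicator_def)
        also have "\<dots> \<le> hl_maximal (\<lambda>z. v z * indicator S z) y"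
          using R R' by (auto intro: avg_le_hl_maximal)
        finally show ?thesis by (rule order_trans) simp
      qed
    qed
    have "(\<integral>\<^sup>+ x\<in>Q0 \<inter> P. F x \<partial>lebesgue)
       \<le> (\<integral>\<^sup>+ x. ennreal (c2 * lam) * indicator P x + hl_maximal (\<lambda>z. v z * indicator S z) x * indicator S x \<partial>lebesgue)"
      using FS PS by (intro nn_integral_mono) (auto simp: indicator_def)
    also have "\<dots> = ennreal (c2 * lam) * emeasure lebesgue P + (\<integral>\<^sup>+ x\<in>S. hl_maximal (\<lambda>z. v z * indicator S z) x \<partial>lebesgue)"
      by (subst nn_integral_add) (auto simp: P_def S_def nn_integral_cmult)
    also have "\<dots> \<le> ennreal (c2 * lam) * ennreal (c1 * l ^ n) + ennreal H * ennreal (c1 * lam * l ^ n)"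
    proof (intro add_mono mult_left_mono)
      have "emeasure lebesgue P = ennreal ((D * l) ^ n)"
        unfolding P_def n_def using D al by (intro emeasure_cube) auto
      also have "\<dots> \<le> ennreal (c1 * l ^ n)"
        unfolding c1_def using D al by (simp flip: power_mult_distrib) (intro ennreal_leI power_mono mult_right_mono, auto)
      finally show "emeasure lebesgue P \<le> ennreal (c1 * l ^ n)" .
      have "(\<integral>\<^sup>+ x\<in>S. hl_maximal (\<lambda>z. v z * indicator S z) x \<partial>lebesgue) \<le> ennreal H * wmeasure v S"
        using H(1) S(1) unfolding Ainf_const_le_iff[OF v] S_def by blast
      also have "\<dots> \<le> ennreal H * ennreal (c1 * lam * l ^ n)" by (intro mult_left_mono wS) simp
      finally show "(\<integral>\<^sup>+ x\<in>S. hl_maximal (\<lambda>z. v z * indicator S z) x \<partial>lebesgue) \<le> ennreal H * ennreal (c1 * lam * l ^ n)" .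
    qed auto
    also have "\<dots> = ennreal (c1 * (c2 + H) * lam * l ^ n)"
      using c H lam_pos al by (simp add: algebra_simps flip: ennreal_mult ennreal_plus)
    also have "\<dots> \<le> ennreal (c1 * (c2 + 1) * H * lam * l ^ n)"
    proof -
      have "c2 + H \<le> (c2 + 1) * H" using c H by (simp add: algebra_simps)
      then have "c1 * (c2 + H) \<le> c1 * ((c2 + 1) * H)" using c by (intro mult_left_mono) auto
      then show ?thesis using lam_pos al by (intro ennreal_leI mult_right_mono) (auto simp: mult.assoc)
    qed
    finally have "(\<integral>\<^sup>+ x\<in>Q0 \<inter> P. F x \<partial>lebesgue) \<le> ennreal (c1 * (c2 + 1) * H * lam * l ^ n)" .
    moreover have "wmeasure v (Q0 \<inter> P) \<le> ennreal (c1 * lam * l ^ n)"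
      using wmeasure_mono[OF PS, of v] wS by (rule order_trans)
    ultimately show ?thesis by (simp add: P_def)
  qed
  obtain C where C: "countable C" "C \<subseteq> K" "disjoint_family_on (\<lambda>(a, l). cube a l) C"
      "(\<Union>(a, l)\<in>K. cube a l) \<subseteq> (\<Union>(a, l)\<in>C. cube (dilated_corner a l) (D * l))"
    by (rule Vitali_cubes[of K L, folded D_def], simp add: K_def, erule (3) that)
  have cov: "E \<subseteq> (\<Union>c\<in>C. case c of (a, l) \<Rightarrow> Q0 \<inter> cube (dilated_corner a l) (D * l))"
  proof
    fix x assume x: "x \<in> E"
    have "x \<in> (\<Union>(a, l)\<in>C. cube (dilated_corner a l) (D * l))"
      using x EK C(4) by (meson subsetD)
    then obtain a l where al: "(a, l) \<in> C" "x \<in> cube (dilated_corner a l) (D * l)" by blast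
    have "x \<in> Q0" using x by (simp add: E_def Q0_def)
    with al show "x \<in> (\<Union>c\<in>C. case c of (a, l) \<Rightarrow> Q0 \<inter> cube (dilated_corner a l) (D * l))"
      by (intro UN_I[OF al(1)]) simp
  qed
  have gen: "(\<integral>\<^sup>+ x\<in>E. g x \<partial>lebesgue) \<le> ennreal k * emeasure lebesgue E"
    if g: "g \<in> borel_measurable lebesgue" and k: "k \<ge> 0"
      and le: "\<And>a l. (a, l) \<in> K \<Longrightarrow> (\<integral>\<^sup>+ x\<in>Q0 \<inter> cube (dilated_corner a l) (D * l). g x \<partial>lebesgue) \<le> ennreal (k * l ^ n)" for g k
  proof -
    have "1 * (\<integral>\<^sup>+ x\<in>E. g x \<partial>lebesgue) \<le> ennreal k * (\<integral>\<^sup>+ x\<in>E. 1 \<partial>lebesgue)"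
    proof (rule set_nn_integral_countable_cover[OF C(1) cov C(3)])
      fix c assume "c \<in> C"
      then obtain a l where cal: "c = (a, l)" "(a, l) \<in> K" using C(2) by (cases c) auto
      then have "l > 0" by (simp add: K_def)
      show "(case c of (a, l) \<Rightarrow> cube a l) \<subseteq> E" using KE[OF cal(2)] cal(1) by simp
      have "ennreal (k * l ^ n) = ennreal k * (\<integral>\<^sup>+ x\<in>cube a l. 1 \<partial>lebesgue)"
        using \<open>l > 0\<close> k emeasure_cube[of l a] by (simp add: ennreal_mult n_def)
      with le[OF cal(2)] cal(1)
      show "1 * (\<integral>\<^sup>+ x\<in>(case c of (a, l) \<Rightarrow> Q0 \<inter> cube (dilated_corner a l) (D * l)). g x \<partial>lebesgue)
          \<le> ennreal k * (\<integral>\<^sup>+ x\<in>(case c of (a, l) \<Rightarrow> cube a l). 1 \<partial>lebesgue)"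
        by simp
    qed (use g in \<open>auto split: prod.splits\<close>)
    then show ?thesis by simp
  qed
  have "wmeasure v E \<le> ennreal (c1 * lam) * emeasure lebesgue E"
    unfolding wmeasure_def using single c lam_pos by (intro gen) (auto simp: wmeasure_def)
  also have "\<dots> \<le> ennreal (level_const TYPE('n) * lam) * emeasure lebesgue E"
    unfolding big using c lam_pos by (intro mult_right_mono ennreal_leI) auto
  finally show "wmeasure v E \<le> ennreal (level_const TYPE('n) * lam) * emeasure lebesgue E" .
  show "(\<integral>\<^sup>+ x\<in>E. F x \<partial>lebesgue) \<le> ennreal (level_const TYPE('n) * H * lam) * emeasure lebesgue E"
    unfolding big using single c lam_pos H by (intro gen) auto
qed

section \<open>Reverse Hoelder inequality and self-improvement of the Muckenhoupt condition\<close>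

lemma two_powr_le:
  assumes "0 < e" "e < (1::real)"
  shows "2 powr e - 1 \<le> e"
  using Youngs_inequality_0[of e "1 - e" 2 1] assms by simp

lemma sum_powers_le_twice_last:
  fixes q :: real
  assumes "q \<ge> 2"
  shows "(\<Sum>k<Suc N. q ^ k) \<le> 2 * q ^ N"
proof (induction N)
  case (Suc N)
  have "(\<Sum>k<Suc (Suc N). q ^ k) \<le> 2 * q ^ N + q ^ Suc N" using Suc by simp
  also have "2 * q ^ N \<le> q ^ Suc N" using assms by (simp add: mult_right_mono)
  finally show ?case by simp
qed simp

lemma ennreal_absorb_half:
  fixes x :: ennreal
  assumes "x \<le> ennreal a + ennreal (1/2) * x" "x < top" "a \<ge> 0"
  shows "x \<le> ennreal (2 * a)"
proof -
  obtain r where r: "x = ennreal r" "r \<ge> 0" using assms(2) by (cases x) auto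
  have "ennreal r \<le> ennreal (a + 1/2 * r)"
  proof -
    have "ennreal (1/2) * ennreal r = ennreal (1/2 * r)" using r by (intro ennreal_mult[symmetric]) auto
    moreover have "ennreal (a + 1/2 * r) = ennreal a + ennreal (1/2 * r)"
      using assms r by (intro ennreal_plus) auto
    ultimately show ?thesis using assms(1) unfolding r(1) by metis
  qed
  then have "r \<le> a + 1/2 * r" using assms r by (subst (asm) ennreal_le_iff) auto
  then show ?thesis unfolding r by (intro ennreal_leI) simp
qed

text \<open>The functions \<open>T N\<close> below are dyadic step functions that increase to a majorant of \<open>(F / lam0) powr e\<close> where
  \<open>F > lam0\<close>; they replace the layer cake formula by a finite sum. Summation by levels turns the hypothesis on \<open>F\<close> into
  \<open>\<integral> F T \<le> \<integral> F + 2 e \<kappa> H \<integral> F T\<close>, and since \<open>e \<kappa> H = 1/4\<close> the last term can be absorbed: \<open>\<integral> F T \<le> 2 H V\<close>. The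
  hypothesis on \<open>v\<close> gives in the same way \<open>\<integral> v T \<le> V + 2 e \<kappa> \<integral> F T \<le> 2 V\<close>. Truncation at level \<open>N\<close> ensures that the
  absorbed quantity is finite.\<close>

lemma reverse_Hoelder_from_level_sets:
  fixes F :: "'a \<Rightarrow> ennreal" and v :: "'a \<Rightarrow> real"
  assumes F[measurable]: "F \<in> borel_measurable M" and v[measurable]: "v \<in> borel_measurable M"
    and nonneg: "\<And>x. v x \<ge> 0" and le: "AE x in M. ennreal (v x) \<le> F x"
    and lam0: "lam0 > 0" and \<kappa>: "\<kappa> \<ge> 1" and H: "H \<ge> 1" and V: "V \<ge> 0"
    and levF: "\<And>lam. lam \<ge> lam0 \<Longrightarrow> (\<integral>\<^sup>+ x\<in>{x \<in> space M. ennreal lam < F x}. F x \<partial>M)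
        \<le> ennreal (\<kappa> * H * lam) * emeasure M {x \<in> space M. ennreal lam < F x}"
    and levv: "\<And>lam. lam \<ge> lam0 \<Longrightarrow> (\<integral>\<^sup>+ x\<in>{x \<in> space M. ennreal lam < F x}. ennreal (v x) \<partial>M)
        \<le> ennreal (\<kappa> * lam) * emeasure M {x \<in> space M. ennreal lam < F x}"
    and intF: "(\<integral>\<^sup>+ x. F x \<partial>M) \<le> ennreal (H * V)" and intv: "(\<integral>\<^sup>+ x. ennreal (v x) \<partial>M) = ennreal V"
    and e: "e = 1 / (4 * \<kappa> * H)"
  shows "(\<integral>\<^sup>+ x. ennreal (v x powr (1 + e)) \<partial>M) \<le> ennreal (2 * lam0 powr e * V)"
proof -
  have e01: "0 < e" "e < 1"
  proof -
    have "\<kappa> * H \<ge> 1 * 1" using \<kappa> H by (intro mult_mono) auto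
    then have *: "4 * \<kappa> * H > 1" by simp
    show "0 < e" unfolding e using \<kappa> H by (intro divide_pos_pos mult_pos_pos) auto
    show "e < 1" unfolding e using * by (subst divide_less_eq_1_pos) linarith+
  qed
  have eH: "e * \<kappa> * H = 1/4" using \<kappa> H by (simp add: e)
  define q where "q = 2 powr e"
  have q: "q > 1" "q - 1 \<le> e" using two_powr_le[OF e01] e01 by (auto simp: q_def)
  define E where "E = (\<lambda>k::nat. {x \<in> space M. ennreal (2 ^ k * lam0) < F x})"
  have [measurable]: "E k \<in> sets M" for k unfolding E_def by measurable
  define d where "d = (\<lambda>k::nat. q ^ Suc k - q ^ k)"
  have d: "0 \<le> d k" "d k \<le> e * q ^ k" for k
    using q mult_right_mono[of "q - 1" e "q ^ k"] by (auto simp: d_def algebra_simps)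
  define T where "T = (\<lambda>N x. 1 + (\<Sum>k<N. ennreal (d k) * indicator (E k) x))"
  have [measurable]: "T N \<in> borel_measurable M" for N unfolding T_def by measurable
  have T_all: "T N x = ennreal (q ^ N)" if "\<And>k. k < N \<Longrightarrow> x \<in> E k" for N x
  proof -
    have "T N x = 1 + (\<Sum>k<N. ennreal (d k))" unfolding T_def using that by simp
    also have "\<dots> = ennreal (1 + (\<Sum>k<N. d k))"
      using d by (simp add: sum_ennreal sum_nonneg ennreal_plus)
    also have "(\<Sum>k<N. d k) = q ^ N - 1" unfolding d_def using sum_lessThan_telescope[of "\<lambda>k. q ^ k" N] by simp
    finally show ?thesis by simp
  qed
  have T_le: "T N x \<le> ennreal (q ^ N)" for N x
  proof -
    have "T N x \<le> 1 + (\<Sum>k<N. ennreal (d k))"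
      unfolding T_def by (intro add_left_mono sum_mono) (auto simp: indicator_def)
    also have "\<dots> = ennreal (1 + (\<Sum>k<N. d k))"
      using d by (simp add: sum_ennreal sum_nonneg ennreal_plus)
    also have "(\<Sum>k<N. d k) = q ^ N - 1" unfolding d_def using sum_lessThan_telescope[of "\<lambda>k. q ^ k" N] by simp
    finally show ?thesis by simp
  qed
  have T_mono: "T N x \<le> T N' x" if "N \<le> N'" for N N' x
    unfolding T_def using that by (intro add_left_mono sum_mono2) auto
  define S where "S = (\<lambda>N x. \<Sum>k<N. ennreal (lam0 * (2 * q) ^ k) * indicator (E k) x)"
  have [measurable]: "S N \<in> borel_measurable M" for N unfolding S_def by measurable
  \<comment> \<open>If \<open>N\<close> is the last level exceeded by \<open>F x\<close>, the sum \<open>S\<close> is at most twice its last term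
    \<open>lam0 * 2\<^sup>N * q\<^sup>N\<close>, and \<open>F x > lam0 * 2\<^sup>N\<close> and \<open>T (Suc N) x = q\<^sup>N\<^sup>+\<^sup>1\<close>.\<close>
  have S_le: "S N x \<le> 2 * (F x * T N x)" if x: "x \<in> space M" for N x
  proof (induction N)
    case 0 then show ?case by (simp add: S_def)
  next
    case (Suc N)
    show ?case
    proof (cases "x \<in> E N")
      case False
      then have "indicator (E N) x = (0 :: ennreal)" by simp
      then have "S (Suc N) x = S N x" "T (Suc N) x = T N x"
        by (simp_all only: S_def T_def sum.lessThan_Suc mult_zero_right add_0_right)
      then show ?thesis using Suc by simp
    next
      case True
      have sub: "x \<in> E k" if "k \<le> N" for k
      proof -
        have "ennreal (2 ^ k * lam0) \<le> ennreal (2 ^ N * lam0)"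
          using that lam0 by (intro ennreal_leI mult_right_mono power_increasing) auto
        also have "\<dots> < F x" using True by (simp add: E_def)
        finally show ?thesis using x by (simp add: E_def)
      qed
      have "S (Suc N) x = (\<Sum>k<Suc N. ennreal (lam0 * (2 * q) ^ k))"
        unfolding S_def using sub by (intro sum.cong) auto
      also have "\<dots> = ennreal (\<Sum>k<Suc N. lam0 * (2 * q) ^ k)"
        using lam0 q by (intro sum_ennreal) auto
      also have "\<dots> \<le> ennreal (2 * (2 ^ N * lam0 * q ^ N))"
      proof (rule ennreal_leI)
        have "(\<Sum>k<Suc N. lam0 * (2 * q) ^ k) = lam0 * (\<Sum>k<Suc N. (2 * q) ^ k)"
          by (simp only: sum_distrib_left)
        also have "\<dots> \<le> lam0 * (2 * (2 * q) ^ N)"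
          using lam0 q by (intro mult_left_mono sum_powers_le_twice_last) auto
        finally show "(\<Sum>k<Suc N. lam0 * (2 * q) ^ k) \<le> 2 * (2 ^ N * lam0 * q ^ N)"
          by (simp add: power_mult_distrib mult_ac)
      qed
      also have "\<dots> \<le> ennreal (2 * (2 ^ N * lam0 * q ^ Suc N))"
        using lam0 q by (intro ennreal_leI mult_left_mono power_increasing) auto
      also have "\<dots> = 2 * (ennreal (2 ^ N * lam0) * ennreal (q ^ Suc N))"
        using lam0 q by (simp add: ennreal_mult mult_ac)
      also have "\<dots> \<le> 2 * (F x * T (Suc N) x)"
        using True sub T_all[of "Suc N" x] by (intro mult_left_mono mult_mono) (auto simp: E_def less_imp_le)
      finally show ?thesis .
    qed
  qed
  \<comment> \<open>Summation by levels, once for \<open>g = F\<close> with \<open>h = H\<close> and once for \<open>g = v\<close> with \<open>h = 1\<close>.\<close>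
  have main: "(\<integral>\<^sup>+ x. g x * T N x \<partial>M) \<le> (\<integral>\<^sup>+ x. g x \<partial>M) + ennreal (2 * e * \<kappa> * h) * (\<integral>\<^sup>+ x. F x * T N x \<partial>M)"
    if g[measurable]: "g \<in> borel_measurable M" and h: "h \<ge> 0"
      and lev: "\<And>lam. lam \<ge> lam0 \<Longrightarrow> (\<integral>\<^sup>+ x\<in>{x \<in> space M. ennreal lam < F x}. g x \<partial>M)
        \<le> ennreal (\<kappa> * h * lam) * emeasure M {x \<in> space M. ennreal lam < F x}"
    for g h N
  proof -
    have "(\<integral>\<^sup>+ x. g x * T N x \<partial>M) = (\<integral>\<^sup>+ x. g x + (\<Sum>k<N. ennreal (d k) * (g x * indicator (E k) x)) \<partial>M)"
      unfolding T_def by (intro nn_integral_cong) (simp only: distrib_left mult_1_right mult_1_left sum_distrib_left mult_ac)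
    also have "\<dots> = (\<integral>\<^sup>+ x. g x \<partial>M) + (\<Sum>k<N. ennreal (d k) * (\<integral>\<^sup>+ x\<in>E k. g x \<partial>M))"
      by (simp add: nn_integral_add nn_integral_sum nn_integral_cmult)
    also have "(\<Sum>k<N. ennreal (d k) * (\<integral>\<^sup>+ x\<in>E k. g x \<partial>M))
        \<le> (\<Sum>k<N. ennreal (e * \<kappa> * h) * (ennreal (lam0 * (2 * q) ^ k) * emeasure M (E k)))"
    proof (rule sum_mono)
      fix k
      have "lam0 \<le> 2 ^ k * lam0" using lam0 by simp
      then have "(\<integral>\<^sup>+ x\<in>E k. g x \<partial>M) \<le> ennreal (\<kappa> * h * (2 ^ k * lam0)) * emeasure M (E k)"
        unfolding E_def by (rule lev)
      then have "ennreal (d k) * (\<integral>\<^sup>+ x\<in>E k. g x \<partial>M)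
          \<le> ennreal (e * q ^ k) * (ennreal (\<kappa> * h * (2 ^ k * lam0)) * emeasure M (E k))"
        using d by (intro mult_mono ennreal_leI) auto
      also have "\<dots> = ennreal (e * \<kappa> * h) * (ennreal (lam0 * (2 * q) ^ k) * emeasure M (E k))"
      proof -
        have "ennreal (e * q ^ k) * ennreal (\<kappa> * h * (2 ^ k * lam0)) = ennreal (e * \<kappa> * h) * ennreal (lam0 * (2 * q) ^ k)"
          using e01 q \<kappa> h lam0 by (simp add: power_mult_distrib mult_ac flip: ennreal_mult)
        then show ?thesis by (simp flip: mult.assoc)
      qed
      finally show "ennreal (d k) * (\<integral>\<^sup>+ x\<in>E k. g x \<partial>M)
          \<le> ennreal (e * \<kappa> * h) * (ennreal (lam0 * (2 * q) ^ k) * emeasure M (E k))" .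
    qed
    also have "\<dots> = ennreal (e * \<kappa> * h) * (\<integral>\<^sup>+ x. S N x \<partial>M)"
    proof -
      have "(\<integral>\<^sup>+ x. S N x \<partial>M) = (\<Sum>k<N. \<integral>\<^sup>+ x. ennreal (lam0 * (2 * q) ^ k) * indicator (E k) x \<partial>M)"
        unfolding S_def by (rule nn_integral_sum) measurable
      also have "\<dots> = (\<Sum>k<N. ennreal (lam0 * (2 * q) ^ k) * emeasure M (E k))"
        by (intro sum.cong nn_integral_cmult_indicator) auto
      finally show ?thesis by (simp only: sum_distrib_left)
    qed
    also have "(\<integral>\<^sup>+ x. S N x \<partial>M) \<le> (\<integral>\<^sup>+ x. 2 * (F x * T N x) \<partial>M)"
      by (intro nn_integral_mono S_le) auto
    also have "\<dots> = 2 * (\<integral>\<^sup>+ x. F x * T N x \<partial>M)" by (simp add: nn_integral_cmult)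
    finally have "(\<integral>\<^sup>+ x. g x * T N x \<partial>M) \<le> (\<integral>\<^sup>+ x. g x \<partial>M) + ennreal (e * \<kappa> * h) * (2 * (\<integral>\<^sup>+ x. F x * T N x \<partial>M))"
      by (simp add: add_left_mono mult_left_mono)
    also have "ennreal (e * \<kappa> * h) * (2 * (\<integral>\<^sup>+ x. F x * T N x \<partial>M)) = ennreal (2 * e * \<kappa> * h) * (\<integral>\<^sup>+ x. F x * T N x \<partial>M)"
      using e01 \<kappa> h by (simp add: ennreal_mult mult_ac)
    finally show ?thesis .
  qed
  have FT: "(\<integral>\<^sup>+ x. F x * T N x \<partial>M) \<le> ennreal (2 * (H * V))" for N
  proof (rule ennreal_absorb_half)
    have "(\<integral>\<^sup>+ x. F x * T N x \<partial>M) \<le> (\<integral>\<^sup>+ x. F x \<partial>M) + ennreal (2 * e * \<kappa> * H) * (\<integral>\<^sup>+ x. F x * T N x \<partial>M)"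
      using levF H by (intro main) auto
    also have "2 * e * \<kappa> * H = 1/2" using eH by simp
    also have "(\<integral>\<^sup>+ x. F x \<partial>M) + ennreal (1/2) * (\<integral>\<^sup>+ x. F x * T N x \<partial>M)
        \<le> ennreal (H * V) + ennreal (1/2) * (\<integral>\<^sup>+ x. F x * T N x \<partial>M)" by (intro add_right_mono intF)
    finally show "(\<integral>\<^sup>+ x. F x * T N x \<partial>M) \<le> ennreal (H * V) + ennreal (1/2) * (\<integral>\<^sup>+ x. F x * T N x \<partial>M)" .
    have "(\<integral>\<^sup>+ x. F x * T N x \<partial>M) \<le> (\<integral>\<^sup>+ x. F x * ennreal (q ^ N) \<partial>M)"
      by (intro nn_integral_mono mult_left_mono T_le) auto
    also have "\<dots> = (\<integral>\<^sup>+ x. F x \<partial>M) * ennreal (q ^ N)" by (simp add: nn_integral_multc)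
    also have "\<dots> \<le> ennreal (H * V) * ennreal (q ^ N)" by (intro mult_right_mono intF) auto
    also have "\<dots> < top" by (simp add: ennreal_mult_less_top)
    finally show "(\<integral>\<^sup>+ x. F x * T N x \<partial>M) < top" .
    show "H * V \<ge> 0" using H V by simp
  qed
  have vT: "(\<integral>\<^sup>+ x. ennreal (v x) * T N x \<partial>M) \<le> ennreal (2 * V)" for N
  proof -
    have "(\<integral>\<^sup>+ x. ennreal (v x) * T N x \<partial>M) \<le> (\<integral>\<^sup>+ x. ennreal (v x) \<partial>M) + ennreal (2 * e * \<kappa> * 1) * (\<integral>\<^sup>+ x. F x * T N x \<partial>M)"
      using levv by (intro main) auto
    also have "\<dots> \<le> ennreal V + ennreal (2 * e * \<kappa> * 1) * ennreal (2 * (H * V))"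
      unfolding intv by (intro add_left_mono mult_left_mono FT) auto
    also have "\<dots> = ennreal (V + (e * \<kappa> * H) * 4 * V)"
      using V H \<kappa> e01 by (simp add: mult_ac flip: ennreal_mult ennreal_plus)
    also have "\<dots> = ennreal (2 * V)" by (simp add: eH)
    finally show ?thesis .
  qed
  have "AE x in M. ennreal (v x powr (1 + e)) \<le> ennreal (lam0 powr e) * (SUP N. ennreal (v x) * T N x)"
    using le AE_space
  proof eventually_elim
    case (elim x)
    have "\<exists>N. ennreal (v x powr (1 + e)) \<le> ennreal (lam0 powr e) * (ennreal (v x) * T N x)"
    proof (cases "v x \<le> lam0")
      case True
      have "v x powr (1 + e) \<le> v x * lam0 powr e"
        using nonneg[of x] True e01 by (auto simp: powr_add intro!: mult_left_mono powr_mono2)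
      then have "ennreal (v x powr (1 + e)) \<le> ennreal (lam0 powr e) * (ennreal (v x) * T 0 x)"
        using nonneg[of x] by (simp add: T_def mult.commute ennreal_leI flip: ennreal_mult)
      then show ?thesis by blast
    next
      case False
      obtain m :: nat where "v x / lam0 < 2 ^ m" using real_arch_pow[of 2 "v x / lam0"] by auto
      then have ex: "\<exists>m. v x \<le> 2 ^ m * lam0" using lam0 by (auto simp: field_simps intro: less_imp_le)
      define N where "N = (LEAST m. v x \<le> 2 ^ m * lam0)"
      have N: "v x \<le> 2 ^ N * lam0" unfolding N_def using ex by (rule LeastI_ex)
      have "x \<in> E k" if "k < N" for k
      proof -
        have "\<not> v x \<le> 2 ^ k * lam0" using that unfolding N_def by (rule not_less_Least)
        then have "ennreal (2 ^ k * lam0) < ennreal (v x)" using lam0 by (simp add: ennreal_less_iff)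
        also have "\<dots> \<le> F x" by (rule elim)
        finally show ?thesis using elim by (simp add: E_def)
      qed
      then have TN: "T N x = ennreal (q ^ N)" by (rule T_all)
      have "v x powr e \<le> (2 ^ N * lam0) powr e" using N nonneg[of x] e01 by (intro powr_mono2) auto
      also have "\<dots> = lam0 powr e * q ^ N"
        using lam0 by (simp add: powr_mult q_def powr_realpow[symmetric] powr_powr mult_ac)
      finally have "v x * v x powr e \<le> v x * (lam0 powr e * q ^ N)"
        using nonneg by (intro mult_left_mono) auto
      then have "v x powr (1 + e) \<le> lam0 powr e * (v x * q ^ N)"
        using False lam0 by (simp add: powr_add mult_ac)
      then have "ennreal (v x powr (1 + e)) \<le> ennreal (lam0 powr e) * (ennreal (v x) * T N x)"
        unfolding TN using nonneg[of x] q lam0 by (simp add: ennreal_leI flip: ennreal_mult)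
      then show ?thesis by blast
    qed
    then obtain N where "ennreal (v x powr (1 + e)) \<le> ennreal (lam0 powr e) * (ennreal (v x) * T N x)" by blast
    also have "\<dots> \<le> ennreal (lam0 powr e) * (SUP N. ennreal (v x) * T N x)"
      by (intro mult_left_mono SUP_upper) auto
    finally show ?case .
  qed
  then have "(\<integral>\<^sup>+ x. ennreal (v x powr (1 + e)) \<partial>M)
      \<le> (\<integral>\<^sup>+ x. ennreal (lam0 powr e) * (SUP N. ennreal (v x) * T N x) \<partial>M)"
    by (rule nn_integral_mono_AE)
  also have "\<dots> = ennreal (lam0 powr e) * (\<integral>\<^sup>+ x. (SUP N. ennreal (v x) * T N x) \<partial>M)"
    by (intro nn_integral_cmult) measurable
  also have "(\<integral>\<^sup>+ x. (SUP N. ennreal (v x) * T N x) \<partial>M) = (SUP N. \<integral>\<^sup>+ x. ennreal (v x) * T N x \<partial>M)"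
    by (intro nn_integral_monotone_convergence_SUP)
      (auto simp: incseq_def le_fun_def intro!: mult_left_mono T_mono)
  also have "\<dots> \<le> ennreal (2 * V)" by (intro SUP_least vT)
  finally have "(\<integral>\<^sup>+ x. ennreal (v x powr (1 + e)) \<partial>M) \<le> ennreal (lam0 powr e) * ennreal (2 * V)"
    by (simp add: mult_left_mono)
  also have "\<dots> = ennreal (2 * lam0 powr e * V)"
    using V by (simp add: mult_ac flip: ennreal_mult)
  finally show ?thesis .
qed

text \<open>The exponent exceeds 1 by a quantity inversely proportional to the Fujii-Wilson constant, while the constant in front stays
  bounded. Both features are essential for the sharp dependence in the upper bound.\<close>

theorem reverse_Hoelder_Ainf:
  fixes v :: "real ^ 'n \<Rightarrow> real"
  assumes v: "weight v" and nonneg: "\<And>x. v x \<ge> 0"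
    and H: "Ainf_const v \<le> ennreal H" "H \<ge> 1" and L: "L > 0"
    and e: "e = 1 / (4 * level_const TYPE('n) * H)" and big: "level_const TYPE('n) \<ge> 1"
  shows "avg (cube b L) (\<lambda>x. ennreal (v x powr (1 + e)))
      \<le> 2 * epowr (avg (cube b L) (\<lambda>x. ennreal (v x))) (1 + e)"
proof -
  define n where "n = CARD('n)"
  define Q where "Q = cube b L"
  have [measurable]: "v \<in> borel_measurable lebesgue" "Q \<in> sets lebesgue"
    using weightD[OF v] by (auto simp: Q_def)
  have Ln: "L ^ n > 0" using L by simp
  obtain V where V: "wmeasure v Q = ennreal V" "V > 0"
    using wmeasure_cube_pos[OF weightD(1,3)[OF v] L, of b] weightD(4)[OF v, of b "b + vec L"]
    unfolding Q_def by (cases "wmeasure v (cube b L)") (auto simp: ennreal_eq_0_iff)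
  define lam0 where "lam0 = V / L ^ n"
  have lam0: "lam0 > 0" "V = lam0 * L ^ n" using V Ln L by (simp_all add: lam0_def)
  define F where "F = hl_maximal (\<lambda>y. v y * indicator Q y)"
  have [measurable]: "F \<in> borel_measurable lebesgue" unfolding F_def by measurable
  have lev_eq: "{x \<in> space lebesgue. ennreal lam < F x * indicator Q x} = {x \<in> cube b L. ennreal lam < hl_maximal (\<lambda>y. v y * indicator (cube b L) y) x}"
    for lam by (auto simp: F_def Q_def indicator_def split: if_splits)
  have lev_int: "(\<integral>\<^sup>+ x\<in>{x \<in> cube b L. P x}. g x * indicator Q x \<partial>lebesgue) = (\<integral>\<^sup>+ x\<in>{x \<in> cube b L. P x}. g x \<partial>lebesgue)"
    for P and g :: "real ^ 'n \<Rightarrow> ennreal" by (intro nn_integral_cong) (auto simp: Q_def indicator_def)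
  have vi: "ennreal (v x * indicator Q x) = ennreal (v x) * indicator Q x" for x
    by (auto simp: indicator_def)
  have "(\<integral>\<^sup>+ x. ennreal ((v x * indicator Q x) powr (1 + e)) \<partial>lebesgue) \<le> ennreal (2 * lam0 powr e * V)"
  proof (rule reverse_Hoelder_from_level_sets[where F = "\<lambda>x. F x * indicator Q x" and H = H])
    show "AE x in lebesgue. ennreal (v x * indicator Q x) \<le> F x * indicator Q x"
      using AE_cube_le_hl_maximal[OF weightD(2)[OF v], of b L]
      by eventually_elim (auto simp: F_def Q_def indicator_def)
    show "(\<integral>\<^sup>+ x. F x * indicator Q x \<partial>lebesgue) \<le> ennreal (H * V)"
    proof -
      have "(\<integral>\<^sup>+ x\<in>Q. F x \<partial>lebesgue) \<le> ennreal H * wmeasure v Q"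
        using H(1) L unfolding Ainf_const_le_iff[OF v] F_def Q_def by blast
      then show ?thesis using V H by (simp add: ennreal_mult)
    qed
    show "(\<integral>\<^sup>+ x. ennreal (v x * indicator Q x) \<partial>lebesgue) = ennreal V"
      using V by (simp add: vi wmeasure_def)
    fix lam assume lam: "lam0 \<le> lam"
    have w0: "wmeasure v (cube b L) = ennreal (lam0 * L ^ CARD('n))"
      using V lam0 by (simp add: Q_def n_def)
    note lev = hl_maximal_level_sets[OF v nonneg H L w0 lam0(1) lam]
    show "(\<integral>\<^sup>+ x\<in>{x \<in> space lebesgue. ennreal lam < F x * indicator Q x}. F x * indicator Q x \<partial>lebesgue)
        \<le> ennreal (level_const TYPE('n) * H * lam) * emeasure lebesgue {x \<in> space lebesgue. ennreal lam < F x * indicator Q x}"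
      unfolding lev_eq lev_int using lev(2) by (simp add: F_def Q_def)
    show "(\<integral>\<^sup>+ x\<in>{x \<in> space lebesgue. ennreal lam < F x * indicator Q x}. ennreal (v x * indicator Q x) \<partial>lebesgue)
        \<le> ennreal (level_const TYPE('n) * lam) * emeasure lebesgue {x \<in> space lebesgue. ennreal lam < F x * indicator Q x}"
      unfolding lev_eq vi lev_int using lev(1) by (simp add: wmeasure_def)
  qed (use nonneg lam0 big H V e in \<open>auto simp: indicator_def\<close>)
  also have "(\<integral>\<^sup>+ x. ennreal ((v x * indicator Q x) powr (1 + e)) \<partial>lebesgue)
      = (\<integral>\<^sup>+ x\<in>Q. ennreal (v x powr (1 + e)) \<partial>lebesgue)"
    by (intro nn_integral_cong) (auto simp: indicator_def)
  finally have le: "(\<integral>\<^sup>+ x\<in>Q. ennreal (v x powr (1 + e)) \<partial>lebesgue) \<le> ennreal (2 * lam0 powr e * V)" .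
  have avg: "avg Q (\<lambda>x. ennreal (v x)) = ennreal lam0"
  proof -
    have "avg Q (\<lambda>x. ennreal (v x)) = wmeasure v Q / ennreal (L ^ n)"
      unfolding Q_def using L by (simp add: avg_cube wmeasure_def n_def)
    also have "\<dots> = ennreal lam0"
      unfolding V(1) lam0_def using V(2) Ln by (intro divide_ennreal) auto
    finally show ?thesis .
  qed
  have "2 * epowr (avg Q (\<lambda>x. ennreal (v x))) (1 + e) * ennreal (L ^ n) = ennreal (2 * lam0 powr e * V)"
  proof -
    have "ennreal (2 * lam0 powr e * V) = ennreal (2 * lam0 powr (1 + e) * L ^ n)"
      using lam0 by (simp add: powr_add mult_ac)
    also have "\<dots> = 2 * ennreal (lam0 powr (1 + e)) * ennreal (L ^ n)"
      using Ln by (simp add: ennreal_mult)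
    finally show ?thesis unfolding avg using lam0 by (simp add: epowr_ennreal)
  qed
  then show ?thesis using le L unfolding Q_def n_def by (simp add: avg_le_iff)
qed

lemma level_const_ge: "level_const TYPE('n::finite) \<ge> 1"
proof -
  have "(dilation_factor TYPE('n) + 2) ^ CARD('n) \<ge> 1" "(2 * dilation_factor TYPE('n) + 1) ^ CARD('n) \<ge> 1"
    using dilation_factor_ge[where 'n = 'n] by auto
  then have "(dilation_factor TYPE('n) + 2) ^ CARD('n) * ((2 * dilation_factor TYPE('n) + 1) ^ CARD('n) + 1) \<ge> 1 * 1"
    by (intro mult_mono) auto
  then show ?thesis by (simp add: level_const_def)
qed

lemma conj_exp_identities:
  assumes "p > 1"
  shows "1 - conj_exp p = - (1 / (p - 1))" "(p - 1) * (1 - conj_exp p) = -1" "conj_exp p > 1"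
  using assms by (auto simp: conj_exp_def field_simps)

lemma locally_integrableI:
  fixes v :: "real ^ 'n \<Rightarrow> real"
  assumes [measurable]: "v \<in> borel_measurable lebesgue" and nonneg: "\<And>x. v x \<ge> 0"
    and fin: "\<And>a l. l > 0 \<Longrightarrow> wmeasure v (cube a l) < top"
  shows "locally_integrable v"
  unfolding locally_integrable_def
proof (intro conjI allI impI)
  fix K :: "(real ^ 'n) set" assume K: "compact K"
  then obtain B where B: "B > 0" "\<And>x. x \<in> K \<Longrightarrow> norm x \<le> B"
    using compact_imp_bounded bounded_pos by metis
  define Q where "Q = cube (- vec B :: real ^ 'n) (2 * B)"
  have [measurable]: "Q \<in> sets lebesgue" by (simp add: Q_def)
  have "K \<subseteq> Q"
  proof
    fix x assume "x \<in> K"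
    then have "\<bar>x $ i\<bar> \<le> B" for i using B(2) component_le_norm_cart order_trans by blast
    then have "- B \<le> x $ i \<and> x $ i \<le> B" for i by (simp add: abs_le_iff) (metis minus_le_iff)
    then show "x \<in> Q" unfolding Q_def mem_cube by simp
  qed
  have "set_integrable lebesgue Q v"
    unfolding set_integrable_def
  proof (rule integrableI_bounded)
    have "(\<integral>\<^sup>+ x. ennreal (norm (indicator Q x *\<^sub>R v x)) \<partial>lebesgue) = wmeasure v Q"
      unfolding wmeasure_def using nonneg by (intro nn_integral_cong) (auto simp: indicator_def)
    also have "\<dots> < top" unfolding Q_def using B by (intro fin) auto
    finally show "(\<integral>\<^sup>+ x. ennreal (norm (indicator Q x *\<^sub>R v x)) \<partial>lebesgue) < \<infinity>" by simp
  qed measurable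
  moreover have "K \<in> sets lebesgue" using K by (simp add: borel_compact)
  ultimately show "set_integrable lebesgue K v" using \<open>K \<subseteq> Q\<close> by (rule set_integrable_subset)
qed (fact assms)

lemma dual_weight_measurable [measurable]:
  "w \<in> borel_measurable lebesgue \<Longrightarrow> dual_weight p w \<in> borel_measurable lebesgue"
  unfolding dual_weight_def by measurable

lemma dual_weight_nonneg: "dual_weight p w x \<ge> 0"
  by (simp add: dual_weight_def)

text \<open>If \<open>\<sigma>\<close> were not integrable over some cube, the product defining the \<open>A\<^sub>p\<close> constant would be infinite there, because
  \<open>w\<close> has positive integral over every cube.\<close>

lemma weight_dual_weight:
  fixes w :: "real ^ 'n \<Rightarrow> real"
  assumes p: "p > 1" and w: "w \<in> Ap p"
  shows "weight (dual_weight p w)"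
proof -
  have ww: "weight w" and fin: "Ap_const p w < top" using w by (auto simp: Ap_def)
  note [measurable] = weightD(1)[OF ww]
  have "AE x in lebesgue. dual_weight p w x > 0"
    using weightD(3)[OF ww] by eventually_elim (simp add: dual_weight_def)
  moreover have "locally_integrable (dual_weight p w)"
  proof (rule locally_integrableI)
    fix a :: "real ^ 'n" and l :: real assume l: "l > 0"
    have "wmeasure w (cube a l) * epowr (wmeasure (dual_weight p w) (cube a l)) (p - 1)
        \<le> Ap_const p w * ennreal ((l ^ CARD('n)) powr p)"
      using Ap_const_cube_le[OF p l, of w a] by (simp add: wmeasure_def dual_weight_def)
    also have "\<dots> < top" using fin by (simp add: ennreal_mult_less_top)
    finally have "epowr (wmeasure (dual_weight p w) (cube a l)) (p - 1) \<noteq> top"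
      using wmeasure_cube_pos[OF weightD(1,3)[OF ww] l, of a]
      by (auto simp: ennreal_mult_top split: if_splits)
    then show "wmeasure (dual_weight p w) (cube a l) < top"
      using p by (simp add: epowr_eq_top_iff less_top)
  qed (auto simp: dual_weight_nonneg)
  ultimately show ?thesis by (simp add: weight_def)
qed

lemma Ap_const_ge_1:
  fixes w :: "real ^ 'n \<Rightarrow> real"
  assumes p: "p > 1" and w: "weight w"
  shows "Ap_const p w \<ge> 1"
proof -
  let ?Q = "cube (0 :: real ^ 'n) 1"
  have "epowr (\<integral>\<^sup>+ x\<in>?Q. ennreal \<bar>1\<bar> \<partial>lebesgue) p
    \<le> (\<integral>\<^sup>+ x\<in>?Q. epowr (ennreal \<bar>1\<bar>) p * ennreal (w x) \<partial>lebesgue) *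
       epowr (\<integral>\<^sup>+ x\<in>?Q. ennreal (w x powr (1 - conj_exp p)) \<partial>lebesgue) (p - 1)"
    using p weightD[OF w] by (intro set_nn_integral_Holder_weighted) (auto simp del: vec_1 vec_0)
  then have "1 \<le> wmeasure w ?Q * epowr (\<integral>\<^sup>+ x\<in>?Q. ennreal (w x powr (1 - conj_exp p)) \<partial>lebesgue) (p - 1)"
    using emeasure_cube[of 1 "0 :: real ^ 'n"] by (simp add: wmeasure_def)
  also have "\<dots> \<le> Ap_const p w * ennreal ((1 ^ CARD('n)) powr p)"
    using p by (intro Ap_const_cube_le) auto
  finally show ?thesis by simp
qed

text \<open>The exponent \<open>r\<close> is the one for which \<open>w powr (1 - r') = \<sigma> powr (1 + e)\<close>, so the reverse Hoelder inequality for \<open>\<sigma>\<close>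
  compares the two products that define the constants.\<close>

theorem Ap_const_self_improvement:
  fixes w :: "real ^ 'n \<Rightarrow> real"
  assumes p: "p > 1" and w: "w \<in> Ap p"
    and H: "Ainf_const (dual_weight p w) \<le> ennreal H" "H \<ge> 1"
    and e: "e = 1 / (4 * level_const TYPE('n) * H)"
    and r: "r = 1 + (p - 1) / (1 + e)"
  shows "Ap_const r w \<le> ennreal (2 powr (p - 1)) * Ap_const p w"
proof -
  have e0: "e > 0" unfolding e using level_const_ge[where 'n = 'n] H by (intro divide_pos_pos mult_pos_pos) auto
  have r1: "r - 1 > 0" using p e0 by (simp add: r)
  have "r - 1 = (p - 1) / (1 + e)" by (simp add: r)
  also have "\<dots> \<le> (p - 1) / 1" using p e0 by (intro divide_left_mono) auto
  finally have r2: "r - 1 \<le> p - 1" by simp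
  have re: "(1 + e) * (r - 1) = p - 1" using e0 by (simp add: r)
  have exps: "(1 - conj_exp p) * (1 + e) = 1 - conj_exp r"
  proof -
    have "1 - conj_exp r = - (1 / (r - 1))" using r1 by (intro conj_exp_identities) auto
    also have "\<dots> = - ((1 + e) / (p - 1))" using p e0 by (simp add: r)
    also have "\<dots> = (1 - conj_exp p) * (1 + e)" using conj_exp_identities(1)[OF p] by simp
    finally show ?thesis ..
  qed
  show ?thesis
    unfolding Ap_const_def[of r]
  proof (rule SUP_least)
    fix Q :: "(real ^ 'n) set" assume "Q \<in> cubes"
    then obtain a l where Q: "Q = cube a l" "l > 0" by (rule cubesE)
    define S where "S = avg Q (\<lambda>x. ennreal (dual_weight p w x))"
    have "avg Q (\<lambda>x. ennreal (dual_weight p w x powr (1 + e))) \<le> 2 * epowr S (1 + e)"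
      unfolding S_def Q(1)
      by (rule reverse_Hoelder_Ainf[OF weight_dual_weight[OF p w] dual_weight_nonneg H Q(2) e level_const_ge])
    then have "avg Q (\<lambda>x. ennreal (w x powr (1 - conj_exp r))) \<le> 2 * epowr S (1 + e)"
      by (simp add: dual_weight_def powr_powr exps)
    then have "epowr (avg Q (\<lambda>x. ennreal (w x powr (1 - conj_exp r)))) (r - 1) \<le> epowr (2 * epowr S (1 + e)) (r - 1)"
      using r1 by (intro epowr_mono) auto
    also have "\<dots> = ennreal (2 powr (r - 1)) * epowr S (p - 1)"
      using r1 e0 epowr_ennreal[of 2 "r - 1"] by (simp add: epowr_mult epowr_epowr re)
    also have "\<dots> \<le> ennreal (2 powr (p - 1)) * epowr S (p - 1)"
      using r2 by (intro mult_right_mono ennreal_leI powr_mono) auto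
    finally have "avg Q (\<lambda>x. ennreal (w x)) * epowr (avg Q (\<lambda>x. ennreal (w x powr (1 - conj_exp r)))) (r - 1)
       \<le> avg Q (\<lambda>x. ennreal (w x)) * (ennreal (2 powr (p - 1)) * epowr S (p - 1))"
      by (intro mult_left_mono) auto
    also have "\<dots> = ennreal (2 powr (p - 1)) * (avg Q (\<lambda>x. ennreal (w x)) * epowr S (p - 1))"
      by (simp add: mult_ac)
    also have "\<dots> \<le> ennreal (2 powr (p - 1)) * Ap_const p w"
      unfolding Ap_const_def S_def dual_weight_def using \<open>Q \<in> cubes\<close>
      by (intro mult_left_mono SUP_upper) auto
    finally show "avg Q (\<lambda>x. ennreal (w x)) * epowr (avg Q (\<lambda>x. ennreal (w x powr (1 - conj_exp r)))) (r - 1)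
       \<le> ennreal (2 powr (p - 1)) * Ap_const p w" .
  qed
qed

section \<open>Lorentz quasinorms and dyadic domination\<close>

text \<open>The geometric series with ratio \<open>2 powr (- y)\<close>; only its growth of order \<open>1 / y\<close> for small \<open>y\<close> matters.\<close>

definition dyadic_geom :: "real \<Rightarrow> ennreal" where
  "dyadic_geom y = (\<Sum>k. ennreal (2 powr (- (real k * y))))"

text \<open>By concavity \<open>1 - 2 powr (- y) \<ge> y / 2\<close> for \<open>y \<le> 1\<close>.\<close>

lemma dyadic_geom_le:
  assumes y: "y > 0"
  shows "dyadic_geom y \<le> ennreal (2 / min y 1)"
proof -
  define a where "a = 2 powr (- y)"
  have a: "0 < a" "a \<le> 1 - min y 1 / 2"
  proof -
    show "0 < a" by (simp add: a_def)
    show "a \<le> 1 - min y 1 / 2"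
    proof (cases "y < 1")
      case True
      then have "(1/2) powr y * 1 powr (1 - y) \<le> y * (1/2) + (1 - y) * (1 :: real)"
        using y by (intro Youngs_inequality_0) auto
      moreover have "(1/2) powr y = a" by (simp add: a_def powr_divide powr_minus_divide)
      ultimately show ?thesis using True by simp
    next
      case False
      then have "a \<le> 2 powr (-1)" unfolding a_def by (intro powr_mono) auto
      then show ?thesis using False by (simp add: powr_minus)
    qed
  qed
  have a1: "a < 1" using a y by (auto simp: min_def split: if_splits)
  have "2 powr (- (real k * y)) = a ^ k" for k
    by (simp add: a_def powr_realpow[symmetric] powr_powr mult_ac)
  then have "dyadic_geom y = (\<Sum>k. ennreal (a ^ k))" by (simp add: dyadic_geom_def)
  also have "\<dots> = ennreal (\<Sum>k. a ^ k)"
    using a a1 by (intro suminf_ennreal2 summable_geometric) auto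
  also have "(\<Sum>k. a ^ k) = 1 / (1 - a)" using a a1 by (intro suminf_geometric) auto
  also have "ennreal (1 / (1 - a)) \<le> ennreal (2 / min y 1)"
  proof (rule ennreal_leI)
    have "1 / (1 - a) \<le> 1 / (min y 1 / 2)" using a y by (intro divide_left_mono) (auto simp: a1)
    then show "1 / (1 - a) \<le> 2 / min y 1" by simp
  qed
  finally show ?thesis .
qed

lemma antimono_imp_borel_measurable:
  fixes g :: "real \<Rightarrow> ennreal"
  assumes "\<And>s t. s \<le> t \<Longrightarrow> g t \<le> g s"
  shows "g \<in> borel_measurable borel"
proof (rule borel_measurableI_greater)
  fix c
  have "is_interval {s. c < g s}"
    unfolding is_interval_1 using assms by (auto intro: less_le_trans)
  then have "{s. c < g s} \<in> sets borel" by (rule real_interval_borel_measurable)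
  then show "{s \<in> space borel. c < g s} \<in> sets borel" by simp
qed

lemma nn_integral_dilation_invariant:
  fixes g :: "real \<Rightarrow> ennreal"
  assumes [measurable]: "g \<in> borel_measurable borel" and c: "c > 0"
  shows "(\<integral>\<^sup>+ s\<in>{0<..}. g (c * s) / ennreal s \<partial>lborel) = (\<integral>\<^sup>+ s\<in>{0<..}. g s / ennreal s \<partial>lborel)"
proof -
  have "(\<integral>\<^sup>+ s\<in>{0<..}. g s / ennreal s \<partial>lborel)
     = ennreal \<bar>c\<bar> * (\<integral>\<^sup>+ x. g (0 + c * x) / ennreal (0 + c * x) * indicator {0<..} (0 + c * x) \<partial>lborel)"
    using c by (intro nn_integral_real_affine) auto
  also have "\<dots> = (\<integral>\<^sup>+ x. ennreal c * (g (c * x) / ennreal (c * x) * indicator {0<..} (c * x)) \<partial>lborel)"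
    using c by (simp add: nn_integral_cmult)
  also have "\<dots> = (\<integral>\<^sup>+ s\<in>{0<..}. g (c * s) / ennreal s \<partial>lborel)"
  proof (rule nn_integral_cong)
    fix x :: real
    show "ennreal c * (g (c * x) / ennreal (c * x) * indicator {0<..} (c * x)) = g (c * x) / ennreal x * indicator {0<..} x"
    proof (cases "x > 0")
      case True
      have "ennreal c * (g (c * x) / ennreal (c * x)) = g (c * x) * ennreal c / (ennreal x * ennreal c)"
        using c True by (simp add: ennreal_times_divide ennreal_mult mult_ac)
      also have "\<dots> = g (c * x) / ennreal x" using c by (intro divide_mult_eq) auto
      finally show ?thesis using True c by simp
    next
      case False
      then show ?thesis using c by (simp add: zero_less_mult_iff)
    qed
  qed
  finally show ?thesis ..
qed

text \<open>The Lorentz quasinorm in terms of \<open>\<Phi> s = s powr p * w(|f| > s)\<close>. In this form the remaining measure \<open>ds / s\<close> is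
  invariant under dilations of \<open>s\<close>.\<close>

definition lorentz_functional :: "real \<Rightarrow> ennreal \<Rightarrow> (real \<Rightarrow> ennreal) \<Rightarrow> ennreal" where
  "lorentz_functional p q \<Phi> =
    (if q = top then SUP s\<in>{0<..}. epowr (\<Phi> s) (1 / p)
     else epowr (ennreal p * (\<integral>\<^sup>+ s\<in>{0<..}. epowr (\<Phi> s) (enn2real q / p) / ennreal s \<partial>lborel)) (1 / enn2real q))"

lemma lorentz_norm_eq_functional:
  assumes p: "p > 0" and q: "q > 0"
  shows "lorentz_norm p q w F = lorentz_functional p q (\<lambda>s. ennreal (s powr p) * wmeasure w {x. F x > ennreal s})"
proof (cases "q = top")
  case True
  then show ?thesis
    unfolding lorentz_norm_def lorentz_functional_def
    using p by (auto intro!: SUP_cong simp: epowr_mult epowr_ennreal powr_powr)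
next
  case False
  then have Q: "enn2real q > 0" using q by (simp add: enn2real_positive_iff less_top)
  have "(\<integral>\<^sup>+ s\<in>{0<..}. ennreal (s powr enn2real q) * epowr (wmeasure w {x. F x > ennreal s}) (enn2real q / p) / ennreal s \<partial>lborel)
    = (\<integral>\<^sup>+ s\<in>{0<..}. epowr (ennreal (s powr p) * wmeasure w {x. F x > ennreal s}) (enn2real q / p) / ennreal s \<partial>lborel)"
    using p Q by (intro nn_integral_cong)
      (auto simp: indicator_def epowr_mult epowr_ennreal powr_powr split: if_splits)
  then show ?thesis using False by (simp add: lorentz_norm_def lorentz_functional_def)
qed

text \<open>Dilations by \<open>2\<^sup>k\<close> do not change the functional, so the terms of the sum differ only in their coefficients. For \<open>q \<le> p\<close>
  the power \<open>q / p\<close> is subadditive and acts on each coefficient, which changes the ratio of the geometric series; for \<open>q > p\<close>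
  it is convex and the coefficients are summed first; for \<open>q = \<infinity>\<close> the supremum bounds each term. In every case the series
  finally appears to the power \<open>1 / min p q\<close>.\<close>

lemma lorentz_functional_dyadic_domination:
  fixes \<Phi> \<Psi> :: "real \<Rightarrow> ennreal"
  assumes p: "p > 0" and q: "q > 0" and y: "y > 0"
    and [measurable]: "\<Phi> \<in> borel_measurable borel" "\<Psi> \<in> borel_measurable borel"
    and le: "\<And>s. s > 0 \<Longrightarrow> \<Psi> (2 * s) \<le> B * (\<Sum>k. ennreal (2 powr (- (real k * y))) * \<Phi> (2 ^ k * s))"
  shows "lorentz_functional p q \<Psi> \<le> epowr B (1 / p) *
    epowr (dyadic_geom (if ennreal p \<le> q then y else y * (enn2real q / p))) (1 / min_exp p q) * lorentz_functional p q \<Phi>"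
proof (cases "q = top")
  case True
  define N where "N = lorentz_functional p q \<Phi>"
  have min: "min_exp p q = p" using True p by (simp add: min_exp_def)
  have \<Phi>: "\<Phi> s \<le> epowr N p" if "s > 0" for s
  proof -
    have "epowr (\<Phi> s) (1 / p) \<le> N"
      using True that by (auto simp: N_def lorentz_functional_def intro: SUP_upper)
    then show ?thesis using p epowr_le_iff[of "1 / p" "\<Phi> s" N] by simp
  qed
  have "epowr (\<Psi> s) (1 / p) \<le> epowr B (1/p) * epowr (dyadic_geom y) (1/p) * N" if s: "s > 0" for s
  proof -
    have "\<Psi> s \<le> B * (\<Sum>k. ennreal (2 powr (- (real k * y))) * \<Phi> (2 ^ k * (s / 2)))"
      using le[of "s / 2"] s by simp
    also have "\<dots> \<le> B * (\<Sum>k. ennreal (2 powr (- (real k * y))) * epowr N p)"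
      using s by (intro mult_left_mono suminf_le \<Phi>) auto
    also have "\<dots> = B * dyadic_geom y * epowr N p" by (simp add: dyadic_geom_def mult.assoc)
    finally have "epowr (\<Psi> s) (1/p) \<le> epowr (B * dyadic_geom y * epowr N p) (1/p)"
      using p by (intro epowr_mono) auto
    also have "\<dots> = epowr B (1/p) * epowr (dyadic_geom y) (1/p) * N"
      using p by (simp add: epowr_mult epowr_inverse)
    finally show ?thesis .
  qed
  then show ?thesis
    unfolding N_def[symmetric] using True min by (auto simp: lorentz_functional_def intro!: SUP_least)
next
  case False
  define Q where "Q = enn2real q"
  have Q: "Q > 0" "q = ennreal Q"
    using q False by (auto simp: enn2real_positive_iff less_top Q_def)
  define \<theta> where "\<theta> = Q / p"
  have \<theta>: "\<theta> > 0" using p Q by (simp add: \<theta>_def)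
  define a where "a = (\<lambda>k::nat. ennreal (2 powr (- (real k * y))))"
  define J where "J = (\<lambda>\<Phi>. \<integral>\<^sup>+ s\<in>{0<..}. epowr (\<Phi> s) \<theta> / ennreal s \<partial>lborel)"
  have dilated_corner: "(\<integral>\<^sup>+ s\<in>{0<..}. epowr (\<Phi> (2 ^ k * s)) \<theta> / ennreal s \<partial>lborel) = J \<Phi>" for k :: nat
    unfolding J_def by (rule nn_integral_dilation_invariant[of "\<lambda>s. epowr (\<Phi> s) \<theta>"]) auto
  have sums: "(\<integral>\<^sup>+ s\<in>{0<..}. (K * (\<Sum>k. b k * epowr (\<Phi> (2 ^ k * s)) \<theta>)) / ennreal s \<partial>lborel) = K * (\<Sum>k. b k) * J \<Phi>"
    for K and b :: "nat \<Rightarrow> ennreal"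
  proof -
    have "(\<integral>\<^sup>+ s\<in>{0<..}. (K * (\<Sum>k. b k * epowr (\<Phi> (2 ^ k * s)) \<theta>)) / ennreal s \<partial>lborel)
       = (\<integral>\<^sup>+ s. K * (\<Sum>k. b k * (epowr (\<Phi> (2 ^ k * s)) \<theta> / ennreal s * indicator {0<..} s)) \<partial>lborel)"
      by (intro nn_integral_cong) (auto simp: indicator_def ennreal_times_divide[symmetric] simp flip: ennreal_suminf_divide)
    also have "\<dots> = K * (\<Sum>k. b k * (\<integral>\<^sup>+ s\<in>{0<..}. epowr (\<Phi> (2 ^ k * s)) \<theta> / ennreal s \<partial>lborel))"
      by (simp add: nn_integral_cmult nn_integral_suminf)
    also have "\<dots> = K * (\<Sum>k. b k) * J \<Phi>" unfolding dilated_corner by (simp add: mult.assoc)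
    finally show ?thesis .
  qed
  \<comment> \<open>The hypothesis concerns \<open>\<Psi> (2 * s)\<close>, and this factor 2 is removed by a dilation, too.\<close>
  have J\<Psi>: "J \<Psi> = (\<integral>\<^sup>+ s\<in>{0<..}. epowr (\<Psi> (2 * s)) \<theta> / ennreal s \<partial>lborel)"
    unfolding J_def by (rule nn_integral_dilation_invariant[symmetric, of "\<lambda>s. epowr (\<Psi> s) \<theta>" 2, simplified])
  have B: "epowr (epowr B \<theta>) (1/Q) = epowr B (1/p)"
    using \<theta> Q p by (simp add: epowr_epowr \<theta>_def)
  have fin: "lorentz_functional p q \<Psi> \<le> epowr B (1/p) * epowr G (1/Q) * lorentz_functional p q \<Phi>"
    if "J \<Psi> \<le> epowr B \<theta> * G * J \<Phi>" for G
  proof -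
    have "lorentz_functional p q \<Psi> = epowr (ennreal p * J \<Psi>) (1/Q)"
      using False by (simp add: lorentz_functional_def J_def \<theta>_def Q_def)
    also have "\<dots> \<le> epowr (epowr B \<theta> * G * (ennreal p * J \<Phi>)) (1/Q)"
    proof (rule epowr_mono)
      have "ennreal p * J \<Psi> \<le> ennreal p * (epowr B \<theta> * G * J \<Phi>)" using that by (intro mult_left_mono) auto
      then show "ennreal p * J \<Psi> \<le> epowr B \<theta> * G * (ennreal p * J \<Phi>)" by (simp add: mult_ac)
    qed (use Q in auto)
    also have "\<dots> = epowr B (1/p) * epowr G (1/Q) * epowr (ennreal p * J \<Phi>) (1/Q)"
      using Q by (simp add: epowr_mult[of "1/Q"] B)
    also have "epowr (ennreal p * J \<Phi>) (1/Q) = lorentz_functional p q \<Phi>"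
      using False by (simp add: lorentz_functional_def J_def \<theta>_def Q_def)
    finally show ?thesis .
  qed
  show ?thesis
  proof (cases "\<theta> \<le> 1")
    case True
    then have "Q \<le> p" using p by (simp add: \<theta>_def)
    then have min: "min_exp p q = Q" using p Q by (simp add: min_exp_def min_def)
    have exp_eq: "(if ennreal p \<le> q then y else y * (enn2real q / p)) = y * \<theta>"
    proof (cases "ennreal p \<le> q")
      case True then show ?thesis using \<open>Q \<le> p\<close> p Q by (simp add: \<theta>_def)
    qed (simp add: \<theta>_def Q_def)
    have "J \<Psi> \<le> (\<integral>\<^sup>+ s\<in>{0<..}. (epowr B \<theta> * (\<Sum>k. ennreal (2 powr (- (real k * (y * \<theta>)))) * epowr (\<Phi> (2 ^ k * s)) \<theta>)) / ennreal s \<partial>lborel)"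
      unfolding J\<Psi>
    proof (rule nn_integral_mono)
      fix s :: real
      have "epowr (\<Psi> (2 * s)) \<theta> \<le> epowr B \<theta> * (\<Sum>k. ennreal (2 powr (- (real k * (y * \<theta>)))) * epowr (\<Phi> (2 ^ k * s)) \<theta>)" if "s > 0"
      proof -
        have "epowr (\<Psi> (2 * s)) \<theta> \<le> epowr (B * (\<Sum>k. a k * \<Phi> (2 ^ k * s))) \<theta>"
          unfolding a_def using le[OF that] \<theta> by (intro epowr_mono) auto
        also have "\<dots> = epowr B \<theta> * epowr (\<Sum>k. a k * \<Phi> (2 ^ k * s)) \<theta>" using \<theta> by (simp add: epowr_mult)
        also have "\<dots> \<le> epowr B \<theta> * (\<Sum>k. epowr (a k * \<Phi> (2 ^ k * s)) \<theta>)"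
          using \<theta> True by (intro mult_left_mono epowr_suminf_le) auto
        also have "(\<lambda>k. epowr (a k * \<Phi> (2 ^ k * s)) \<theta>) = (\<lambda>k. ennreal (2 powr (- (real k * (y * \<theta>)))) * epowr (\<Phi> (2 ^ k * s)) \<theta>)"
          using \<theta> by (simp add: a_def epowr_mult epowr_ennreal powr_powr mult_ac)
        finally show ?thesis .
      qed
      then show "epowr (\<Psi> (2 * s)) \<theta> / ennreal s * indicator {0<..} s
         \<le> (epowr B \<theta> * (\<Sum>k. ennreal (2 powr (- (real k * (y * \<theta>)))) * epowr (\<Phi> (2 ^ k * s)) \<theta>)) / ennreal s * indicator {0<..} s"
        by (auto simp: indicator_def intro!: divide_right_mono_ennreal)
    qed
    also have "\<dots> = epowr B \<theta> * dyadic_geom (y * \<theta>) * J \<Phi>" unfolding sums by (simp add: dyadic_geom_def)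
    finally have "J \<Psi> \<le> epowr B \<theta> * dyadic_geom (y * \<theta>) * J \<Phi>" .
    from fin[OF this] show ?thesis unfolding exp_eq min .
  next
    case False
    then have "p < Q" using p by (simp add: \<theta>_def)
    then have min: "min_exp p q = p" and exp_eq: "(if ennreal p \<le> q then y else y * (enn2real q / p)) = y"
      using p Q by (auto simp: min_exp_def min_def)
    have "J \<Psi> \<le> (\<integral>\<^sup>+ s\<in>{0<..}. ((epowr B \<theta> * epowr (dyadic_geom y) (\<theta> - 1)) * (\<Sum>k. a k * epowr (\<Phi> (2 ^ k * s)) \<theta>)) / ennreal s \<partial>lborel)"
      unfolding J\<Psi>
    proof (rule nn_integral_mono)
      fix s :: real
      have "epowr (\<Psi> (2 * s)) \<theta> \<le> (epowr B \<theta> * epowr (dyadic_geom y) (\<theta> - 1)) * (\<Sum>k. a k * epowr (\<Phi> (2 ^ k * s)) \<theta>)" if "s > 0"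
      proof -
        have "epowr (\<Psi> (2 * s)) \<theta> \<le> epowr (B * (\<Sum>k. a k * \<Phi> (2 ^ k * s))) \<theta>"
          unfolding a_def using le[OF that] \<theta> by (intro epowr_mono) auto
        also have "\<dots> = epowr B \<theta> * epowr (\<Sum>k. a k * \<Phi> (2 ^ k * s)) \<theta>" using \<theta> by (simp add: epowr_mult)
        also have "\<dots> \<le> epowr B \<theta> * (epowr (\<Sum>k. a k) (\<theta> - 1) * (\<Sum>k. a k * epowr (\<Phi> (2 ^ k * s)) \<theta>))"
          using False by (intro mult_left_mono epowr_suminf_convex) auto
        finally show ?thesis by (simp add: a_def dyadic_geom_def mult.assoc)
      qed
      then show "epowr (\<Psi> (2 * s)) \<theta> / ennreal s * indicator {0<..} s
         \<le> ((epowr B \<theta> * epowr (dyadic_geom y) (\<theta> - 1)) * (\<Sum>k. a k * epowr (\<Phi> (2 ^ k * s)) \<theta>)) / ennreal s * indicator {0<..} s"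
        by (auto simp: indicator_def intro!: divide_right_mono_ennreal)
    qed
    also have "\<dots> = epowr B \<theta> * epowr (dyadic_geom y) (\<theta> - 1) * dyadic_geom y * J \<Phi>" unfolding sums by (simp add: dyadic_geom_def a_def)
    also have "epowr B \<theta> * epowr (dyadic_geom y) (\<theta> - 1) * dyadic_geom y = epowr B \<theta> * epowr (dyadic_geom y) \<theta>"
      using False epowr_add[of "\<theta> - 1" 1 "dyadic_geom y"] by (simp add: mult.assoc)
    finally have "J \<Psi> \<le> epowr B \<theta> * epowr (dyadic_geom y) \<theta> * J \<Phi>" .
    from fin[OF this] show ?thesis unfolding exp_eq min
      using \<theta> Q p by (simp add: epowr_epowr \<theta>_def)
  qed
qed

section \<open>The upper bound\<close>

text \<open>The part of \<open>f\<close> of height at most \<open>s\<close> has maximal function at most \<open>s\<close>.\<close>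

lemma hl_maximal_truncation:
  fixes f :: "real ^ 'n \<Rightarrow> real"
  assumes [measurable]: "f \<in> borel_measurable lebesgue"
    and s: "s > 0" and lt: "ennreal (2 * s) < hl_maximal f x"
  shows "ennreal s < hl_maximal (\<lambda>y. if s < \<bar>f y\<bar> then f y else 0) x"
proof (rule ccontr)
  let ?g = "\<lambda>y. if s < \<bar>f y\<bar> then f y else 0"
  assume "\<not> ?thesis"
  then have le: "hl_maximal ?g x \<le> ennreal s" by simp
  have "hl_maximal f x \<le> ennreal (2 * s)"
    unfolding hl_maximal_def[of f]
  proof (rule SUP_least, safe)
    fix Q :: "(real ^ 'n) set" assume "Q \<in> cubes" "x \<in> Q"
    then obtain a l where Q: "Q = cube a l" "l > 0" by (auto elim: cubesE)
    have "avg Q (\<lambda>y. ennreal \<bar>?g y\<bar>) \<le> ennreal s"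
      using avg_le_hl_maximal[of l x a ?g] le Q \<open>x \<in> Q\<close> by (auto intro: order_trans)
    then have I: "(\<integral>\<^sup>+ y\<in>Q. ennreal \<bar>?g y\<bar> \<partial>lebesgue) \<le> ennreal s * ennreal (l ^ CARD('n))"
      using Q by (simp add: avg_le_iff)
    have "(\<integral>\<^sup>+ y\<in>Q. ennreal \<bar>f y\<bar> \<partial>lebesgue) \<le> (\<integral>\<^sup>+ y. ennreal s * indicator Q y + ennreal \<bar>?g y\<bar> * indicator Q y \<partial>lebesgue)"
      using s by (intro nn_integral_mono) (auto simp: indicator_def intro: ennreal_leI add_increasing)
    also have "\<dots> = ennreal s * ennreal (l ^ CARD('n)) + (\<integral>\<^sup>+ y\<in>Q. ennreal \<bar>?g y\<bar> \<partial>lebesgue)"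
    proof -
      have [measurable]: "Q \<in> sets lebesgue" by (simp add: Q)
      have "emeasure lebesgue Q = ennreal (l ^ CARD('n))"
        unfolding Q(1) using Q(2) by (intro emeasure_cube) auto
      then show ?thesis by (subst nn_integral_add) (auto simp: nn_integral_cmult_indicator)
    qed
    also have "\<dots> \<le> ennreal s * ennreal (l ^ CARD('n)) + ennreal s * ennreal (l ^ CARD('n))"
      by (intro add_left_mono I)
    also have "\<dots> = ennreal (2 * s) * ennreal (l ^ CARD('n))"
      using s Q by (simp flip: ennreal_mult ennreal_plus)
    finally show "avg Q (\<lambda>y. ennreal \<bar>f y\<bar>) \<le> ennreal (2 * s)" using Q by (simp add: avg_le_iff)
  qed
  with lt show False by (simp add: not_less[symmetric])
qed

text \<open>The weak-type inequality is applied to the part of \<open>f\<close> above height \<open>s\<close>, whose r-th power is then bounded on each dyadic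
  layer \<open>2\<^sup>k s < |f| \<le> 2\<^sup>k\<^sup>+\<^sup>1 s\<close> by its largest value.\<close>

lemma distribution_hl_maximal_le:
  fixes w f :: "real ^ 'n \<Rightarrow> real"
  assumes r: "1 < r" and f[measurable]: "f \<in> borel_measurable lebesgue"
    and w[measurable]: "w \<in> borel_measurable lebesgue" and pos: "AE x in lebesgue. w x > 0"
    and s: "s > 0"
  shows "wmeasure w {x. ennreal (2 * s) < hl_maximal f x}
     \<le> ennreal ((2 * dilation_volume TYPE('n)) powr r) * Ap_const r w *
        (\<Sum>k. ennreal (2 powr (real k * r)) * wmeasure w {x. ennreal (2 ^ k * s) < ennreal \<bar>f x\<bar>})"
proof -
  define g where "g = (\<lambda>y. if s < \<bar>f y\<bar> then f y else 0)"
  have [measurable]: "g \<in> borel_measurable lebesgue" unfolding g_def by measurable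
  define W where "W = (\<lambda>k::nat. {x. ennreal (2 ^ k * s) < ennreal \<bar>f x\<bar>})"
  have W[measurable]: "W k \<in> sets lebesgue" for k
  proof -
    have "{x \<in> space lebesgue. ennreal (2 ^ k * s) < ennreal \<bar>f x\<bar>} \<in> sets lebesgue" by measurable
    then show ?thesis by (simp add: W_def)
  qed
  define S where "S = (\<Sum>k. ennreal (2 powr (real k * r)) * wmeasure w (W k))"
  have pw: "epowr (ennreal \<bar>g x\<bar>) r * ennreal (w x)
      \<le> ennreal ((2 * s) powr r) * (\<Sum>k. ennreal (2 powr (real k * r)) * (ennreal (w x) * indicator (W k) x))" for x
  proof (cases "s < \<bar>f x\<bar>")
    case False
    then show ?thesis using r by (simp add: g_def)
  next
    case True
    obtain m :: nat where "\<bar>f x\<bar> / s < 2 ^ m" using real_arch_pow[of 2 "\<bar>f x\<bar> / s"] by auto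
    then have ex: "\<exists>m. \<bar>f x\<bar> \<le> 2 ^ m * s" using s by (auto simp: field_simps intro: less_imp_le)
    define N where "N = (LEAST m. \<bar>f x\<bar> \<le> 2 ^ m * s)"
    have N: "\<bar>f x\<bar> \<le> 2 ^ N * s" unfolding N_def using ex by (rule LeastI_ex)
    then have "N \<noteq> 0" using True by (cases N) auto
    then obtain k where k: "N = Suc k" by (cases N) auto
    have "\<not> \<bar>f x\<bar> \<le> 2 ^ k * s" using k unfolding N_def by (intro not_less_Least) auto
    then have "x \<in> W k" using s by (simp add: W_def ennreal_less_iff)
    have "\<bar>f x\<bar> powr r \<le> (2 ^ N * s) powr r" using N r by (intro powr_mono2) auto
    also have "\<dots> = (2 * s) powr r * 2 powr (real k * r)"
      using s by (simp add: k powr_mult powr_realpow[symmetric] powr_powr mult_ac)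
    finally have "epowr (ennreal \<bar>g x\<bar>) r \<le> ennreal ((2 * s) powr r) * ennreal (2 powr (real k * r))"
      using True r by (simp add: g_def epowr_ennreal' ennreal_leI flip: ennreal_mult)
    then have "epowr (ennreal \<bar>g x\<bar>) r * ennreal (w x)
       \<le> ennreal ((2 * s) powr r) * ennreal (2 powr (real k * r)) * ennreal (w x)"
      by (rule mult_right_mono) simp
    also have "\<dots> = ennreal ((2 * s) powr r) * (\<Sum>j\<in>{k}. ennreal (2 powr (real j * r)) * (ennreal (w x) * indicator (W j) x))"
      using \<open>x \<in> W k\<close> by (simp add: mult.assoc)
    also have "\<dots> \<le> ennreal ((2 * s) powr r) * (\<Sum>k. ennreal (2 powr (real k * r)) * (ennreal (w x) * indicator (W k) x))"
      by (intro mult_left_mono sum_le_suminf) auto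
    finally show ?thesis .
  qed
  have int: "(\<integral>\<^sup>+ x. epowr (ennreal \<bar>g x\<bar>) r * ennreal (w x) \<partial>lebesgue) \<le> ennreal ((2 * s) powr r) * S"
  proof -
    have "(\<integral>\<^sup>+ x. epowr (ennreal \<bar>g x\<bar>) r * ennreal (w x) \<partial>lebesgue)
       \<le> (\<integral>\<^sup>+ x. ennreal ((2 * s) powr r) * (\<Sum>k. ennreal (2 powr (real k * r)) * (ennreal (w x) * indicator (W k) x)) \<partial>lebesgue)"
      by (intro nn_integral_mono pw)
    also have "\<dots> = ennreal ((2 * s) powr r) * S"
      by (simp add: nn_integral_cmult nn_integral_suminf S_def wmeasure_def)
    finally show ?thesis .
  qed
  have "ennreal (s powr r) * wmeasure w {x. ennreal (2 * s) < hl_maximal f x}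
      \<le> ennreal (s powr r) * wmeasure w {x. ennreal s < hl_maximal g x}"
    using hl_maximal_truncation[OF f s] by (intro mult_left_mono wmeasure_mono) (auto simp: g_def)
  also have "\<dots> \<le> ennreal (dilation_volume TYPE('n) powr r) * Ap_const r w *
         (\<integral>\<^sup>+ x. epowr (ennreal \<bar>g x\<bar>) r * ennreal (w x) \<partial>lebesgue)"
    by (intro hl_maximal_weak_type r pos s) auto
  also have "\<dots> \<le> ennreal (dilation_volume TYPE('n) powr r) * Ap_const r w * (ennreal ((2 * s) powr r) * S)"
    by (intro mult_left_mono int) auto
  also have "\<dots> = ennreal (dilation_volume TYPE('n) powr r) * ennreal ((2 * s) powr r) * (Ap_const r w * S)"
    by (simp add: mult_ac)
  also have "ennreal (dilation_volume TYPE('n) powr r) * ennreal ((2 * s) powr r)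
      = ennreal ((2 * dilation_volume TYPE('n)) powr r) * ennreal (s powr r)"
    using s dilation_volume_ge_1[where 'n = 'n] by (simp add: powr_mult mult_ac flip: ennreal_mult)
  finally have "wmeasure w {x. ennreal (2 * s) < hl_maximal f x} * ennreal (s powr r)
    \<le> ennreal ((2 * dilation_volume TYPE('n)) powr r) * Ap_const r w * S * ennreal (s powr r)"
    by (simp add: mult_ac)
  then have "wmeasure w {x. ennreal (2 * s) < hl_maximal f x}
    \<le> ennreal ((2 * dilation_volume TYPE('n)) powr r) * Ap_const r w * S"
    by (rule ennreal_mult_right_le_cancel) (use s in auto)
  then show ?thesis by (simp add: S_def W_def)
qed

lemma distribution_measurable:
  "(\<lambda>s. ennreal (s powr p) * wmeasure w {x. F x > ennreal s}) \<in> borel_measurable borel"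
proof -
  have "(\<lambda>s. wmeasure w {x. F x > ennreal s}) \<in> borel_measurable borel"
    by (rule antimono_imp_borel_measurable)
      (auto intro!: wmeasure_mono intro: le_less_trans[OF ennreal_leI])
  then show ?thesis by measurable
qed

text \<open>Multiplying the distributional inequality by \<open>(2 s) powr p\<close> leaves the coefficient \<open>2 powr (- k (p - r))\<close> in front of
  the k-th dilate. The prefactor is at most the p-th power of a dimensional constant times \<open>[w]\<^bsub>A_p\<^esub>\<close>, so its p-th root is bounded
  independently of \<open>p\<close> apart from the weight constant.\<close>

lemma lorentz_norm_hl_maximal_le:
  fixes w f :: "real ^ 'n \<Rightarrow> real"
  assumes p: "p > 1" and q: "q > 0" and w: "w \<in> Ap p" and f: "f \<in> borel_measurable lebesgue"
    and r: "1 < r" "r < p" and Ar: "Ap_const r w \<le> ennreal (2 powr (p - 1)) * Ap_const p w"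
  shows "lorentz_norm p q w (hl_maximal f) \<le> ennreal (8 * dilation_volume TYPE('n)) * epowr (Ap_const p w) (1 / p) *
    epowr (dyadic_geom (if ennreal p \<le> q then p - r else (p - r) * (enn2real q / p))) (1 / min_exp p q) *
    lorentz_norm p q w (\<lambda>x. ennreal \<bar>f x\<bar>)"
proof -
  have ww: "weight w" using w by (simp add: Ap_def)
  define c where "c = dilation_volume TYPE('n)"
  have c: "c \<ge> 1" by (simp add: c_def dilation_volume_ge_1)
  define A where "A = Ap_const p w"
  have p0: "p > 0" using p by simp
  define d where "d = (\<lambda>s. wmeasure w {x. ennreal s < ennreal \<bar>f x\<bar>})"
  define m where "m = (\<lambda>s. wmeasure w {x. ennreal s < hl_maximal f x})"
  define B where "B = ennreal (2 powr p) * (ennreal ((2 * c) powr r) * Ap_const r w)"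
  have le: "ennreal ((2 * s) powr p) * m (2 * s)
      \<le> B * (\<Sum>k. ennreal (2 powr (- (real k * (p - r)))) * (ennreal ((2 ^ k * s) powr p) * d (2 ^ k * s)))"
    if s: "s > 0" for s
  proof -
    have two_s: "ennreal ((2 * s) powr p) = ennreal (2 powr p) * ennreal (s powr p)"
      using s by (simp add: powr_mult ennreal_mult)
    have "ennreal ((2 * s) powr p) * m (2 * s)
        \<le> ennreal ((2 * s) powr p) * (ennreal ((2 * c) powr r) * Ap_const r w * (\<Sum>k. ennreal (2 powr (real k * r)) * d (2 ^ k * s)))"
      unfolding m_def d_def c_def
      by (intro mult_left_mono distribution_hl_maximal_le r f weightD[OF ww] s) auto
    also have "ennreal ((2 * s) powr p) * (ennreal ((2 * c) powr r) * Ap_const r w * (\<Sum>k. ennreal (2 powr (real k * r)) * d (2 ^ k * s)))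
       = B * (\<Sum>k. ennreal (s powr p) * (ennreal (2 powr (real k * r)) * d (2 ^ k * s)))"
      unfolding two_s by (simp add: B_def mult_ac)
    also have "(\<lambda>k. ennreal (s powr p) * (ennreal (2 powr (real k * r)) * d (2 ^ k * s)))
       = (\<lambda>k. ennreal (2 powr (- (real k * (p - r)))) * (ennreal ((2 ^ k * s) powr p) * d (2 ^ k * s)))"
    proof
      fix k
      have "s powr p * 2 powr (real k * r) = 2 powr (- (real k * (p - r))) * (2 ^ k * s) powr p"
        using s by (simp add: powr_mult powr_realpow[symmetric] powr_powr powr_add[symmetric] algebra_simps)
      then show "ennreal (s powr p) * (ennreal (2 powr (real k * r)) * d (2 ^ k * s))
         = ennreal (2 powr (- (real k * (p - r)))) * (ennreal ((2 ^ k * s) powr p) * d (2 ^ k * s))"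
        by (simp flip: mult.assoc ennreal_mult)
    qed
    finally show ?thesis .
  qed
  have "B \<le> ennreal ((8 * c) powr p) * A"
  proof -
    have "B \<le> ennreal (2 powr p) * (ennreal ((2 * c) powr p) * (ennreal (2 powr (p - 1)) * A))"
      unfolding B_def A_def using c r Ar by (intro mult_left_mono mult_mono ennreal_leI powr_mono) auto
    also have "\<dots> \<le> ennreal (2 powr p) * (ennreal ((2 * c) powr p) * (ennreal (2 powr p) * A))"
      by (intro mult_left_mono mult_right_mono ennreal_leI powr_mono) auto
    also have "\<dots> = ennreal (2 powr p * (2 * c) powr p * 2 powr p) * A"
      by (simp add: ennreal_mult mult_ac)
    also have "2 powr p * (2 * c) powr p * 2 powr p = (8 * c) powr p"
      using c by (simp flip: powr_mult)
    finally show ?thesis .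
  qed
  then have "epowr B (1/p) \<le> epowr (ennreal ((8 * c) powr p) * A) (1/p)"
    using p by (intro epowr_mono) auto
  also have "\<dots> = ennreal (8 * c) * epowr A (1/p)"
    using p c by (simp add: epowr_mult epowr_ennreal powr_powr)
  finally have Bp: "epowr B (1/p) \<le> ennreal (8 * c) * epowr A (1/p)" .
  have "lorentz_norm p q w (hl_maximal f) \<le> epowr B (1/p) *
    epowr (dyadic_geom (if ennreal p \<le> q then p - r else (p - r) * (enn2real q / p))) (1 / min_exp p q) *
    lorentz_norm p q w (\<lambda>x. ennreal \<bar>f x\<bar>)"
    unfolding lorentz_norm_eq_functional[OF p0 q]
    using p0 q r le unfolding m_def d_def
    by (intro lorentz_functional_dyadic_domination distribution_measurable) auto
  also have "\<dots> \<le> ennreal (8 * c) * epowr A (1/p) *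
    epowr (dyadic_geom (if ennreal p \<le> q then p - r else (p - r) * (enn2real q / p))) (1 / min_exp p q) *
    lorentz_norm p q w (\<lambda>x. ennreal \<bar>f x\<bar>)"
    by (intro mult_right_mono Bp) auto
  finally show ?thesis by (simp add: c_def A_def)
qed

lemma ennreal_divide_leI:
  fixes a b c :: ennreal
  assumes "a \<le> c * b" "b < top" "c < top"
  shows "a / b \<le> c"
proof (cases "b = 0")
  case True
  then show ?thesis using assms by simp
next
  case False
  then obtain x where "b = ennreal x" "x > 0" using assms(2) by (cases b) (auto simp: ennreal_eq_0_iff)
  then show ?thesis using assms by (simp add: ennreal_divide_le_iff)
qed

lemma less_ennreal_imp_less_top: "\<not> ennreal p \<le> q \<Longrightarrow> q < top"
  by (metis ennreal_less_top less_trans not_le)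

lemma min_exp_pos: "p > 0 \<Longrightarrow> q > 0 \<Longrightarrow> min_exp p q > 0"
  unfolding min_exp_def by (auto simp: enn2real_positive_iff min_def less_ennreal_imp_less_top)

text \<open>With \<open>e = 1 / (4 \<kappa> H)\<close> one has \<open>p - r \<ge> (p - 1) e / 2\<close>, hence \<open>2 / (p - r) \<le> 16 \<kappa> p' H\<close>, and multiplying by
  \<open>p / q\<close> in the case \<open>q < p\<close> costs a constant that depends only on \<open>q\<close>. If the Fujii-Wilson constant is infinite the
  right-hand side is infinite, because \<open>[w]\<^bsub>A_p\<^esub> \<ge> 1\<close>.\<close>

theorem maximal_opnorm_upper_bound:
  assumes q: "q > 0"
  shows "\<exists>C::real. C > 0 \<and> (\<forall>p::real. 1 < p \<longrightarrow> (\<forall>w :: real ^ 'n \<Rightarrow> real. w \<in> Ap p \<longrightarrow>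
     maximal_opnorm p q w \<le> ennreal (C * conj_exp p powr (1 / min_exp p q)) *
        epowr (Ap_const p w) (1 / p) * epowr (Ainf_const (dual_weight p w)) (1 / min_exp p q)))"
proof -
  define \<kappa> where "\<kappa> = level_const TYPE('n)"
  have \<kappa>: "\<kappa> \<ge> 1" by (simp add: \<kappa>_def level_const_ge)
  define Q where "Q = enn2real q"
  define E where "E = 16 * \<kappa> * (1 + 1 / Q)"
  have Q0: "Q \<ge> 0" by (simp add: Q_def)
  have E: "E \<ge> 16 * \<kappa>" "E \<ge> 1"
  proof -
    have "16 * \<kappa> * 1 \<le> E" unfolding E_def using \<kappa> Q0 by (intro mult_left_mono) auto
    then show "E \<ge> 16 * \<kappa>" "E \<ge> 1" using \<kappa> by auto
  qed
  define c where "c = 8 * dilation_volume TYPE('n)"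
  have c: "c > 0" using dilation_volume_ge_1[where 'n = 'n] by (simp add: c_def)
  define C where "C = c * (E + E powr (1 / Q))"
  have "C > 0" using c E by (auto simp: C_def intro!: mult_pos_pos add_pos_nonneg)
  moreover have "maximal_opnorm p q w \<le> ennreal (C * conj_exp p powr (1 / min_exp p q)) *
        epowr (Ap_const p w) (1 / p) * epowr (Ainf_const (dual_weight p w)) (1 / min_exp p q)"
    if p: "1 < p" and w: "w \<in> Ap p" for p and w :: "real ^ 'n \<Rightarrow> real"
  proof -
    define m where "m = min_exp p q"
    have m: "m > 0" using min_exp_pos[of p q] p q by (simp add: m_def)
    define p' where "p' = conj_exp p"
    have p': "p' > 1" using conj_exp_identities(3)[OF p] by (simp add: p'_def)
    have ww: "weight w" using w by (simp add: Ap_def)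
    have A1: "Ap_const p w \<ge> 1" by (rule Ap_const_ge_1[OF p ww])
    have H1: "Ainf_const (dual_weight p w) \<ge> 1" by (rule Ainf_const_ge_1[OF weight_dual_weight[OF p w]])
    have A0: "epowr (Ap_const p w) (1/p) \<ge> 1" using A1 p by (intro epowr_ge_1) auto
    show ?thesis
    proof (cases "Ainf_const (dual_weight p w)")
      case top
      have "ennreal (C * conj_exp p powr (1 / min_exp p q)) \<noteq> 0" "epowr (Ap_const p w) (1/p) \<noteq> 0"
        using \<open>C > 0\<close> p' A0 by (auto simp: p'_def ennreal_eq_0_iff not_le)
      then show ?thesis using m unfolding top by (simp add: m_def ennreal_mult_top)
    next
      case (real H)
      then have H: "H \<ge> 1" "Ainf_const (dual_weight p w) \<le> ennreal H" using H1 by auto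
      define e where "e = 1 / (4 * \<kappa> * H)"
      have kH: "\<kappa> * H \<ge> 1" using \<kappa> H mult_mono[of 1 \<kappa> 1 H] by simp
      have e: "0 < e" "e \<le> 1" and einv: "1 / e = 4 * (\<kappa> * H)"
      proof -
        have *: "4 * \<kappa> * H \<ge> 1" using kH by simp
        show "0 < e" unfolding e_def using \<kappa> H by (intro divide_pos_pos mult_pos_pos) auto
        show "e \<le> 1" unfolding e_def using * by (subst divide_le_eq_1_pos) linarith+
        show "1 / e = 4 * (\<kappa> * H)" unfolding e_def by simp
      qed
      define r where "r = 1 + (p - 1) / (1 + e)"
      have r1: "r > 1" using p e by (simp add: r_def)
      have pr: "p - r = (p - 1) * e / (1 + e)" using e by (simp add: r_def field_simps)
      have pr_ge: "p - r \<ge> (p - 1) * e / 2" unfolding pr using p e by (intro divide_left_mono) auto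
      have rp: "r < p" using pr_ge p e by (smt (verit) divide_pos_pos mult_pos_pos)
      have Ar: "Ap_const r w \<le> ennreal (2 powr (p - 1)) * Ap_const p w"
        by (rule Ap_const_self_improvement[OF p w H(2,1), of e r]) (auto simp: e_def r_def \<kappa>_def)
      define y where "y = (if ennreal p \<le> q then p - r else (p - r) * (enn2real q / p))"
      have inv_pr: "2 / (p - r) \<le> 16 * \<kappa> * p' * H" and y: "y > 0" and inv_y: "2 / y \<le> E * p' * H"
      proof -
        have pos: "(p - 1) * e / 2 > 0" using p e by simp
        have "2 / (p - r) \<le> 2 / ((p - 1) * e / 2)" using pos pr_ge by (intro divide_left_mono) auto
        also have "\<dots> = 4 / (p - 1) * (1 / e)" by simp
        also have "\<dots> = 16 * \<kappa> * (1 / (p - 1)) * H" unfolding einv by simp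
        also have "\<dots> \<le> 16 * \<kappa> * p' * H"
          using p \<kappa> H by (intro mult_right_mono mult_left_mono) (auto simp: p'_def conj_exp_def divide_right_mono)
        finally show *: "2 / (p - r) \<le> 16 * \<kappa> * p' * H" .
        show "y > 0"
        proof (cases "ennreal p \<le> q")
          case True then show ?thesis using rp by (simp add: y_def)
        next
          case False
          then have "enn2real q > 0" using q by (auto simp: enn2real_positive_iff less_ennreal_imp_less_top)
          then show ?thesis using False rp p by (simp add: y_def)
        qed
        show "2 / y \<le> E * p' * H"
        proof (cases "ennreal p \<le> q")
          case True
          have "16 * \<kappa> * p' * H \<le> E * p' * H" using E p' H by (intro mult_right_mono) auto
          then show ?thesis using * True by (simp add: y_def)
        next
          case False
          then have Qp: "Q > 0" using q by (auto simp: enn2real_positive_iff less_ennreal_imp_less_top Q_def)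
          have "2 / y = 2 / (p - r) * (p / Q)" using False by (simp add: y_def Q_def)
          also have "\<dots> \<le> 2 / ((p - 1) * e / 2) * (p / Q)"
            using pos pr_ge Qp p by (intro mult_right_mono divide_left_mono) auto
          also have "\<dots> = 4 * (p / (p - 1)) * (1 / e) / Q" by simp
          also have "\<dots> = 16 * \<kappa> * (1 / Q) * p' * H" unfolding einv by (simp add: p'_def conj_exp_def mult_ac)
          also have "\<dots> \<le> E * p' * H"
            unfolding E_def using \<kappa> p' H Qp by (intro mult_right_mono mult_left_mono) auto
          finally show ?thesis .
        qed
      qed
      have G: "dyadic_geom y \<le> ennreal (E * p' * H)"
      proof -
        have "dyadic_geom y \<le> ennreal (2 / min y 1)" by (rule dyadic_geom_le[OF y])
        also have "\<dots> \<le> ennreal (E * p' * H)"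
        proof (rule ennreal_leI)
          have "E * p' \<ge> 16 * 1" using E \<kappa> p' by (intro mult_mono) auto
          then have "E * p' * H \<ge> 16 * 1" using H by (intro mult_mono) auto
          then show "2 / min y 1 \<le> E * p' * H" using inv_y by (simp add: min_def)
        qed
        finally show ?thesis .
      qed
      have EE: "E powr (1 / m) \<le> E + E powr (1 / Q)"
      proof (cases "ennreal p \<le> q")
        case True
        then have "m = p" using p by (simp add: m_def min_exp_def min_def)
        then have "E powr (1 / m) \<le> E powr 1" using E p by (intro powr_mono) auto
        then show ?thesis using E by (simp add: add_increasing2)
      next
        case False
        then have "m = Q" by (simp add: m_def min_exp_def min_def Q_def)
        then show ?thesis using E by simp
      qed
      have Gm: "epowr (dyadic_geom y) (1 / m) \<le> ennreal ((E + E powr (1 / Q)) * p' powr (1 / m)) * epowr (ennreal H) (1 / m)"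
      proof -
        have "epowr (dyadic_geom y) (1 / m) \<le> epowr (ennreal (E * p' * H)) (1 / m)"
          using m by (intro epowr_mono G) auto
        also have "\<dots> = ennreal (E powr (1 / m) * p' powr (1 / m) * H powr (1 / m))"
          using E p' H by (simp add: epowr_ennreal powr_mult)
        also have "\<dots> \<le> ennreal ((E + E powr (1 / Q)) * p' powr (1 / m) * H powr (1 / m))"
          by (intro ennreal_leI mult_right_mono EE) auto
        also have "\<dots> = ennreal ((E + E powr (1 / Q)) * p' powr (1 / m)) * epowr (ennreal H) (1 / m)"
          using E H by (simp add: epowr_ennreal ennreal_mult)
        finally show ?thesis .
      qed
      define R where "R = ennreal (C * p' powr (1 / m)) * epowr (Ap_const p w) (1 / p) * epowr (ennreal H) (1 / m)"
      have bound: "lorentz_norm p q w (hl_maximal f) \<le> R * lorentz_norm p q w (\<lambda>x. ennreal \<bar>f x\<bar>)"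
        if f: "f \<in> borel_measurable lebesgue" for f
      proof -
        have "lorentz_norm p q w (hl_maximal f) \<le> ennreal c * epowr (Ap_const p w) (1 / p) *
            epowr (dyadic_geom y) (1 / m) * lorentz_norm p q w (\<lambda>x. ennreal \<bar>f x\<bar>)"
          using lorentz_norm_hl_maximal_le[OF p q w f r1 rp Ar] by (simp add: y_def m_def c_def)
        also have "\<dots> \<le> ennreal c * epowr (Ap_const p w) (1 / p) *
            (ennreal ((E + E powr (1 / Q)) * p' powr (1 / m)) * epowr (ennreal H) (1 / m)) * lorentz_norm p q w (\<lambda>x. ennreal \<bar>f x\<bar>)"
          by (intro mult_right_mono mult_left_mono Gm) auto
        also have "\<dots> = ennreal c * ennreal ((E + E powr (1 / Q)) * p' powr (1 / m)) * epowr (Ap_const p w) (1 / p) *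
             epowr (ennreal H) (1 / m) * lorentz_norm p q w (\<lambda>x. ennreal \<bar>f x\<bar>)"
          by (simp add: mult_ac)
        also have "ennreal c * ennreal ((E + E powr (1 / Q)) * p' powr (1 / m)) = ennreal (C * p' powr (1 / m))"
          using c E by (simp add: C_def mult.assoc flip: ennreal_mult)
        finally show ?thesis by (simp add: R_def)
      qed
      have "R < top"
        using w p m by (auto simp: R_def ennreal_mult_less_top epowr_less_top_iff Ap_def)
      then have "maximal_opnorm p q w \<le> R"
        unfolding maximal_opnorm_def by (intro SUP_least ennreal_divide_leI bound) auto
      then show ?thesis by (simp add: R_def real p'_def m_def)
    qed
  qed
  ultimately show ?thesis by blast
qed

section \<open>Weights of one coordinate\<close>

text \<open>Fubini's theorem: the integrand times the indicator of the cube is a product of functions of the single coordinates.\<close>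

lemma nn_integral_cube_coordinate:
  fixes a :: "real ^ 'n" and h :: "real \<Rightarrow> ennreal"
  assumes [measurable]: "h \<in> borel_measurable borel" and l: "l > 0"
  shows "(\<integral>\<^sup>+ x\<in>cube a l. h (x $ i) \<partial>lebesgue) = (\<integral>\<^sup>+ t\<in>{a $ i..a $ i + l}. h t \<partial>lborel) * ennreal (l ^ (CARD('n) - 1))"
proof -
  define B where "B = (axis i 1 :: real ^ 'n)"
  have B: "B \<in> Basis" by (simp add: B_def)
  define F where "F = (\<lambda>(b :: real ^ 'n) t. indicator {a \<bullet> b..a \<bullet> b + l} t * (if b = B then h t else 1))"
  have [measurable]: "F b \<in> borel_measurable borel" for b
    unfolding F_def by (cases "b = B") simp_all
  have inn: "x \<bullet> B = x $ i" for x :: "real ^ 'n" by (simp add: B_def inner_axis)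
  have prod_ind: "h (x $ i) * indicator (cube a l) x = (\<Prod>b\<in>Basis. F b (x \<bullet> b))" for x
  proof -
    have "(\<Prod>b\<in>Basis. F b (x \<bullet> b)) = (\<Prod>b\<in>Basis. indicator {a \<bullet> b..a \<bullet> b + l} (x \<bullet> b)) * (\<Prod>b\<in>Basis. if b = B then h (x \<bullet> b) else 1)"
      unfolding F_def by (simp only: prod.distrib)
    also have "(\<Prod>b\<in>Basis. if b = B then h (x \<bullet> b) else 1) = h (x $ i)"
      using B by (simp add: prod.delta inn)
    also have "(\<Prod>b\<in>(Basis :: (real ^ 'n) set). indicator {a \<bullet> b..a \<bullet> b + l} (x \<bullet> b)) = (indicator (cube a l) x :: ennreal)"
    proof (cases "x \<in> cube a l")
      case True
      then have "indicator {a \<bullet> b..a \<bullet> b + l} (x \<bullet> b) = (1 :: ennreal)" if "b \<in> Basis" for b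
        using that by (auto simp: Basis_vec_def mem_cube inner_axis)
      then show ?thesis using True by simp
    next
      case False
      then obtain j where j: "\<not> (a $ j \<le> x $ j \<and> x $ j \<le> a $ j + l)" by (auto simp: mem_cube)
      have "(indicator {a \<bullet> axis j 1..a \<bullet> axis j 1 + l} (x \<bullet> axis j 1) :: ennreal) = 0"
        using j by (simp add: inner_axis)
      then have "(\<Prod>b\<in>(Basis :: (real ^ 'n) set). indicator {a \<bullet> b..a \<bullet> b + l} (x \<bullet> b)) = (0 :: ennreal)"
        by (intro prod_zero) (auto intro!: bexI[of _ "axis j 1"])
      then show ?thesis using False by simp
    qed
    finally show ?thesis by (simp add: mult.commute)
  qed
  have "(\<integral>\<^sup>+ x\<in>cube a l. h (x $ i) \<partial>lebesgue) = (\<integral>\<^sup>+ x. (\<Prod>b\<in>Basis. F b (x \<bullet> b)) \<partial>lborel)"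
    by (simp only: prod_ind nn_integral_completion)
  also have "\<dots> = (\<Prod>b\<in>Basis. \<integral>\<^sup>+ t. F b t \<partial>lborel)"
    by (intro nn_integral_lborel_prod) auto
  also have "\<dots> = (\<integral>\<^sup>+ t. F B t \<partial>lborel) * (\<Prod>b\<in>Basis - {B}. \<integral>\<^sup>+ t. F b t \<partial>lborel)"
    using B by (intro prod.remove) auto
  also have "(\<Prod>b\<in>Basis - {B}. \<integral>\<^sup>+ t. F b t \<partial>lborel) = (\<Prod>b\<in>Basis - {B}. ennreal l)"
    using l by (intro prod.cong) (auto simp: F_def)
  also have "\<dots> = ennreal (l ^ (CARD('n) - 1))"
    using B l by (simp add: card_Diff_singleton ennreal_power)
  also have "(\<integral>\<^sup>+ t. F B t \<partial>lborel) = (\<integral>\<^sup>+ t\<in>{a $ i..a $ i + l}. h t \<partial>lborel)"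
    by (simp add: F_def inn mult.commute)
  finally show ?thesis .
qed

lemma avg_cube_coordinate:
  fixes a :: "real ^ 'n" and h :: "real \<Rightarrow> ennreal"
  assumes [measurable]: "h \<in> borel_measurable borel" and l: "l > 0"
  shows "avg (cube a l) (\<lambda>x. h (x $ i)) = (\<integral>\<^sup>+ t\<in>{a $ i..a $ i + l}. h t \<partial>lborel) / ennreal l"
proof -
  define I where "I = (\<integral>\<^sup>+ t\<in>{a $ i..a $ i + l}. h t \<partial>lborel)"
  define c where "c = ennreal (l ^ (CARD('n) - 1))"
  have c: "c \<noteq> 0" "c \<noteq> \<infinity>" using l by (auto simp: c_def)
  have "l ^ CARD('n) = l * l ^ (CARD('n) - 1)"
    by (metis Suc_diff_1 power_Suc zero_less_card_finite)
  then have "ennreal (l ^ CARD('n)) = ennreal l * c" using l by (simp add: c_def ennreal_mult)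
  then have "avg (cube a l) (\<lambda>x. h (x $ i)) = I * c / (ennreal l * c)"
    using nn_integral_cube_coordinate[OF assms, where a = a and i = i] l by (simp add: avg_cube I_def c_def)
  also have "\<dots> = I / ennreal l" using c by (rule divide_mult_eq)
  finally show ?thesis by (simp add: I_def)
qed

lemma AE_coordinate_nonzero: "AE x in lebesgue. (x :: real ^ 'n) $ i \<noteq> 0"
proof -
  have "{x :: real ^ 'n. x $ i = 0} \<in> null_sets lebesgue"
    using negligible_standard_hyperplane_cart[of i] by (simp add: negligible_iff_null_sets)
  then have "AE x in lebesgue. x \<notin> {x :: real ^ 'n. x $ i = 0}" by (rule AE_not_in)
  then show ?thesis by simp
qed

lemma borel_measurable_coordinate [measurable]:
  assumes "h \<in> borel_measurable borel"
  shows "(\<lambda>x :: real ^ 'n. h (x $ i)) \<in> borel_measurable lebesgue"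
proof -
  have "(\<lambda>x :: real ^ 'n. x $ i) \<in> borel_measurable borel"
    by (intro borel_measurable_continuous_onI continuous_intros)
  then have "(\<lambda>x :: real ^ 'n. h (x $ i)) \<in> measurable borel borel"
    using assms by (rule measurable_compose)
  then show ?thesis by (intro measurable_completion) simp
qed

text \<open>Muckenhoupt's \<open>A\<^sub>1\<close> condition on the line: the mean of \<open>g\<close> over an interval is at most \<open>K\<close> times the value of \<open>g\<close> at
  each of its points. The origin is excepted, since the weights used below are singular there.\<close>

definition A1_line :: "(real \<Rightarrow> real) \<Rightarrow> real \<Rightarrow> bool" where
  "A1_line g K \<longleftrightarrow> g \<in> borel_measurable borel \<and> (\<forall>t. g t \<ge> 0) \<and> (\<forall>t. t \<noteq> 0 \<longrightarrow> g t > 0) \<and> K > 0 \<and>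
     (\<forall>a l t. l > 0 \<longrightarrow> a \<le> t \<longrightarrow> t \<le> a + l \<longrightarrow> t \<noteq> 0 \<longrightarrow>
        (\<integral>\<^sup>+ s\<in>{a..a + l}. ennreal (g s) \<partial>lborel) \<le> ennreal (K * l * g t))"

lemma A1_line_avg_le:
  fixes x :: "real ^ 'n"
  assumes g: "A1_line g K" and l: "l > 0" and x: "x \<in> cube a l" "x $ i \<noteq> 0"
  shows "avg (cube a l) (\<lambda>y. ennreal (g (y $ i))) \<le> ennreal (K * g (x $ i))"
proof -
  have [measurable]: "g \<in> borel_measurable borel" using g by (simp add: A1_line_def)
  have K: "K > 0" "g (x $ i) \<ge> 0" using g by (auto simp: A1_line_def)
  have "(\<integral>\<^sup>+ s\<in>{a $ i..a $ i + l}. ennreal (g s) \<partial>lborel) \<le> ennreal (K * l * g (x $ i))"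
    using g l x unfolding A1_line_def mem_cube by blast
  also have "\<dots> = ennreal (K * g (x $ i)) * ennreal l"
    using K l by (simp add: mult_ac flip: ennreal_mult)
  finally show ?thesis using l by (simp add: avg_cube_coordinate[of "\<lambda>t. ennreal (g t)"] ennreal_divide_le_iff)
qed

lemma A1_line_weight:
  assumes g: "A1_line g K"
  shows "weight (\<lambda>x :: real ^ 'n. g (x $ i))"
proof -
  have [measurable]: "g \<in> borel_measurable borel" using g by (simp add: A1_line_def)
  have "AE x :: real ^ 'n in lebesgue. g (x $ i) > 0"
    using AE_coordinate_nonzero[of i] by eventually_elim (use g in \<open>auto simp: A1_line_def\<close>)
  moreover have "locally_integrable (\<lambda>x :: real ^ 'n. g (x $ i))"
  proof (rule locally_integrableI)
    fix a :: "real ^ 'n" and l :: real assume l: "l > 0"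
    obtain t where t: "a $ i \<le> t" "t \<le> a $ i + l" "t \<noteq> 0"
    proof (cases "a $ i = 0")
      case True then show ?thesis using l that[of l] by simp
    next
      case False then show ?thesis using l that[of "a $ i"] by simp
    qed
    then have "(\<integral>\<^sup>+ s\<in>{a $ i..a $ i + l}. ennreal (g s) \<partial>lborel) \<le> ennreal (K * l * g t)"
      using g l unfolding A1_line_def by blast
    also have "\<dots> < top" by simp
    finally show "wmeasure (\<lambda>x. g (x $ i)) (cube a l) < top"
      using l nn_integral_cube_coordinate[where h = "\<lambda>t. ennreal (g t)" and a = a and i = i and l = l]
      by (simp add: wmeasure_def ennreal_mult_less_top)
  qed (use g in \<open>auto simp: A1_line_def\<close>)
  ultimately show ?thesis by (simp add: weight_def)
qed

text \<open>Pointwise \<open>M(v \<chi>\<^sub>Q) \<le> M v \<le> K v\<close> almost everywhere.\<close>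

lemma A1_line_Ainf_const_le:
  assumes g: "A1_line g K"
  shows "Ainf_const (\<lambda>x :: real ^ 'n. g (x $ i)) \<le> ennreal K"
  unfolding Ainf_const_le_iff[OF A1_line_weight[OF g]]
proof (intro allI impI)
  fix a :: "real ^ 'n" and l :: real assume l: "l > 0"
  have [measurable]: "g \<in> borel_measurable borel" using g by (simp add: A1_line_def)
  have g0: "g t \<ge> 0" for t using g by (simp add: A1_line_def)
  have K: "K > 0" using g by (simp add: A1_line_def)
  have M: "hl_maximal (\<lambda>y. g (y $ i) * indicator (cube a l) y) x \<le> ennreal K * ennreal (g (x $ i))" if "x $ i \<noteq> 0" for x
    unfolding hl_maximal_def
  proof (rule SUP_least, safe)
    fix Q :: "(real ^ 'n) set" assume "Q \<in> cubes" "x \<in> Q"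
    then obtain b m where Q: "Q = cube b m" "m > 0" by (auto elim: cubesE)
    have "avg Q (\<lambda>y. ennreal \<bar>g (y $ i) * indicator (cube a l) y\<bar>) \<le> avg Q (\<lambda>y. ennreal (g (y $ i)))"
      using g0 by (intro avg_cube_mono ennreal_leI) (auto simp: indicator_def)
    also have "\<dots> \<le> ennreal (K * g (x $ i))"
      unfolding Q(1) using \<open>x \<in> Q\<close> Q that by (intro A1_line_avg_le[OF g]) auto
    finally show "avg Q (\<lambda>y. ennreal \<bar>g (y $ i) * indicator (cube a l) y\<bar>) \<le> ennreal K * ennreal (g (x $ i))"
      using K g0 by (simp add: ennreal_mult)
  qed
  have "(\<integral>\<^sup>+ x\<in>cube a l. hl_maximal (\<lambda>y. g (y $ i) * indicator (cube a l) y) x \<partial>lebesgue)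
      \<le> (\<integral>\<^sup>+ x. ennreal K * (ennreal (g (x $ i)) * indicator (cube a l) x) \<partial>lebesgue)"
  proof (rule nn_integral_mono_AE)
    show "AE x in lebesgue. hl_maximal (\<lambda>y. g (y $ i) * indicator (cube a l) y) x * indicator (cube a l) x
        \<le> ennreal K * (ennreal (g (x $ i)) * indicator (cube a l) x)"
      using AE_coordinate_nonzero[of i]
    proof eventually_elim
      case (elim x)
      then show ?case by (cases "x \<in> cube a l") (simp_all add: M)
    qed
  qed
  also have "\<dots> = ennreal K * wmeasure (\<lambda>x. g (x $ i)) (cube a l)"
    unfolding wmeasure_def by (intro nn_integral_cmult) measurable
  finally show "(\<integral>\<^sup>+ x\<in>cube a l. hl_maximal (\<lambda>y. g (y $ i) * indicator (cube a l) y) x \<partial>lebesgue)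
      \<le> ennreal K * wmeasure (\<lambda>x. g (x $ i)) (cube a l)" .
qed

text \<open>The pointwise inequality \<open>(mean of v) powr s \<le> K powr s * v powr s\<close> is multiplied by \<open>v powr (- s)\<close> and averaged.\<close>

lemma A1_line_negative_power:
  fixes a :: "real ^ 'n"
  assumes g: "A1_line g K" and s: "s > 0" and l: "l > 0"
  shows "avg (cube a l) (\<lambda>x. ennreal (g (x $ i) powr (- s))) * epowr (avg (cube a l) (\<lambda>x. ennreal (g (x $ i)))) s
      \<le> ennreal (K powr s)"
proof -
  have [measurable]: "g \<in> borel_measurable borel" using g by (simp add: A1_line_def)
  have K: "K > 0" using g by (simp add: A1_line_def)
  define Q where "Q = cube a l"
  have [measurable]: "Q \<in> sets lebesgue" by (simp add: Q_def)
  define A where "A = epowr (avg Q (\<lambda>x. ennreal (g (x $ i)))) s"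
  have pw: "ennreal (g (x $ i) powr (- s)) * A \<le> ennreal (K powr s)" if x: "x \<in> Q" "x $ i \<noteq> 0" for x
  proof -
    have gx: "g (x $ i) > 0" using g x by (simp add: A1_line_def)
    have "A \<le> epowr (ennreal (K * g (x $ i))) s"
      unfolding A_def Q_def using s x A1_line_avg_le[OF g l, of x a i] by (intro epowr_mono) (auto simp: Q_def)
    also have "\<dots> = ennreal (K powr s * g (x $ i) powr s)"
      using K gx by (simp add: epowr_ennreal powr_mult)
    finally have "ennreal (g (x $ i) powr (- s)) * A \<le> ennreal (g (x $ i) powr (- s)) * ennreal (K powr s * g (x $ i) powr s)"
      by (rule mult_left_mono) simp
    also have "\<dots> = ennreal (K powr s)"
      using gx by (simp add: powr_minus field_simps flip: ennreal_mult)
    finally show ?thesis .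
  qed
  define N where "N = (\<integral>\<^sup>+ x\<in>Q. ennreal (g (x $ i) powr (- s)) \<partial>lebesgue)"
  have "N * A = (\<integral>\<^sup>+ x. ennreal (g (x $ i) powr (- s)) * indicator Q x * A \<partial>lebesgue)"
    unfolding N_def by (subst nn_integral_multc) auto
  also have "\<dots> \<le> (\<integral>\<^sup>+ x. ennreal (K powr s) * indicator Q x \<partial>lebesgue)"
    using AE_coordinate_nonzero[of i]
    by (intro nn_integral_mono_AE) (auto elim!: eventually_mono simp: indicator_def pw)
  also have "\<dots> = ennreal (K powr s) * emeasure lebesgue Q" by (simp add: nn_integral_cmult_indicator)
  also have "emeasure lebesgue Q = ennreal (l ^ CARD('n))" unfolding Q_def using l by (intro emeasure_cube) auto
  finally have "A * N / ennreal (l ^ CARD('n)) \<le> ennreal (K powr s)"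
    using l by (simp add: ennreal_divide_le_iff mult.commute)
  then have "A * (N / ennreal (l ^ CARD('n))) \<le> ennreal (K powr s)"
    by (simp add: ennreal_times_divide)
  then show ?thesis
    using l by (simp add: A_def N_def Q_def avg_cube mult.commute)
qed

text \<open>The case \<open>s = p - 1\<close> of the previous inequality: an \<open>A\<^sub>1\<close> weight is the dual weight of an \<open>A\<^sub>p\<close> weight.\<close>

lemma A1_line_negative_power_Ap:
  fixes i :: "'n::finite"
  assumes g: "A1_line g K" and p: "p > 1"
  defines "w \<equiv> (\<lambda>x :: real ^ 'n. g (x $ i) powr (1 - p))"
  shows "w \<in> Ap p" "Ap_const p w \<le> ennreal (K powr (p - 1))" "dual_weight p w = (\<lambda>x. g (x $ i))"
proof -
  have [measurable]: "g \<in> borel_measurable borel" using g by (simp add: A1_line_def)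
  have g0: "g t \<ge> 0" for t using g by (simp add: A1_line_def)
  have "(1 - p) * (1 - conj_exp p) = 1" using conj_exp_identities(2)[OF p] by (simp add: algebra_simps)
  then show dual: "dual_weight p w = (\<lambda>x. g (x $ i))"
    using g0 by (auto simp: dual_weight_def w_def powr_powr fun_eq_iff)
  have cube_le: "avg (cube a l) (\<lambda>x. ennreal (w x)) * epowr (avg (cube a l) (\<lambda>x. ennreal (dual_weight p w x))) (p - 1)
      \<le> ennreal (K powr (p - 1))" if "l > 0" for a l
    using A1_line_negative_power[OF g _ that, of "p - 1" a i] p unfolding dual by (simp add: w_def)
  show Ap: "Ap_const p w \<le> ennreal (K powr (p - 1))"
    unfolding Ap_const_def
  proof (rule SUP_least)
    fix Q :: "(real ^ 'n) set" assume "Q \<in> cubes"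
    then obtain a l where "Q = cube a l" "l > 0" by (rule cubesE)
    then show "avg Q (\<lambda>x. ennreal (w x)) * epowr (avg Q (\<lambda>x. ennreal (w x powr (1 - conj_exp p)))) (p - 1) \<le> ennreal (K powr (p - 1))"
      using cube_le[of l a] by (simp add: dual_weight_def)
  qed
  have [measurable]: "w \<in> borel_measurable lebesgue" unfolding w_def by measurable
  have "AE x in lebesgue. w x > 0"
    using AE_coordinate_nonzero[of i] by eventually_elim (use g in \<open>auto simp: A1_line_def w_def\<close>)
  moreover have "locally_integrable w"
  proof (rule locally_integrableI)
    fix a :: "real ^ 'n" and l :: real assume l: "l > 0"
    have "wmeasure (\<lambda>x. g (x $ i)) (cube a l) > 0"
      using weightD[OF A1_line_weight[OF g]] by (intro wmeasure_cube_pos l) auto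
    then have "avg (cube a l) (\<lambda>x. ennreal (dual_weight p w x)) \<noteq> 0"
      using l by (simp add: dual avg_cube wmeasure_def)
    then have "epowr (avg (cube a l) (\<lambda>x. ennreal (dual_weight p w x))) (p - 1) \<noteq> 0"
      using p by (simp add: epowr_eq_0_iff)
    then have "avg (cube a l) (\<lambda>x. ennreal (w x)) \<noteq> top"
      using cube_le[OF l, of a] by (auto simp: ennreal_top_mult top_unique)
    then show "wmeasure w (cube a l) < top"
      using l by (simp add: avg_cube wmeasure_def ennreal_divide_eq_top_iff less_top)
  qed (auto simp: w_def)
  ultimately have "weight w" by (simp add: weight_def)
  moreover have "Ap_const p w < top" using Ap by (rule order.strict_trans1) simp
  ultimately show "w \<in> Ap p" by (simp add: Ap_def)
qed

text \<open>The case \<open>s = 1 / (p - 1)\<close>, raised to the power \<open>p - 1\<close>.\<close>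

lemma A1_line_Ap:
  fixes i :: "'n::finite"
  assumes g: "A1_line g K" and p: "p > 1"
  defines "w \<equiv> (\<lambda>x :: real ^ 'n. g (x $ i))"
  shows "w \<in> Ap p" "Ap_const p w \<le> ennreal K"
proof -
  have K: "K > 0" using g by (simp add: A1_line_def)
  define s where "s = 1 / (p - 1)"
  have s: "s > 0" "1 - conj_exp p = - s" "s * (p - 1) = 1"
    using p conj_exp_identities(1)[OF p] by (auto simp: s_def)
  show Ap: "Ap_const p w \<le> ennreal K"
    unfolding Ap_const_def
  proof (rule SUP_least)
    fix Q :: "(real ^ 'n) set" assume "Q \<in> cubes"
    then obtain a l where Q: "Q = cube a l" "l > 0" by (rule cubesE)
    have "epowr (avg Q (\<lambda>x. ennreal (w x powr (- s))) * epowr (avg Q (\<lambda>x. ennreal (w x))) s) (p - 1)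
        \<le> epowr (ennreal (K powr s)) (p - 1)"
      using A1_line_negative_power[OF g s(1) Q(2), of a i] p unfolding Q(1) w_def
      by (intro epowr_mono) auto
    also have "\<dots> = ennreal K" using K s by (simp add: epowr_ennreal powr_powr)
    finally show "avg Q (\<lambda>x. ennreal (w x)) * epowr (avg Q (\<lambda>x. ennreal (w x powr (1 - conj_exp p)))) (p - 1) \<le> ennreal K"
      using p s by (simp add: epowr_mult epowr_epowr mult.commute)
  qed
  have "Ap_const p w < top" using Ap by (rule order.strict_trans1) simp
  then show "w \<in> Ap p" using A1_line_weight[OF g, of i] by (simp add: Ap_def w_def)
qed

text \<open>The maximal function of \<open>v \<chi>\<^sub>Q\<close> never exceeds the supremum of \<open>v\<close> over \<open>Q\<close>.\<close>

lemma Ainf_const_le_of_sup_le_avg: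
  fixes v :: "real ^ 'n \<Rightarrow> real"
  assumes v: "weight v" and nonneg: "\<And>x. v x \<ge> 0"
    and sup: "\<And>a l x. l > 0 \<Longrightarrow> x \<in> cube a l \<Longrightarrow> ennreal (v x) \<le> ennreal K * avg (cube a l) (\<lambda>y. ennreal (v y))"
  shows "Ainf_const v \<le> ennreal K"
  unfolding Ainf_const_le_iff[OF v]
proof (intro allI impI)
  fix a :: "real ^ 'n" and l :: real assume l: "l > 0"
  define Q where "Q = cube a l"
  have [measurable]: "Q \<in> sets lebesgue" by (simp add: Q_def)
  define A where "A = ennreal K * avg Q (\<lambda>y. ennreal (v y))"
  have M: "hl_maximal (\<lambda>y. v y * indicator Q y) x \<le> A" for x
    unfolding hl_maximal_def
  proof (rule SUP_least, safe)
    fix R :: "(real ^ 'n) set" assume "R \<in> cubes"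
    then obtain b m where R: "R = cube b m" "m > 0" by (auto elim: cubesE)
    have "avg R (\<lambda>y. ennreal \<bar>v y * indicator Q y\<bar>) \<le> avg R (\<lambda>y. A)"
      using sup[OF l, of _ a] nonneg by (intro avg_cube_mono) (auto simp: indicator_def A_def Q_def)
    also have "\<dots> \<le> A"
      using R emeasure_cube[of m b] by (simp add: avg_le_iff nn_integral_cmult_indicator)
    finally show "avg R (\<lambda>y. ennreal \<bar>v y * indicator Q y\<bar>) \<le> A" .
  qed
  have "(\<integral>\<^sup>+ x\<in>Q. hl_maximal (\<lambda>y. v y * indicator Q y) x \<partial>lebesgue) \<le> (\<integral>\<^sup>+ x. A * indicator Q x \<partial>lebesgue)"
    using M by (intro nn_integral_mono) (auto simp: indicator_def)
  also have "\<dots> = A * ennreal (l ^ CARD('n))"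
    using l emeasure_cube[of l a] by (simp add: nn_integral_cmult_indicator Q_def)
  also have "\<dots> = ennreal K * (wmeasure v Q / ennreal (l ^ CARD('n)) * ennreal (l ^ CARD('n)))"
    using l by (simp add: A_def Q_def avg_cube wmeasure_def mult.assoc)
  also have "wmeasure v Q / ennreal (l ^ CARD('n)) * ennreal (l ^ CARD('n)) = wmeasure v Q"
    using l by (simp add: ennreal_divide_times)
  finally show "(\<integral>\<^sup>+ x\<in>cube a l. hl_maximal (\<lambda>y. v y * indicator (cube a l) y) x \<partial>lebesgue)
      \<le> ennreal K * wmeasure v (cube a l)" by (simp add: Q_def)
qed

text \<open>On the quarter of the interval adjacent to the end point farther from the origin, \<open>|s|\<close> is at least half of its
  maximum.\<close>

lemma abs_powr_le_average:
  fixes a l t c :: real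
  assumes l: "l > 0" and t: "a \<le> t" "t \<le> a + l" and c: "c \<ge> 0"
  shows "ennreal (\<bar>t\<bar> powr c * l) \<le> ennreal (4 * 2 powr c) * (\<integral>\<^sup>+ s\<in>{a..a + l}. ennreal (\<bar>s\<bar> powr c) \<partial>lborel)"
proof -
  define m where "m = max \<bar>a\<bar> \<bar>a + l\<bar>"
  have "\<bar>a\<bar> \<le> m" "\<bar>a + l\<bar> \<le> m" by (simp_all add: m_def)
  then have m: "m \<ge> \<bar>t\<bar>" "l \<le> 2 * m" using t l by linarith+
  obtain b where b: "a \<le> b" "b + l / 4 \<le> a + l" "\<And>s. b \<le> s \<Longrightarrow> s \<le> b + l / 4 \<Longrightarrow> m / 2 \<le> \<bar>s\<bar>"
  proof (cases "\<bar>a\<bar> \<le> a + l")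
    case True
    then show ?thesis using l by (intro that[of "a + l - l / 4"]) (auto simp: m_def)
  next
    case False
    then have "m = - a" using l by (auto simp: m_def)
    with l m(2) show ?thesis by (intro that[of a]) (auto simp: abs_if)
  qed
  have "ennreal (\<bar>t\<bar> powr c * l) \<le> ennreal (4 * 2 powr c * ((m / 2) powr c * (l / 4)))"
  proof (rule ennreal_leI)
    have "\<bar>t\<bar> powr c \<le> m powr c" using m c by (intro powr_mono2) auto
    also have "\<dots> = 2 powr c * (m / 2) powr c" using m l by (simp flip: powr_mult)
    finally show "\<bar>t\<bar> powr c * l \<le> 4 * 2 powr c * ((m / 2) powr c * (l / 4))"
      using l by (simp add: mult_right_mono)
  qed
  also have "\<dots> = ennreal (4 * 2 powr c) * (ennreal ((m / 2) powr c) * ennreal (l / 4))"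
    using l by (subst ennreal_mult[symmetric], simp, simp)+ simp
  also have "ennreal ((m / 2) powr c) * ennreal (l / 4) = (\<integral>\<^sup>+ s. ennreal ((m / 2) powr c) * indicator {b..b + l / 4} s \<partial>lborel)"
    using l by (simp add: nn_integral_cmult_indicator)
  also have "\<dots> \<le> (\<integral>\<^sup>+ s\<in>{a..a + l}. ennreal (\<bar>s\<bar> powr c) \<partial>lborel)"
    using b c m l by (intro nn_integral_mono) (auto simp: indicator_def intro!: ennreal_leI powr_mono2)
  finally show ?thesis by (simp add: mult_left_mono)
qed

text \<open>The power \<open>|t| powr (e - 1)\<close>, replaced for \<open>|t| \<le> d\<close> by the constant that has the same integral over \<open>[-d, d]\<close>. For
  \<open>d = 0\<close> it is the power itself.\<close>

definition trunc_power :: "real \<Rightarrow> real \<Rightarrow> real \<Rightarrow> real" where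
  "trunc_power d e t = (if \<bar>t\<bar> \<le> d then d powr (e - 1) / e else \<bar>t\<bar> powr (e - 1))"

lemma nn_integral_powr_from_0:
  assumes "e > 0" "m \<ge> 0"
  shows "(\<integral>\<^sup>+ t\<in>{0..m}. ennreal (t powr (e - 1)) \<partial>lborel) = ennreal (m powr e / e)"
proof -
  have "((\<lambda>x. x powr (e - 1)) has_integral m powr (e - 1 + 1) / (e - 1 + 1)) {0..m}"
    using assms by (intro has_integral_powr_from_0) auto
  then have "(\<integral>\<^sup>+ t. ennreal (indicator {0..m} t * t powr (e - 1)) \<partial>lborel) = ennreal (m powr e / e)"
    by (intro nn_integral_has_integral_lebesgue) auto
  then show ?thesis by (simp add: ennreal_mult' ennreal_indicator mult.commute)
qed

lemma nn_integral_trunc_power: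
  assumes e: "0 < e" and d: "0 \<le> d" "d \<le> m"
  shows "(\<integral>\<^sup>+ t\<in>{0..m}. ennreal (trunc_power d e t) \<partial>lborel) = ennreal (m powr e / e)"
proof -
  let ?I = "\<integral>\<^sup>+ t\<in>{d<..m}. ennreal (t powr (e - 1)) \<partial>lborel"
  have "(\<integral>\<^sup>+ t\<in>{0..m}. ennreal (trunc_power d e t) \<partial>lborel)
      = (\<integral>\<^sup>+ t. ennreal (d powr (e - 1) / e) * indicator {0..d} t + ennreal (t powr (e - 1)) * indicator {d<..m} t \<partial>lborel)"
    using d by (intro nn_integral_cong) (auto simp: trunc_power_def indicator_def)
  also have "\<dots> = ennreal (d powr (e - 1) / e) * ennreal d + ?I"
    using d by (subst nn_integral_add) (auto simp: nn_integral_cmult_indicator)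
  also have "ennreal (d powr (e - 1) / e) * ennreal d = ennreal (d powr e / e)"
    using d e by (cases "d = 0") (auto simp: powr_diff simp flip: ennreal_mult)
  also have "\<dots> = (\<integral>\<^sup>+ t\<in>{0..d}. ennreal (t powr (e - 1)) \<partial>lborel)"
    using nn_integral_powr_from_0[of e d] d e by simp
  also have "\<dots> + ?I = (\<integral>\<^sup>+ t. ennreal (t powr (e - 1)) * indicator {0..d} t + ennreal (t powr (e - 1)) * indicator {d<..m} t \<partial>lborel)"
    by (subst nn_integral_add) auto
  also have "\<dots> = (\<integral>\<^sup>+ t\<in>{0..m}. ennreal (t powr (e - 1)) \<partial>lborel)"
    using d by (intro nn_integral_cong) (auto simp: indicator_def)
  also have "\<dots> = ennreal (m powr e / e)" using nn_integral_powr_from_0[of e m] d e by simp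
  finally show ?thesis .
qed

text \<open>Let \<open>m\<close> be the largest absolute value on the interval. An interval of length at least \<open>m / 2\<close> is compared with \<open>[-m, m]\<close>.
  A shorter one stays outside \<open>|s| < m / 2\<close>, where \<open>g \<le> g (m / 2) \<le> 2 k g m\<close> by the hypothesis on the integral and
  monotonicity.\<close>

lemma A1_line_of_decreasing:
  fixes g :: "real \<Rightarrow> real"
  assumes g[measurable]: "g \<in> borel_measurable borel" and g0: "\<And>t. g t \<ge> 0" and gpos: "\<And>t. t \<noteq> 0 \<Longrightarrow> g t > 0"
    and even: "\<And>t. g (- t) = g t" and dec: "\<And>s t. 0 < s \<Longrightarrow> s \<le> t \<Longrightarrow> g t \<le> g s"
    and k: "k \<ge> 1" and int: "\<And>m. m > 0 \<Longrightarrow> (\<integral>\<^sup>+ t\<in>{0..m}. ennreal (g t) \<partial>lborel) \<le> ennreal (k * m * g m)"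
  shows "A1_line g (4 * k)"
  unfolding A1_line_def
proof (intro conjI allI impI)
  fix a l t :: real assume l: "l > 0" and t: "a \<le> t" "t \<le> a + l" "t \<noteq> 0"
  define m where "m = max \<bar>a\<bar> \<bar>a + l\<bar>"
  have "\<bar>a\<bar> \<le> m" "\<bar>a + l\<bar> \<le> m" by (simp_all add: m_def)
  then have m: "m > 0" "\<bar>t\<bar> \<le> m" using t l by linarith+
  have g_abs: "g \<bar>t\<bar> = g t" for t using even[of t] by (auto simp: abs_if)
  have gm: "g m \<le> g t" using dec[of "\<bar>t\<bar>" m] t m by (simp add: g_abs)
  have mg: "g m > 0" using gpos[of m] m by simp
  have refl: "(\<integral>\<^sup>+ s\<in>{-m..0}. ennreal (g s) \<partial>lborel) = (\<integral>\<^sup>+ s\<in>{0..m}. ennreal (g s) \<partial>lborel)"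
  proof -
    have "(\<integral>\<^sup>+ s\<in>{-m..0}. ennreal (g s) \<partial>lborel)
        = ennreal \<bar>-1\<bar> * (\<integral>\<^sup>+ x. ennreal (g (0 + (-1) * x)) * indicator {-m..0} (0 + (-1) * x) \<partial>lborel)"
      by (intro nn_integral_real_affine) auto
    also have "\<dots> = (\<integral>\<^sup>+ s\<in>{0..m}. ennreal (g s) \<partial>lborel)"
      by (simp add: even) (intro nn_integral_cong, auto simp: indicator_def)
    finally show ?thesis .
  qed
  show "(\<integral>\<^sup>+ s\<in>{a..a + l}. ennreal (g s) \<partial>lborel) \<le> ennreal (4 * k * l * g t)"
  proof (cases "l \<ge> m / 2")
    case True
    have "(\<integral>\<^sup>+ s\<in>{a..a + l}. ennreal (g s) \<partial>lborel)
        \<le> (\<integral>\<^sup>+ s. ennreal (g s) * indicator {-m..0} s + ennreal (g s) * indicator {0..m} s \<partial>lborel)"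
      by (intro nn_integral_mono) (auto simp: indicator_def m_def)
    also have "\<dots> = (\<integral>\<^sup>+ s\<in>{0..m}. ennreal (g s) \<partial>lborel) + (\<integral>\<^sup>+ s\<in>{0..m}. ennreal (g s) \<partial>lborel)"
      by (subst nn_integral_add) (auto simp: refl)
    also have "\<dots> \<le> ennreal (k * m * g m) + ennreal (k * m * g m)" by (intro add_mono int m)
    also have "\<dots> = ennreal (2 * k * m * g m)" using k m mg by (simp flip: ennreal_plus)
    also have "\<dots> \<le> ennreal (4 * k * l * g t)"
    proof (rule ennreal_leI)
      have "2 * k * m \<le> 4 * k * l" using True k mult_left_mono[of m "2 * l" "2 * k"] by simp
      then show "2 * k * m * g m \<le> 4 * k * l * g t"
        by (rule mult_mono) (use k m mg gm l in auto)
    qed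
    finally show ?thesis .
  next
    case False
    have "ennreal (m / 2 * g (m / 2)) = (\<integral>\<^sup>+ s. ennreal (g (m / 2)) * indicator {0<..m/2} s \<partial>lborel)"
      using m g0 by (simp add: nn_integral_cmult_indicator mult.commute flip: ennreal_mult)
    also have "\<dots> \<le> (\<integral>\<^sup>+ s\<in>{0..m}. ennreal (g s) \<partial>lborel)"
      using m by (intro nn_integral_mono) (auto simp: indicator_def intro!: ennreal_leI dec)
    also have "\<dots> \<le> ennreal (k * m * g m)" by (intro int m)
    finally have "m / 2 * g (m / 2) \<le> k * m * g m" using k m mg by (subst (asm) ennreal_le_iff) auto
    then have gm2: "g (m / 2) \<le> 2 * k * g m" using m by (simp add: field_simps)
    have far: "m / 2 \<le> \<bar>s\<bar>" if "a \<le> s" "s \<le> a + l" for s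
      using that False l unfolding m_def by (auto simp: max_def abs_if split: if_splits)
    have "g s \<le> g (m / 2)" if "a \<le> s" "s \<le> a + l" for s
      using dec[of "m / 2" "\<bar>s\<bar>"] far[OF that] m by (simp add: g_abs)
    then have "(\<integral>\<^sup>+ s\<in>{a..a + l}. ennreal (g s) \<partial>lborel) \<le> (\<integral>\<^sup>+ s. ennreal (g (m / 2)) * indicator {a..a + l} s \<partial>lborel)"
      by (intro nn_integral_mono) (auto simp: indicator_def intro!: ennreal_leI)
    also have "\<dots> = ennreal (g (m / 2) * l)" using l g0 by (simp add: nn_integral_cmult_indicator ennreal_mult)
    also have "\<dots> \<le> ennreal (4 * k * l * g t)"
    proof (rule ennreal_leI)
      have "g (m / 2) * l \<le> (2 * k * g m) * l" using gm2 l by (intro mult_right_mono) auto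
      also have "\<dots> \<le> (4 * k * g t) * l" using k gm mg l by (intro mult_right_mono mult_mono) auto
      finally show "g (m / 2) * l \<le> 4 * k * l * g t" by (simp add: mult_ac)
    qed
    finally show ?thesis .
  qed
qed (use g0 gpos k in auto)

lemma A1_line_trunc_power:
  assumes e: "0 < e" "e < 1" and d: "0 \<le> d"
  shows "A1_line (trunc_power d e) (4 * (1 / e))"
proof (rule A1_line_of_decreasing)
  show "trunc_power d e \<in> borel_measurable borel" unfolding trunc_power_def by measurable
  show "trunc_power d e t \<ge> 0" for t using e by (simp add: trunc_power_def)
  show "trunc_power d e t > 0" if "t \<noteq> 0" for t using e d that by (auto simp: trunc_power_def)
  show "trunc_power d e (- t) = trunc_power d e t" for t by (simp add: trunc_power_def)
  have key: "t powr (e - 1) \<le> d powr (e - 1) / e" if "0 < d" "d \<le> t" for t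
  proof -
    have "t powr (e - 1) \<le> d powr (e - 1)" using that e by (intro powr_mono2') auto
    also have "\<dots> \<le> d powr (e - 1) / e" using e by (simp add: pos_le_divide_eq mult_left_le)
    finally show ?thesis .
  qed
  show "trunc_power d e t \<le> trunc_power d e s" if "0 < s" "s \<le> t" for s t
    using that e d key[of t] by (auto simp: trunc_power_def intro!: powr_mono2')
  show "1 / e \<ge> 1" using e by simp
  show "(\<integral>\<^sup>+ t\<in>{0..m}. ennreal (trunc_power d e t) \<partial>lborel) \<le> ennreal (1 / e * m * trunc_power d e m)" if m: "m > 0" for m
  proof (cases "m \<le> d")
    case True
    then have "d > 0" using m by simp
    have "(\<integral>\<^sup>+ t\<in>{0..m}. ennreal (trunc_power d e t) \<partial>lborel) = (\<integral>\<^sup>+ t. ennreal (d powr (e - 1) / e) * indicator {0..m} t \<partial>lborel)"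
      using True by (intro nn_integral_cong) (auto simp: trunc_power_def indicator_def)
    also have "\<dots> = ennreal (d powr (e - 1) / e * m)" using m e by (subst nn_integral_cmult_indicator) (auto simp flip: ennreal_mult)
    also have "\<dots> \<le> ennreal (1 / e * m * trunc_power d e m)"
    proof (rule ennreal_leI)
      have "1 * (d powr (e - 1) / e * m) \<le> 1 / e * (d powr (e - 1) / e * m)"
        using m e by (intro mult_right_mono) auto
      then show "d powr (e - 1) / e * m \<le> 1 / e * m * trunc_power d e m"
        using True m by (simp add: trunc_power_def mult_ac)
    qed
    finally show ?thesis .
  next
    case False
    then have "(\<integral>\<^sup>+ t\<in>{0..m}. ennreal (trunc_power d e t) \<partial>lborel) = ennreal (m powr e / e)"
      using e d by (intro nn_integral_trunc_power) auto
    also have "m powr e / e = 1 / e * m * trunc_power d e m"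
      using False m by (simp add: trunc_power_def powr_diff)
    finally show ?thesis by simp
  qed
qed

section \<open>Lower bounds for Lorentz and operator norms\<close>

text \<open>The average of a function of one coordinate over a cube inside the unit cube whose i-th side is \<open>[0, \<tau>]\<close>. The other
  coordinates of its corner can be chosen such that it contains \<open>x\<close> because \<open>\<tau> \<le> 1\<close>.\<close>

lemma hl_maximal_ge_coordinate_avg:
  fixes x :: "real ^ 'n" and \<phi> :: "real \<Rightarrow> real"
  assumes [measurable]: "\<phi> \<in> borel_measurable borel" and nonneg: "\<And>t. \<phi> t \<ge> 0"
    and \<tau>: "0 < \<tau>" "\<tau> \<le> 1" and x: "x \<in> cube 0 1" "x $ i \<le> \<tau>"
  shows "(\<integral>\<^sup>+ t\<in>{0..\<tau>}. ennreal (\<phi> t) \<partial>lborel) / ennreal \<tau>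
    \<le> hl_maximal (\<lambda>y. \<phi> (y $ i) * indicator (cube 0 1) y) x"
proof -
  define U where "U = cube (0 :: real ^ 'n) 1"
  define a where "a = (\<chi> j. if j = i then 0 else min (x $ j) (1 - \<tau>))"
  have xj: "0 \<le> x $ j" "x $ j \<le> 1" for j using x(1)[unfolded mem_cube, rule_format, of j] by auto
  have sub: "cube a \<tau> \<subseteq> U"
  proof
    fix y assume y: "y \<in> cube a \<tau>"
    have "0 $ j \<le> y $ j \<and> y $ j \<le> 0 $ j + 1" for j
      using y[unfolded mem_cube, rule_format, of j] xj[of j] \<tau> by (auto simp: a_def split: if_splits)
    then show "y \<in> U" unfolding U_def mem_cube by blast
  qed
  have xa: "x \<in> cube a \<tau>"
    unfolding mem_cube
  proof
    fix j show "a $ j \<le> x $ j \<and> x $ j \<le> a $ j + \<tau>"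
      using xj[of j] x(2) \<tau> by (auto simp: a_def)
  qed
  have "(\<integral>\<^sup>+ t\<in>{0..\<tau>}. ennreal (\<phi> t) \<partial>lborel) / ennreal \<tau> = avg (cube a \<tau>) (\<lambda>y. ennreal (\<phi> (y $ i)))"
    using avg_cube_coordinate[where h = "\<lambda>t. ennreal (\<phi> t)" and a = a and l = \<tau> and i = i] \<tau>
    by (simp add: a_def)
  also have "\<dots> \<le> avg (cube a \<tau>) (\<lambda>y. ennreal \<bar>\<phi> (y $ i) * indicator U y\<bar>)"
    using sub nonneg by (intro avg_cube_mono) auto
  also have "\<dots> \<le> hl_maximal (\<lambda>y. \<phi> (y $ i) * indicator U y) x"
    using xa \<tau> by (intro avg_le_hl_maximal) auto
  finally show ?thesis by (simp only: U_def)
qed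

lemma wmeasure_unit_cube_slab:
  fixes i :: "'n::finite"
  assumes [measurable]: "g \<in> borel_measurable borel" "T \<in> sets borel"
  shows "wmeasure (\<lambda>x :: real ^ 'n. g (x $ i)) {x \<in> cube 0 1. x $ i \<in> T} = (\<integral>\<^sup>+ t\<in>{0..1} \<inter> T. ennreal (g t) \<partial>lborel)"
proof -
  define U where "U = cube (0 :: real ^ 'n) 1"
  have "wmeasure (\<lambda>x :: real ^ 'n. g (x $ i)) {x \<in> U. x $ i \<in> T} = (\<integral>\<^sup>+ x\<in>U. ennreal (g (x $ i)) * indicator T (x $ i) \<partial>lebesgue)"
    unfolding wmeasure_def by (intro nn_integral_cong) (auto simp: indicator_def)
  also have "\<dots> = (\<integral>\<^sup>+ t\<in>{0..1}. ennreal (g t) * indicator T t \<partial>lborel)"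
    using nn_integral_cube_coordinate[where h = "\<lambda>t. ennreal (g t) * indicator T t" and a = 0 and l = 1 and i = i]
    by (simp add: U_def)
  also have "\<dots> = (\<integral>\<^sup>+ t\<in>{0..1} \<inter> T. ennreal (g t) \<partial>lborel)"
    by (intro nn_integral_cong) (auto simp: indicator_def)
  finally show ?thesis by (simp only: U_def)
qed

text \<open>The quasinorm of the indicator of a set of measure 1.\<close>

definition lorentz_const :: "real \<Rightarrow> ennreal \<Rightarrow> real" where
  "lorentz_const p q = (if q = top then 1 else (p / enn2real q) powr (1 / enn2real q))"

lemma enn2real_gt_0: "0 < q \<Longrightarrow> q \<noteq> top \<Longrightarrow> enn2real q > 0"
  by (simp add: enn2real_positive_iff less_top)

lemma lorentz_const_pos: "p > 0 \<Longrightarrow> q > 0 \<Longrightarrow> lorentz_const p q > 0"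
  using enn2real_gt_0[of q] by (auto simp: lorentz_const_def)

lemma lorentz_integral_power:
  assumes Q: "Q > 0" and c: "c > 0"
  shows "(\<integral>\<^sup>+ s\<in>{0<..c}. ennreal (s powr Q) / ennreal s \<partial>lborel) = ennreal (c powr Q / Q)"
proof -
  have "(\<integral>\<^sup>+ s\<in>{0<..c}. ennreal (s powr Q) / ennreal s \<partial>lborel) = (\<integral>\<^sup>+ s\<in>{0..c}. ennreal (s powr (Q - 1)) \<partial>lborel)"
    by (intro nn_integral_cong) (auto simp: indicator_def divide_ennreal powr_diff)
  also have "\<dots> = ennreal (c powr Q / Q)" using assms by (intro nn_integral_powr_from_0) auto
  finally show ?thesis .
qed

lemma lorentz_norm_ge:
  assumes p: "p > 0" and q: "q > 0" and c: "c > 0" and G: "\<And>x. x \<in> G \<Longrightarrow> ennreal c < F x"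
  shows "ennreal (c * lorentz_const p q) * epowr (wmeasure w G) (1 / p) \<le> lorentz_norm p q w F"
proof -
  have sub: "wmeasure w G \<le> wmeasure w {x. F x > ennreal s}" if "s \<le> c" for s
    using that G by (intro wmeasure_mono) (auto intro: le_less_trans[OF ennreal_leI])
  show ?thesis
  proof (cases "q = top")
    case True
    have "ennreal c * epowr (wmeasure w G) (1 / p) \<le> ennreal c * epowr (wmeasure w {x. F x > ennreal c}) (1 / p)"
      using p sub[of c] by (intro mult_left_mono epowr_mono) auto
    also have "\<dots> \<le> lorentz_norm p q w F"
      using c True unfolding lorentz_norm_def by (auto intro: SUP_upper)
    finally show ?thesis using True by (simp add: lorentz_const_def)
  next
    case False
    define Q where "Q = enn2real q"
    have Q: "Q > 0" using enn2real_gt_0[OF q False] by (simp add: Q_def)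
    define W where "W = wmeasure w G"
    have "ennreal (c powr Q / Q) * epowr W (Q / p) = (\<integral>\<^sup>+ s. (ennreal (s powr Q) / ennreal s * indicator {0<..c} s) * epowr W (Q / p) \<partial>lborel)"
      using lorentz_integral_power[OF Q c] by (subst nn_integral_multc) auto
    also have "\<dots> \<le> (\<integral>\<^sup>+ s\<in>{0<..}. ennreal (s powr Q) * epowr (wmeasure w {x. F x > ennreal s}) (Q / p) / ennreal s \<partial>lborel)"
    proof (rule nn_integral_mono)
      fix s :: real
      show "(ennreal (s powr Q) / ennreal s * indicator {0<..c} s) * epowr W (Q / p)
          \<le> ennreal (s powr Q) * epowr (wmeasure w {x. F x > ennreal s}) (Q / p) / ennreal s * indicator {0<..} s"
      proof (cases "0 < s \<and> s \<le> c")
        case True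
        have "ennreal (s powr Q) / ennreal s * epowr W (Q / p) = ennreal (s powr Q) * epowr W (Q / p) / ennreal s"
          by (simp add: ennreal_times_divide mult.commute)
        also have "\<dots> \<le> ennreal (s powr Q) * epowr (wmeasure w {x. F x > ennreal s}) (Q / p) / ennreal s"
          using sub[of s] True p Q unfolding W_def
          by (intro divide_right_mono_ennreal mult_left_mono epowr_mono) auto
        finally show ?thesis using True by (simp add: indicator_def)
      qed (auto simp: indicator_def)
    qed
    finally have le: "ennreal p * (ennreal (c powr Q / Q) * epowr W (Q / p))
       \<le> ennreal p * (\<integral>\<^sup>+ s\<in>{0<..}. ennreal (s powr Q) * epowr (wmeasure w {x. F x > ennreal s}) (Q / p) / ennreal s \<partial>lborel)"
      by (rule mult_left_mono) simp
    have "1 / Q > 0" using Q by simp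
    then have "epowr (ennreal p * (ennreal (c powr Q / Q) * epowr W (Q / p))) (1 / Q) \<le> lorentz_norm p q w F"
      unfolding lorentz_norm_def Q_def[symmetric] if_not_P[OF False] by (rule epowr_mono[OF le])
    also have "ennreal p * (ennreal (c powr Q / Q) * epowr W (Q / p)) = ennreal (c powr Q * (p / Q)) * epowr W (Q / p)"
    proof -
      have "ennreal p * ennreal (c powr Q / Q) = ennreal (c powr Q * (p / Q))"
        using p Q by (simp add: mult.commute flip: ennreal_mult)
      then show ?thesis by (simp only: mult.assoc[symmetric])
    qed
    also have "epowr (ennreal (c powr Q * (p / Q)) * epowr W (Q / p)) (1 / Q) = ennreal (c * lorentz_const p q) * epowr W (1 / p)"
    proof -
      define X where "X = c powr Q * (p / Q)"
      have X: "X > 0" using p Q c by (simp add: X_def)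
      have "X powr (1 / Q) = (c powr Q) powr (1 / Q) * (p / Q) powr (1 / Q)"
        unfolding X_def by (rule powr_mult)
      also have "\<dots> = c * lorentz_const p q"
        using Q c False by (simp add: powr_powr lorentz_const_def flip: Q_def)
      finally show ?thesis
        unfolding X_def[symmetric] using p Q X by (simp add: epowr_mult epowr_epowr epowr_ennreal)
    qed
    finally show ?thesis by (simp add: W_def)
  qed
qed

lemma lorentz_norm_indicator_le:
  assumes p: "p > 0" and q: "q > 0" and F: "\<And>x. F x \<le> indicator E x"
  shows "lorentz_norm p q w F \<le> ennreal (lorentz_const p q) * epowr (wmeasure w E) (1 / p)"
proof -
  have lev: "wmeasure w {x. F x > ennreal s} \<le> (if s \<le> 1 then wmeasure w E else 0)" if "s > 0" for s
  proof (cases "s \<le> 1")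
    case True
    have "x \<in> E" if "ennreal s < F x" for x
      using order.strict_trans2[OF that F[of x]] by (cases "x \<in> E") auto
    then show ?thesis using True by (auto intro!: wmeasure_mono)
  next
    case False
    have "\<not> ennreal s < F x" for x
    proof -
      have "F x \<le> 1" using F[of x] by (cases "x \<in> E") auto
      also have "\<dots> \<le> ennreal s" using False by simp
      finally show ?thesis by simp
    qed
    then show ?thesis using False by (simp add: wmeasure_def)
  qed
  show ?thesis
  proof (cases "q = top")
    case True
    have "ennreal s * epowr (wmeasure w {x. F x > ennreal s}) (1 / p) \<le> epowr (wmeasure w E) (1 / p)" if s: "s > 0" for s
    proof (cases "s \<le> 1")
      case True
      then have "ennreal s * epowr (wmeasure w {x. F x > ennreal s}) (1 / p) \<le> 1 * epowr (wmeasure w E) (1 / p)"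
        using lev[OF s] p by (intro mult_mono epowr_mono) auto
      then show ?thesis by simp
    next
      case False
      then show ?thesis using lev[OF s] p by simp
    qed
    then show ?thesis using True unfolding lorentz_norm_def by (auto simp: lorentz_const_def intro!: SUP_least)
  next
    case False
    define Q where "Q = enn2real q"
    have Q: "Q > 0" using enn2real_gt_0[OF q False] by (simp add: Q_def)
    define W where "W = wmeasure w E"
    have "(\<integral>\<^sup>+ s\<in>{0<..}. ennreal (s powr Q) * epowr (wmeasure w {x. F x > ennreal s}) (Q / p) / ennreal s \<partial>lborel)
        \<le> (\<integral>\<^sup>+ s. (ennreal (s powr Q) / ennreal s * indicator {0<..1} s) * epowr W (Q / p) \<partial>lborel)"
    proof (rule nn_integral_mono)
      fix s :: real
      show "ennreal (s powr Q) * epowr (wmeasure w {x. F x > ennreal s}) (Q / p) / ennreal s * indicator {0<..} s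
          \<le> (ennreal (s powr Q) / ennreal s * indicator {0<..1} s) * epowr W (Q / p)"
      proof (cases "s > 0")
        case True
        show ?thesis
        proof (cases "s \<le> 1")
          case s1: True
          have "ennreal (s powr Q) * epowr (wmeasure w {x. F x > ennreal s}) (Q / p) / ennreal s
            \<le> ennreal (s powr Q) * epowr W (Q / p) / ennreal s"
            using lev[OF True] s1 p Q unfolding W_def
            by (intro divide_right_mono_ennreal mult_left_mono epowr_mono) auto
          also have "\<dots> = ennreal (s powr Q) / ennreal s * epowr W (Q / p)"
            by (simp add: ennreal_times_divide mult.commute)
          finally show ?thesis using True s1 by (simp add: indicator_def)
        next
          case False
          then show ?thesis using lev[OF True] p Q by simp
        qed
      qed auto
    qed
    also have "\<dots> = ennreal (1 / Q) * epowr W (Q / p)"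
      using lorentz_integral_power[OF Q, of 1] by (subst nn_integral_multc) auto
    finally have "epowr (ennreal p * (\<integral>\<^sup>+ s\<in>{0<..}. ennreal (s powr Q) * epowr (wmeasure w {x. F x > ennreal s}) (Q / p) / ennreal s \<partial>lborel)) (1 / Q)
        \<le> epowr (ennreal p * (ennreal (1 / Q) * epowr W (Q / p))) (1 / Q)"
      using Q by (intro epowr_mono mult_left_mono) auto
    also have "ennreal p * (ennreal (1 / Q) * epowr W (Q / p)) = ennreal (p / Q) * epowr W (Q / p)"
      using p Q by (simp flip: mult.assoc ennreal_mult)
    also have "epowr (ennreal (p / Q) * epowr W (Q / p)) (1 / Q) = ennreal (lorentz_const p q) * epowr W (1 / p)"
      using p Q False by (simp add: epowr_mult epowr_epowr epowr_ennreal lorentz_const_def flip: Q_def)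
    finally show ?thesis using False by (simp add: lorentz_norm_def W_def flip: Q_def)
  qed
qed

lemma lorentz_norm_mono:
  assumes p: "p > 0" and q: "q > 0" and F: "\<And>x. F x \<le> G x"
  shows "lorentz_norm p q w F \<le> lorentz_norm p q w G"
proof -
  have lev: "wmeasure w {x. F x > ennreal s} \<le> wmeasure w {x. G x > ennreal s}" for s
    using F by (intro wmeasure_mono) (auto intro: less_le_trans)
  show ?thesis
  proof (cases "q = top")
    case True
    show ?thesis unfolding lorentz_norm_def if_P[OF True]
      using p lev by (intro SUP_subset_mono mult_left_mono epowr_mono) auto
  next
    case False
    then show ?thesis unfolding lorentz_norm_def using p enn2real_gt_0[OF q False] lev
      by (auto intro!: epowr_mono mult_left_mono nn_integral_mono mult_right_mono divide_right_mono_ennreal)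
  qed
qed

text \<open>Homogeneity of the quasinorm. Multiplying by \<open>c\<close> dilates the distribution function, and \<open>ds / s\<close> is invariant under dilations.\<close>

lemma lorentz_norm_scale_ge:
  assumes p: "p > 0" and q: "q > 0" and c: "c > 0"
  shows "ennreal c * lorentz_norm p q w F \<le> lorentz_norm p q w (\<lambda>x. ennreal c * F x)"
proof -
  define \<Phi> where "\<Phi> = (\<lambda>s. ennreal (s powr p) * wmeasure w {x. F x > ennreal s})"
  have [measurable]: "\<Phi> \<in> borel_measurable borel" unfolding \<Phi>_def by (rule distribution_measurable)
  have lev: "{x. ennreal c * F x > ennreal s} = {x. F x > ennreal (s / c)}" for s
  proof -
    have "ennreal s < ennreal c * F x \<longleftrightarrow> ennreal (s / c) < F x" for x
    proof (cases "s \<ge> 0")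
      case True
      have "ennreal c * F x \<le> ennreal s \<longleftrightarrow> F x * ennreal c \<le> ennreal (s / c) * ennreal c"
        using c True by (simp add: mult.commute flip: ennreal_mult)
      also have "\<dots> \<longleftrightarrow> F x \<le> ennreal (s / c)"
        using c by (auto intro: ennreal_mult_right_le_cancel mult_right_mono)
      finally show ?thesis by (simp flip: not_le)
    next
      case False
      then have "ennreal s = 0" "ennreal (s / c) = 0" using c by (auto simp: ennreal_neg divide_nonpos_pos)
      then show ?thesis using c by (simp add: zero_less_iff_neq_zero)
    qed
    then show ?thesis by auto
  qed
  have sc: "ennreal (s powr p) * wmeasure w {x. ennreal c * F x > ennreal s} = ennreal (c powr p) * \<Phi> (1 / c * s)" if "s > 0" for s
  proof -
    have "s powr p = c powr p * (1 / c * s) powr p" using c that by (simp flip: powr_mult)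
    then show ?thesis unfolding lev \<Phi>_def using c that by (simp add: ennreal_mult mult.assoc)
  qed
  show ?thesis
  proof (cases "q = top")
    case True
    have "ennreal c * epowr (\<Phi> s) (1 / p) \<le> lorentz_norm p q w (\<lambda>x. ennreal c * F x)" if s: "s > 0" for s
    proof -
      have "ennreal c * epowr (\<Phi> s) (1 / p) = epowr (ennreal (c powr p) * \<Phi> (1 / c * (c * s))) (1 / p)"
        using c p by (simp add: epowr_mult epowr_ennreal powr_powr)
      also have "\<dots> = epowr (ennreal ((c * s) powr p) * wmeasure w {x. ennreal c * F x > ennreal (c * s)}) (1 / p)"
        using sc[of "c * s"] c s by simp
      also have "\<dots> \<le> lorentz_norm p q w (\<lambda>x. ennreal c * F x)"
        unfolding lorentz_norm_eq_functional[OF p q] lorentz_functional_def using True c s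
        by (auto intro!: SUP_upper2[of "c * s"])
      finally show ?thesis .
    qed
    then show ?thesis
      unfolding lorentz_norm_eq_functional[OF p q, of w F] \<Phi>_def[symmetric]
      using True by (auto simp: lorentz_functional_def SUP_mult_left_ennreal intro!: SUP_least)
  next
    case False
    define Q where "Q = enn2real q"
    have Q: "Q > 0" using enn2real_gt_0[OF q False] by (simp add: Q_def)
    define J where "J = (\<integral>\<^sup>+ s\<in>{0<..}. epowr (\<Phi> s) (Q / p) / ennreal s \<partial>lborel)"
    have "(\<integral>\<^sup>+ s\<in>{0<..}. epowr (ennreal (s powr p) * wmeasure w {x. ennreal c * F x > ennreal s}) (Q / p) / ennreal s \<partial>lborel)
        = (\<integral>\<^sup>+ s. ennreal (c powr Q) * (epowr (\<Phi> (1 / c * s)) (Q / p) / ennreal s * indicator {0<..} s) \<partial>lborel)"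
    proof (rule nn_integral_cong)
      fix s :: real
      show "epowr (ennreal (s powr p) * wmeasure w {x. ennreal c * F x > ennreal s}) (Q / p) / ennreal s * indicator {0<..} s
        = ennreal (c powr Q) * (epowr (\<Phi> (1 / c * s)) (Q / p) / ennreal s * indicator {0<..} s)"
      proof (cases "s > 0")
        case True
        have "epowr (ennreal (c powr p) * \<Phi> (1 / c * s)) (Q / p) = ennreal (c powr Q) * epowr (\<Phi> (1 / c * s)) (Q / p)"
          using c p Q by (simp add: epowr_mult epowr_ennreal powr_powr)
        then show ?thesis unfolding sc[OF True] by (simp add: ennreal_times_divide mult.assoc True)
      qed auto
    qed
    also have "\<dots> = ennreal (c powr Q) * (\<integral>\<^sup>+ s\<in>{0<..}. epowr (\<Phi> (1 / c * s)) (Q / p) / ennreal s \<partial>lborel)"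
      by (intro nn_integral_cmult) measurable
    also have "(\<integral>\<^sup>+ s\<in>{0<..}. epowr (\<Phi> (1 / c * s)) (Q / p) / ennreal s \<partial>lborel) = J"
      unfolding J_def using c by (intro nn_integral_dilation_invariant[of "\<lambda>s. epowr (\<Phi> s) (Q / p)" "1 / c"]) auto
    finally have J: "(\<integral>\<^sup>+ s\<in>{0<..}. epowr (ennreal (s powr p) * wmeasure w {x. ennreal c * F x > ennreal s}) (Q / p) / ennreal s \<partial>lborel)
        = ennreal (c powr Q) * J" .
    have "lorentz_norm p q w (\<lambda>x. ennreal c * F x) = epowr (ennreal p * (ennreal (c powr Q) * J)) (1 / Q)"
      unfolding lorentz_norm_eq_functional[OF p q] lorentz_functional_def using False J by (simp flip: Q_def)
    also have "\<dots> = ennreal c * epowr (ennreal p * J) (1 / Q)"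
      using c p Q by (simp add: epowr_mult epowr_ennreal powr_powr mult_ac)
    also have "epowr (ennreal p * J) (1 / Q) = lorentz_norm p q w F"
      unfolding lorentz_norm_eq_functional[OF p q] lorentz_functional_def \<Phi>_def[symmetric] J_def using False by (simp flip: Q_def)
    finally show ?thesis by simp
  qed
qed

lemma lorentz_norm_AE_zero:
  fixes f :: "real ^ 'n \<Rightarrow> real"
  assumes p: "p > 0" and q: "q > 0" and ae: "AE x in lebesgue. f x = 0"
  shows "lorentz_norm p q w (\<lambda>x. ennreal \<bar>f x\<bar>) = 0"
proof -
  have lev: "wmeasure w {x. ennreal \<bar>f x\<bar> > ennreal s} = 0" for s
  proof -
    have "wmeasure w {x. ennreal \<bar>f x\<bar> > ennreal s} = (\<integral>\<^sup>+ x. 0 \<partial>(lebesgue :: (real ^ 'n) measure))"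
      unfolding wmeasure_def
    proof (rule nn_integral_cong_AE)
      show "AE x in lebesgue. ennreal (w x) * indicator {x. ennreal s < ennreal \<bar>f x\<bar>} x = 0"
        using ae by eventually_elim auto
    qed
    then show ?thesis by simp
  qed
  show ?thesis
  proof (cases "q = top")
    case True
    then show ?thesis unfolding lorentz_norm_def lev using p by simp
  next
    case False
    then show ?thesis unfolding lorentz_norm_def lev using p enn2real_gt_0[OF q False] by simp
  qed
qed

lemma maximal_opnorm_ge:
  fixes f :: "real ^ 'n \<Rightarrow> real"
  assumes p: "p > 0" and q: "q > 0" and f: "f \<in> borel_measurable lebesgue"
    and norm: "lorentz_norm p q w (\<lambda>x. ennreal \<bar>f x\<bar>) \<noteq> 0" "lorentz_norm p q w (\<lambda>x. ennreal \<bar>f x\<bar>) < top"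
    and le: "c * lorentz_norm p q w (\<lambda>x. ennreal \<bar>f x\<bar>) \<le> lorentz_norm p q w (hl_maximal f)"
  shows "c \<le> maximal_opnorm p q w"
proof -
  define b where "b = lorentz_norm p q w (\<lambda>x. ennreal \<bar>f x\<bar>)"
  have "c = c * b / b" using norm by (simp add: b_def ennreal_mult_divide_eq)
  also have "\<dots> \<le> lorentz_norm p q w (hl_maximal f) / b"
    using le by (intro divide_right_mono_ennreal) (simp add: b_def)
  also have "\<dots> \<le> maximal_opnorm p q w"
    unfolding maximal_opnorm_def b_def using f norm lorentz_norm_AE_zero[OF p q, of f w]
    by (intro SUP_upper) auto
  finally show ?thesis .
qed

lemma maximal_opnorm_ge_indicator:
  fixes w :: "real ^ 'n \<Rightarrow> real"
  assumes p: "p > 0" and q: "q > 0" and E: "E \<in> sets lebesgue" and wE: "0 < wmeasure w E" "wmeasure w E < top"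
    and le: "c * (ennreal (lorentz_const p q) * epowr (wmeasure w E) (1 / p)) \<le> lorentz_norm p q w (hl_maximal (indicator E))"
  shows "c \<le> maximal_opnorm p q w"
proof (rule maximal_opnorm_ge[OF p q])
  let ?n = "lorentz_norm p q w (\<lambda>x. ennreal \<bar>indicat_real E x\<bar>)"
  have k: "lorentz_const p q > 0" by (rule lorentz_const_pos[OF p q])
  show "indicat_real E \<in> borel_measurable lebesgue" using E by simp
  have up: "?n \<le> ennreal (lorentz_const p q) * epowr (wmeasure w E) (1 / p)"
    by (rule lorentz_norm_indicator_le[OF p q]) (simp add: indicator_def)
  also have "\<dots> < top" using p wE by (simp add: ennreal_mult_less_top epowr_less_top_iff)
  finally show "?n < top" .
  have "ennreal (1/2 * lorentz_const p q) * epowr (wmeasure w E) (1 / p) \<le> ?n"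
  proof (rule lorentz_norm_ge[OF p q])
    fix x assume "x \<in> E"
    moreover have "ennreal (1/2) < ennreal 1" by (subst ennreal_less_iff) auto
    ultimately show "ennreal (1/2) < ennreal \<bar>indicat_real E x\<bar>" by (simp only: indicator_simps abs_one)
  qed simp
  moreover have "ennreal (1/2 * lorentz_const p q) * epowr (wmeasure w E) (1 / p) \<noteq> 0"
    using k wE p by (simp add: ennreal_eq_0_iff epowr_eq_0_iff)
  ultimately show "?n \<noteq> 0" by auto
  show "c * ?n \<le> lorentz_norm p q w (hl_maximal (indicator E))"
    using le mult_left_mono[OF up, of c] by (auto intro: order_trans)
qed

lemma powr_growth_separates:
  fixes a b c0 C x0 :: real
  assumes "a < b" "c0 > 0"
  obtains x where "x \<ge> x0" "x \<ge> 1" "C * x powr a < c0 * x powr b"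
proof -
  define y where "y = (\<bar>C\<bar> / c0 + 1) powr (1 / (b - a))"
  define x where "x = max x0 (max 1 y)"
  have x: "x \<ge> x0" "x \<ge> 1" "x \<ge> y" by (auto simp: x_def)
  have "C / c0 < \<bar>C\<bar> / c0 + 1" using assms by (simp add: field_simps)
  also have "\<dots> = y powr (b - a)" using assms unfolding y_def by (simp add: powr_powr add_nonneg_pos)
  also have "\<dots> \<le> x powr (b - a)" using x assms by (intro powr_mono2) (auto simp: y_def)
  finally have "C < c0 * x powr (b - a)" using assms by (simp add: field_simps)
  then have "C * x powr a < c0 * x powr (b - a) * x powr a" using x by (intro mult_strict_right_mono) auto
  also have "\<dots> = c0 * x powr b" by (simp add: powr_add[symmetric] mult.assoc)
  finally show ?thesis using that x by blast
qed

lemma epowr_le_powr_bound: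
  assumes "1 \<le> X" "X \<le> ennreal K" "\<alpha> \<le> a" "0 \<le> a"
  shows "epowr X \<alpha> \<le> ennreal (K powr a)"
proof -
  have K: "K \<ge> 1" using order_trans[OF assms(1,2)] by simp
  have "epowr X \<alpha> \<le> epowr X a" using assms by (intro epowr_exponent_mono)
  also have "\<dots> \<le> ennreal (K powr a)"
  proof (cases "a = 0")
    case True then show ?thesis using K by (simp add: epowr_def)
  next
    case False
    then have "epowr X a \<le> epowr (ennreal K) a" using assms by (intro epowr_mono) auto
    then show ?thesis using K by (simp add: epowr_ennreal)
  qed
  finally show ?thesis .
qed

section \<open>Optimality of the exponents\<close>

lemma sets_unit_cube_slab:
  fixes i :: "'n::finite"
  assumes [measurable]: "T \<in> sets borel"
  shows "{x \<in> cube (0 :: real ^ 'n) 1. x $ i \<in> T} \<in> sets lebesgue"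
proof -
  define U where "U = cube (0 :: real ^ 'n) 1"
  have [measurable]: "U \<in> sets lebesgue" by (simp only: U_def sets_lebesgue_cbox)
  have [measurable]: "(\<lambda>x :: real ^ 'n. indicat_real T (x $ i)) \<in> borel_measurable lebesgue" by measurable
  have "{x \<in> space lebesgue. indicat_real T (x $ i) = 1} \<in> sets lebesgue" by measurable
  then have "U \<inter> {x \<in> space lebesgue. indicat_real T (x $ i) = 1} \<in> sets lebesgue" by measurable
  also have "U \<inter> {x \<in> space lebesgue. indicat_real T (x $ i) = 1} = {x \<in> U. x $ i \<in> T}"
    by (auto simp: indicator_def)
  finally show ?thesis by (simp only: U_def)
qed

lemma indicator_slab:
  fixes i :: "'n::finite"
  shows "indicat_real {x \<in> cube (0 :: real ^ 'n) 1. x $ i \<in> T} = (\<lambda>y. indicator T (y $ i) * indicator (cube 0 1) y)"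
  by (rule ext) (simp only: indicator_def mem_Collect_eq, auto)

lemma unit_cube_coordinate: "x \<in> cube (0 :: real ^ 'n) 1 \<Longrightarrow> 0 \<le> x $ i \<and> x $ i \<le> 1"
  unfolding mem_cube by (drule spec[of _ i]) simp

lemma trunc_power_ge_1:
  assumes "0 < e" "e < 1" "0 < t" "t \<le> 1" shows "trunc_power 0 e t \<ge> 1"
proof -
  have "1 powr (e - 1) \<le> t powr (e - 1)" using assms by (intro powr_mono2') auto
  then show ?thesis using assms by (simp add: trunc_power_def)
qed

text \<open>Near \<open>t = 0\<close> the weight has mass \<open>1 / e\<close>, and most of it is far from the slab \<open>1/2 \<le> t \<le> 1\<close>, whose mass is bounded.
  The maximal function of the indicator of this slab is at least \<open>1/2\<close> on the whole unit cube.\<close>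

theorem maximal_opnorm_singular_weight:
  fixes i :: "'n::finite"
  assumes e: "0 < e" "e < 1" and p: "p > 1" and q: "q > 0"
  shows "ennreal (1 / 4 * (1 / e) powr (1 / p)) \<le> maximal_opnorm p q (\<lambda>x :: real ^ 'n. trunc_power 0 e (x $ i))"
proof -
  define g where "g = trunc_power 0 e"
  have g: "A1_line g (4 * (1 / e))" unfolding g_def using A1_line_trunc_power[OF e] by simp
  have [measurable]: "g \<in> borel_measurable borel" using g by (simp add: A1_line_def)
  define v where "v = (\<lambda>x :: real ^ 'n. g (x $ i))"
  define U where "U = cube (0 :: real ^ 'n) 1"
  define T where "T = {1/2..1::real}"
  have [measurable]: "T \<in> sets borel" by (simp add: T_def)
  define E where "E = {x \<in> cube (0 :: real ^ 'n) 1. x $ i \<in> T}"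
  have gT: "1 \<le> g t" "g t \<le> 2" if "t \<in> T" for t
  proof -
    have t: "1/2 \<le> t" "t \<le> 1" using that by (auto simp: T_def)
    show "1 \<le> g t" unfolding g_def using trunc_power_ge_1[OF e] t by simp
    have "g t = t powr (e - 1)" using t by (simp add: g_def trunc_power_def)
    also have "\<dots> \<le> (1/2) powr (e - 1)" using t e by (intro powr_mono2') auto
    also have "\<dots> \<le> (1/2) powr (-1)" using e by (intro powr_mono') auto
    finally show "g t \<le> 2" by (simp add: powr_minus)
  qed
  have wE: "wmeasure v E = (\<integral>\<^sup>+ t\<in>{0..1} \<inter> T. ennreal (g t) \<partial>lborel)"
    unfolding v_def E_def by (rule wmeasure_unit_cube_slab) auto
  have lT: "emeasure lborel T = ennreal (1/2)" by (simp add: T_def)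
  have "wmeasure v E \<le> (\<integral>\<^sup>+ t. 2 * indicator T t \<partial>lborel)"
    unfolding wE using gT ennreal_leI[of _ 2] by (intro nn_integral_mono) (auto simp: indicator_def)
  also have "\<dots> = 2 * ennreal (1/2)" by (subst nn_integral_cmult_indicator) (auto simp: lT simp del: ennreal_half)
  also have "\<dots> = ennreal (2 * (1/2))" by (subst ennreal_mult) auto
  finally have wE_le: "wmeasure v E \<le> 1" by simp
  have "(\<integral>\<^sup>+ t. 1 * indicator T t \<partial>lborel) \<le> wmeasure v E"
    unfolding wE using gT ennreal_leI[of 1] by (intro nn_integral_mono) (auto simp: indicator_def T_def)
  then have "emeasure lborel T \<le> wmeasure v E" by simp
  moreover have "0 < emeasure lborel T" unfolding lT by (subst ennreal_less_zero_iff) simp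
  ultimately have wE_pos: "wmeasure v E > 0" by (rule order.strict_trans2[rotated])
  have "wmeasure v {x \<in> cube 0 1. x $ i \<in> UNIV} = (\<integral>\<^sup>+ t\<in>{0..1} \<inter> UNIV. ennreal (g t) \<partial>lborel)"
    unfolding v_def by (rule wmeasure_unit_cube_slab) auto
  then have wU: "wmeasure v U = ennreal (1 / e)"
    using nn_integral_trunc_power[of e 0 1] e by (simp add: U_def g_def)
  have M: "ennreal (1/4) < hl_maximal (indicator E) x" if "x \<in> U" for x
  proof -
    have "(\<integral>\<^sup>+ t\<in>{0..1}. ennreal (indicat_real T t) \<partial>lborel) = (\<integral>\<^sup>+ t. indicator T t \<partial>lborel)"
      by (intro nn_integral_cong) (auto simp: indicator_def T_def)
    then have "(\<integral>\<^sup>+ t\<in>{0..1}. ennreal (indicat_real T t) \<partial>lborel) / ennreal 1 = ennreal (1/2)"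
      using lT by (simp add: divide_ennreal_def)
    then have "ennreal (1/2) \<le> hl_maximal (indicator E) x"
      using hl_maximal_ge_coordinate_avg[where \<phi> = "indicator T" and \<tau> = 1 and x = x and i = i] that unit_cube_coordinate[of x i]
      unfolding E_def indicator_slab U_def by simp
    moreover have "ennreal (1/4) < ennreal (1/2)" by (subst ennreal_less_iff) auto
    ultimately show ?thesis by (rule order.strict_trans2[rotated])
  qed
  have p0: "p > 0" using p by simp
  have k: "lorentz_const p q > 0" by (rule lorentz_const_pos[OF p0 q])
  show ?thesis
    unfolding g_def[symmetric] v_def[symmetric]
  proof (rule maximal_opnorm_ge_indicator[OF p0 q])
    show "E \<in> sets lebesgue" unfolding E_def by (rule sets_unit_cube_slab) simp
    show "0 < wmeasure v E" by (rule wE_pos)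
    show "wmeasure v E < top" using wE_le by (rule order.strict_trans1) simp
    have "epowr (wmeasure v E) (1/p) \<le> epowr 1 (1/p)" using wE_le p by (intro epowr_mono) auto
    then have "ennreal (1 / 4 * (1 / e) powr (1 / p)) * (ennreal (lorentz_const p q) * epowr (wmeasure v E) (1 / p))
        \<le> ennreal (1 / 4 * (1 / e) powr (1 / p)) * (ennreal (lorentz_const p q) * 1)"
      by (intro mult_left_mono) auto
    also have "\<dots> = ennreal (1/4 * lorentz_const p q) * ennreal ((1 / e) powr (1 / p))"
      using k by (simp add: mult_ac flip: ennreal_mult)
    also have "ennreal ((1 / e) powr (1 / p)) = epowr (wmeasure v U) (1 / p)"
      using wU e by (simp add: epowr_ennreal)
    also have "ennreal (1/4 * lorentz_const p q) * \<dots> \<le> lorentz_norm p q v (hl_maximal (indicator E))"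
      using M by (intro lorentz_norm_ge[OF p0 q]) auto
    finally show "ennreal (1 / 4 * (1 / e) powr (1 / p)) * (ennreal (lorentz_const p q) * epowr (wmeasure v E) (1 / p))
        \<le> lorentz_norm p q v (hl_maximal (indicator E))" .
  qed
qed

lemma trunc_power_dual:
  assumes "0 < e" "e < 1" "0 < t" "d < t"
  shows "trunc_power d e t powr (1 - p) = t powr ((1 - e) * (p - 1))"
  using assms by (simp add: trunc_power_def powr_powr algebra_simps)

text \<open>The test function is the dual weight \<open>\<sigma> = |t| powr (e - 1)\<close> on the unit cube. Its mean over \<open>0 \<le> s \<le> t\<close> is exactly
  \<open>\<sigma> / e\<close>, so its maximal function dominates \<open>\<sigma> / e\<close>, and the claim follows from homogeneity whatever \<open>q\<close> is. It remains to see
  that \<open>\<sigma>\<close> has a finite quasinorm: for \<open>s \<ge> 1\<close> the quantity \<open>s powr p * w(\<sigma> > s)\<close> decays like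
  \<open>s powr (- e / (1 - e))\<close>.\<close>

theorem maximal_opnorm_degenerate_weight:
  fixes i :: "'n::finite"
  assumes e: "0 < e" "e < 1" and p: "p > 1" and q: "q > 0"
  shows "ennreal (1 / e) \<le> maximal_opnorm p q (\<lambda>x :: real ^ 'n. trunc_power 0 e (x $ i) powr (1 - p))"
proof -
  define g where "g = trunc_power 0 e"
  have g: "A1_line g (4 * (1 / e))" unfolding g_def using A1_line_trunc_power[OF e] by simp
  have [measurable]: "g \<in> borel_measurable borel" using g by (simp add: A1_line_def)
  have g0: "g t \<ge> 0" for t using g by (simp add: A1_line_def)
  define h where "h = (\<lambda>t. g t powr (1 - p))"
  have [measurable]: "h \<in> borel_measurable borel" unfolding h_def by measurable
  define v where "v = (\<lambda>x :: real ^ 'n. h (x $ i))"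
  have v_eq: "v = (\<lambda>x :: real ^ 'n. g (x $ i) powr (1 - p))" by (simp add: v_def h_def)
  have vAp: "v \<in> Ap p" unfolding v_eq by (rule A1_line_negative_power_Ap[OF g p])
  then have wv: "weight v" by (simp add: Ap_def)
  define U where "U = cube (0 :: real ^ 'n) 1"
  define f where "f = (\<lambda>y. g (y $ i) * indicator U y)"
  have [measurable]: "U \<in> sets lebesgue" by (simp only: U_def sets_lebesgue_cbox)
  have [measurable]: "f \<in> borel_measurable lebesgue" unfolding f_def by measurable
  have p0: "p > 0" using p by simp
  have k: "lorentz_const p q > 0" by (rule lorentz_const_pos[OF p0 q])
  have g00: "g 0 = 0" by (simp add: g_def trunc_power_def)
  define b where "b = (1 - e) * (p - 1)"
  have b: "b \<ge> 0" using e p by (simp add: b_def)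
  have h_le: "h t \<le> r powr b" if "0 \<le> t" "t \<le> r" for t r
  proof (cases "t = 0")
    case True then show ?thesis by (simp add: h_def g00)
  next
    case False
    then have "h t = t powr b" unfolding h_def g_def b_def using e that by (intro trunc_power_dual) auto
    also have "\<dots> \<le> r powr b" using that b by (intro powr_mono2) auto
    finally show ?thesis .
  qed
  have slab: "wmeasure v {x \<in> U. x $ i \<in> {0..r}} \<le> ennreal (r powr (b + 1))" if r: "r > 0" for r
  proof -
    have "wmeasure v {x \<in> U. x $ i \<in> {0..r}} = (\<integral>\<^sup>+ t\<in>{0..1} \<inter> {0..r}. ennreal (h t) \<partial>lborel)"
      unfolding v_def U_def by (rule wmeasure_unit_cube_slab) auto
    also have "\<dots> \<le> (\<integral>\<^sup>+ t. ennreal (r powr b) * indicator {0..r} t \<partial>lborel)"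
      by (intro nn_integral_mono) (auto simp: indicator_def intro!: ennreal_leI h_le)
    also have "\<dots> = ennreal (r powr b) * ennreal r"
      using r by (subst nn_integral_cmult_indicator) auto
    also have "\<dots> = ennreal (r powr (b + 1))" using r by (simp add: powr_add flip: ennreal_mult)
    finally show ?thesis .
  qed
  define D where "D = (\<lambda>s. wmeasure v {x. ennreal \<bar>f x\<bar> > ennreal s})"
  have D1: "D s \<le> 1" if "s > 0" for s
  proof -
    have "{x. ennreal \<bar>f x\<bar> > ennreal s} \<subseteq> {x \<in> U. x $ i \<in> {0..1}}"
    proof
      fix x assume "x \<in> {x. ennreal \<bar>f x\<bar> > ennreal s}"
      then have "x \<in> U" by (cases "x \<in> U") (auto simp: f_def)
      then show "x \<in> {x \<in> U. x $ i \<in> {0..1}}" using unit_cube_coordinate[of x i] by (auto simp: U_def)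
    qed
    then have "D s \<le> wmeasure v {x \<in> U. x $ i \<in> {0..1}}" unfolding D_def by (rule wmeasure_mono)
    also have "\<dots> \<le> 1" using slab[of 1] by simp
    finally show ?thesis .
  qed
  \<comment> \<open>The set where \<open>\<sigma> > s\<close> is the slab of width \<open>s powr (- 1 / (1 - e))\<close>, and
    \<open>((1 - e) (p - 1) + 1) / (1 - e) = p + \<kappa>\<close>.\<close>
  define \<kappa> where "\<kappa> = e / (1 - e)"
  have \<kappa>: "\<kappa> > 0" using e by (simp add: \<kappa>_def)
  have D2: "D s \<le> ennreal (s powr (- (p + \<kappa>)))" if s: "s \<ge> 1" for s
  proof -
    define r where "r = s powr (- (1 / (1 - e)))"
    have r: "r > 0" using s by (simp add: r_def)
    have "{x. ennreal \<bar>f x\<bar> > ennreal s} \<subseteq> {x \<in> U. x $ i \<in> {0..r}}"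
    proof
      fix x assume x: "x \<in> {x. ennreal \<bar>f x\<bar> > ennreal s}"
      then have xU: "x \<in> U" by (cases "x \<in> U") (auto simp: f_def)
      then have xi: "0 \<le> x $ i" "x $ i \<le> 1" using unit_cube_coordinate[of x i] by (auto simp: U_def)
      have "s < g (x $ i)" using x xU s g0 by (simp add: f_def ennreal_less_iff)
      have "x $ i \<le> r"
      proof (rule ccontr)
        assume "\<not> x $ i \<le> r"
        then have "(x $ i) powr (e - 1) \<le> r powr (e - 1)" using r e by (intro powr_mono2') auto
        also have "\<dots> = s powr (- (1 / (1 - e)) * (e - 1))" by (simp only: r_def powr_powr)
        also have "- (1 / (1 - e)) * (e - 1) = 1" using e by (simp add: field_simps)
        also have "s powr 1 = s" using s by simp
        finally have "g (x $ i) \<le> s" using \<open>\<not> x $ i \<le> r\<close> r by (simp add: g_def trunc_power_def)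
        then show False using \<open>s < g (x $ i)\<close> by simp
      qed
      then show "x \<in> {x \<in> U. x $ i \<in> {0..r}}" using xU xi by simp
    qed
    then have "D s \<le> wmeasure v {x \<in> U. x $ i \<in> {0..r}}" unfolding D_def by (rule wmeasure_mono)
    also have "\<dots> \<le> ennreal (r powr (b + 1))" by (rule slab[OF r])
    also have "r powr (b + 1) = s powr (- (p + \<kappa>))"
    proof -
      have "- (1 / (1 - e)) * (b + 1) = - (p + \<kappa>)" using e by (simp add: b_def \<kappa>_def field_simps)
      then show ?thesis by (simp add: r_def powr_powr)
    qed
    finally show ?thesis .
  qed
  define \<Phi> where "\<Phi> = (\<lambda>s. ennreal (s powr p) * D s)"
  have \<Phi>1: "\<Phi> s \<le> ennreal (s powr p)" if "s > 0" for s
    using mult_left_mono[OF D1[OF that], of "ennreal (s powr p)"] by (simp add: \<Phi>_def)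
  have \<Phi>2: "\<Phi> s \<le> ennreal (s powr (- \<kappa>))" if s: "s \<ge> 1" for s
  proof -
    have "\<Phi> s \<le> ennreal (s powr p) * ennreal (s powr (- (p + \<kappa>)))"
      unfolding \<Phi>_def by (intro mult_left_mono D2 s) auto
    also have "\<dots> = ennreal (s powr (- \<kappa>))" using s by (simp add: powr_add[symmetric] flip: ennreal_mult)
    finally show ?thesis .
  qed
  have norm_eq: "lorentz_norm p q v (\<lambda>x. ennreal \<bar>f x\<bar>) = lorentz_functional p q \<Phi>"
    unfolding lorentz_norm_eq_functional[OF p0 q] \<Phi>_def D_def ..
  show ?thesis
    unfolding g_def[symmetric] v_eq[symmetric]
  proof (rule maximal_opnorm_ge[OF p0 q])
    show "f \<in> borel_measurable lebesgue" by measurable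
    show "lorentz_norm p q v (\<lambda>x. ennreal \<bar>f x\<bar>) < top"
    proof (cases "q = top")
      case True
      have "epowr (\<Phi> s) (1 / p) \<le> 1" if s: "s > 0" for s
      proof -
        have "\<Phi> s \<le> 1"
        proof (cases "s \<le> 1")
          case True
          then have "s powr p \<le> 1 powr p" using s p by (intro powr_mono2) auto
          then show ?thesis using \<Phi>1[OF s] by (auto intro: order_trans)
        next
          case False
          then have "s powr (- \<kappa>) \<le> s powr 0" using \<kappa> by (intro powr_mono) auto
          then show ?thesis using \<Phi>2[of s] False by (auto intro: order_trans)
        qed
        then have "epowr (\<Phi> s) (1/p) \<le> epowr 1 (1/p)" using p by (intro epowr_mono) auto
        then show ?thesis by simp
      qed
      then have "lorentz_functional p q \<Phi> \<le> 1"
        unfolding lorentz_functional_def if_P[OF True] by (intro SUP_least) auto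
      then show ?thesis unfolding norm_eq by (rule order.strict_trans1) simp
    next
      case False
      define Q where "Q = enn2real q"
      have Q: "Q > 0" using enn2real_gt_0[OF q False] by (simp add: Q_def)
      define \<theta> where "\<theta> = \<kappa> * Q / p"
      have \<theta>: "\<theta> > 0" using \<kappa> Q p by (simp add: \<theta>_def)
      have tail: "(\<integral>\<^sup>+ s\<in>{1..}. ennreal (s powr (- \<theta> - 1)) \<partial>lborel) < top"
      proof -
        have "((\<lambda>x. x powr (- \<theta> - 1)) has_integral - (1 powr (- \<theta> - 1 + 1)) / (- \<theta> - 1 + 1)) {1..}"
          using \<theta> by (intro has_integral_powr_to_inf) auto
        then have "(\<integral>\<^sup>+ s. ennreal (indicator {1..} s * s powr (- \<theta> - 1)) \<partial>lborel) = ennreal (- (1 powr (- \<theta> - 1 + 1)) / (- \<theta> - 1 + 1))"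
          by (intro nn_integral_has_integral_lebesgue) auto
        also have "\<dots> < top" by simp
        finally show ?thesis by (simp add: ennreal_mult' ennreal_indicator mult.commute)
      qed
      have "(\<integral>\<^sup>+ s\<in>{0<..}. epowr (\<Phi> s) (Q / p) / ennreal s \<partial>lborel)
          \<le> (\<integral>\<^sup>+ s. ennreal (s powr Q) / ennreal s * indicator {0<..1} s + ennreal (s powr (- \<theta> - 1)) * indicator {1..} s \<partial>lborel)"
      proof (rule nn_integral_mono)
        fix s :: real
        show "epowr (\<Phi> s) (Q / p) / ennreal s * indicator {0<..} s
          \<le> ennreal (s powr Q) / ennreal s * indicator {0<..1} s + ennreal (s powr (- \<theta> - 1)) * indicator {1..} s"
        proof (cases "s > 0")
          case s: True
          show ?thesis
          proof (cases "s \<le> 1")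
            case True
            have "epowr (\<Phi> s) (Q / p) \<le> epowr (ennreal (s powr p)) (Q / p)" using Q p \<Phi>1[OF s] by (intro epowr_mono) auto
            also have "\<dots> = ennreal (s powr Q)" using s p by (simp add: epowr_ennreal powr_powr)
            finally have "epowr (\<Phi> s) (Q / p) / ennreal s \<le> ennreal (s powr Q) / ennreal s" by (rule divide_right_mono_ennreal)
            then show ?thesis using s True by (simp add: indicator_def add_increasing2)
          next
            case False
            have "epowr (\<Phi> s) (Q / p) \<le> epowr (ennreal (s powr (- \<kappa>))) (Q / p)" using Q p \<Phi>2[of s] False by (intro epowr_mono) auto
            also have "\<dots> = ennreal (s powr (- \<theta>))" using s p by (simp add: epowr_ennreal powr_powr \<theta>_def)
            finally have "epowr (\<Phi> s) (Q / p) / ennreal s \<le> ennreal (s powr (- \<theta>)) / ennreal s" by (rule divide_right_mono_ennreal)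
            also have "\<dots> = ennreal (s powr (- \<theta> - 1))" using s by (simp add: divide_ennreal powr_diff)
            finally show ?thesis using s False by (simp add: indicator_def)
          qed
        qed auto
      qed
      also have "\<dots> = ennreal (1 / Q) + (\<integral>\<^sup>+ s\<in>{1..}. ennreal (s powr (- \<theta> - 1)) \<partial>lborel)"
        using lorentz_integral_power[OF Q, of 1] by (subst nn_integral_add) auto
      also have "\<dots> < top" using tail by simp
      finally show ?thesis
        unfolding norm_eq lorentz_functional_def if_not_P[OF False] Q_def[symmetric]
        using Q by (simp add: epowr_less_top_iff ennreal_mult_less_top)
    qed
    show "lorentz_norm p q v (\<lambda>x. ennreal \<bar>f x\<bar>) \<noteq> 0"
    proof -
      define R where "R = cube (vec (1/2) :: real ^ 'n) (1/2)"
      have "ennreal (1/2 * lorentz_const p q) * epowr (wmeasure v R) (1 / p) \<le> lorentz_norm p q v (\<lambda>x. ennreal \<bar>f x\<bar>)"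
      proof (rule lorentz_norm_ge[OF p0 q])
        fix x assume x: "x \<in> R"
        have xj: "1/2 \<le> x $ j \<and> x $ j \<le> 1" for j using x[unfolded R_def mem_cube, rule_format, of j] by auto
        have "x \<in> U" unfolding U_def mem_cube using xj by (auto intro: order_trans[of 0 "1/2"])
        moreover have "1 \<le> g (x $ i)" unfolding g_def using xj[of i] by (intro trunc_power_ge_1 e) auto
        ultimately have "1 \<le> \<bar>f x\<bar>" by (simp add: f_def)
        then show "ennreal (1/2) < ennreal \<bar>f x\<bar>" by (subst ennreal_less_iff) auto
      qed simp
      moreover have "wmeasure v R > 0" unfolding R_def using weightD[OF wv] by (intro wmeasure_cube_pos) auto
      then have "ennreal (1/2 * lorentz_const p q) * epowr (wmeasure v R) (1 / p) \<noteq> 0"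
        using k p by (simp add: ennreal_eq_0_iff epowr_eq_0_iff)
      ultimately show ?thesis by auto
    qed
    have "ennreal (1 / e) * lorentz_norm p q v (\<lambda>x. ennreal \<bar>f x\<bar>) \<le> lorentz_norm p q v (\<lambda>x. ennreal (1 / e) * ennreal \<bar>f x\<bar>)"
      using e by (intro lorentz_norm_scale_ge[OF p0 q]) auto
    also have "\<dots> \<le> lorentz_norm p q v (hl_maximal f)"
    proof (rule lorentz_norm_mono[OF p0 q])
      fix x
      show "ennreal (1 / e) * ennreal \<bar>f x\<bar> \<le> hl_maximal f x"
      proof (cases "x \<in> U \<and> x $ i \<noteq> 0")
        case False
        then have "f x = 0" by (auto simp: f_def g00)
        then show ?thesis by simp
      next
        case True
        define \<tau> where "\<tau> = x $ i"
        have \<tau>: "0 < \<tau>" "\<tau> \<le> 1" using True unit_cube_coordinate[of x i] by (auto simp: \<tau>_def U_def)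
        have "(\<integral>\<^sup>+ t\<in>{0..\<tau>}. ennreal (g t) \<partial>lborel) / ennreal \<tau> = ennreal (1 / e * \<bar>f x\<bar>)"
          using nn_integral_trunc_power[of e 0 \<tau>] \<tau> e True g0
          by (simp add: divide_ennreal f_def g_def trunc_power_def powr_diff \<tau>_def[symmetric])
        moreover have "(\<integral>\<^sup>+ t\<in>{0..\<tau>}. ennreal (g t) \<partial>lborel) / ennreal \<tau> \<le> hl_maximal f x"
          unfolding f_def U_def using True \<tau> g0 by (intro hl_maximal_ge_coordinate_avg) (auto simp: \<tau>_def U_def)
        moreover have "ennreal (1 / e) * ennreal \<bar>f x\<bar> = ennreal (1 / e * \<bar>f x\<bar>)"
          using e by (intro ennreal_mult[symmetric]) auto
        ultimately show ?thesis by metis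
      qed
    qed
    finally show "ennreal (1 / e) * lorentz_norm p q v (\<lambda>x. ennreal \<bar>f x\<bar>) \<le> lorentz_norm p q v (hl_maximal f)" .
  qed
qed

text \<open>The test function is the indicator of \<open>0 \<le> t \<le> d\<close> in the unit cube, where \<open>w\<close> is smaller by the factor
  \<open>e powr (p - 1)\<close> than the values of \<open>t powr ((1 - e) (p - 1))\<close> near \<open>t = d\<close>. Its maximal function is at least \<open>d / t\<close> for
  \<open>t \<ge> d\<close>, so \<open>s powr p * w(M f > s)\<close> is at least \<open>(d / 2) powr p\<close> for all \<open>s\<close> between \<open>d\<close> and \<open>1/2\<close>. With respect to \<open>ds / s\<close>
  this range has length comparable to \<open>1 / e\<close>, which gives the factor \<open>(1 / e) powr (1 / q)\<close>. The number \<open>d\<close> is chosen such that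
  \<open>d powr ((p - 1) e) = 1/4\<close>, so that \<open>s powr ((p - 1) e)\<close> varies only by a bounded factor over the range.\<close>

theorem maximal_opnorm_plateau_weight:
  fixes i :: "'n::finite"
  assumes e: "0 < e" "e < 1" and p: "p > 1" and pe: "(p - 1) * e \<le> 1" and q: "q > 0" "q \<noteq> top"
    and d: "d = (1 / 4) powr (1 / ((p - 1) * e))"
  defines "Q \<equiv> enn2real q"
  shows "ennreal ((Q * ln 2 / (p - 1)) powr (1 / Q) * (1 / 2 * (1 / 4) powr (1 / p)) * (1 / e) powr (1 / Q + (p - 1) / p))
     \<le> maximal_opnorm p q (\<lambda>x :: real ^ 'n. trunc_power d e (x $ i) powr (1 - p))"
proof -
  define u where "u = (p - 1) * e"
  have u: "0 < u" "u \<le> 1" using p e pe by (auto simp: u_def)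
  have d0: "0 < d" by (simp add: d)
  have d4: "d \<le> 1 / 4"
  proof -
    have "d \<le> (1 / 4) powr 1" unfolding d u_def[symmetric] using u by (intro powr_mono') auto
    then show ?thesis by simp
  qed
  have du: "d powr u = 1 / 4" unfolding d u_def[symmetric] using u by (simp add: powr_powr)
  have Q: "Q > 0" using enn2real_gt_0[OF q] by (simp add: Q_def)
  define g where "g = trunc_power d e"
  have g: "A1_line g (4 * (1 / e))" unfolding g_def using A1_line_trunc_power[OF e, of d] d0 by simp
  have [measurable]: "g \<in> borel_measurable borel" using g by (simp add: A1_line_def)
  define h where "h = (\<lambda>t. g t powr (1 - p))"
  have [measurable]: "h \<in> borel_measurable borel" unfolding h_def by measurable
  define v where "v = (\<lambda>x :: real ^ 'n. h (x $ i))"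
  have v_eq: "v = (\<lambda>x :: real ^ 'n. g (x $ i) powr (1 - p))" by (simp add: v_def h_def)
  define U where "U = cube (0 :: real ^ 'n) 1"
  define E where "E = {x \<in> cube (0 :: real ^ 'n) 1. x $ i \<in> {0..d}}"
  have p0: "p > 0" using p by simp
  define k where "k = lorentz_const p q"
  have k: "k > 0" unfolding k_def by (rule lorentz_const_pos[OF p0 q(1)])
  have k_eq: "k = (p / Q) powr (1 / Q)" using q(2) by (simp add: k_def lorentz_const_def Q_def)
  define b where "b = (1 - e) * (p - 1)"
  have b: "b \<ge> 0" using e p by (simp add: b_def)
  have bu: "b + 1 = p - u" by (simp add: b_def u_def algebra_simps)
  have wE: "wmeasure v E = ennreal (e powr (p - 1) * d powr (p - u))"
  proof -
    have "h t = e powr (p - 1) * d powr b" if "0 \<le> t" "t \<le> d" for t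
    proof -
      have "h t = (d powr (e - 1) / e) powr (1 - p)" using that by (simp add: h_def g_def trunc_power_def)
      also have "\<dots> = (d powr (e - 1)) powr (1 - p) / e powr (1 - p)" by (rule powr_divide)
      also have "\<dots> = d powr b / e powr (1 - p)" by (simp add: powr_powr b_def algebra_simps)
      also have "\<dots> = e powr (p - 1) * d powr b" using powr_minus_divide[of e "1 - p"] by simp
      finally show ?thesis .
    qed
    note hd = this
    have "wmeasure v E = (\<integral>\<^sup>+ t\<in>{0..1} \<inter> {0..d}. ennreal (h t) \<partial>lborel)"
      unfolding v_def E_def by (rule wmeasure_unit_cube_slab) auto
    also have "\<dots> = (\<integral>\<^sup>+ t. ennreal (e powr (p - 1) * d powr b) * indicator {0..d} t \<partial>lborel)"
      using d4 by (intro nn_integral_cong) (auto simp: indicator_def hd)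
    also have "\<dots> = ennreal (e powr (p - 1) * d powr b) * ennreal d"
      using d0 by (subst nn_integral_cmult_indicator) auto
    also have "\<dots> = ennreal (e powr (p - 1) * (d powr b * d powr 1))"
      using d0 e by (simp add: mult_ac flip: ennreal_mult)
    also have "d powr b * d powr 1 = d powr (p - u)" by (simp only: powr_add[symmetric] bu)
    finally show ?thesis .
  qed
  have level: "ennreal ((d / (2 * s)) powr (p - u)) \<le> wmeasure v {x. ennreal s < hl_maximal (indicator E) x}"
    if s: "d \<le> s" "s \<le> 1 / 2" for s
  proof -
    \<comment> \<open>On the slab \<open>r < t < 2 r\<close> with \<open>2 r = d / s\<close> the maximal function exceeds \<open>s\<close>. It lies beyond the plateau because
      \<open>s \<le> 1/2\<close>, and inside the unit cube because \<open>s \<ge> d\<close>.\<close>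
    define r where "r = d / (2 * s)"
    have s0: "s > 0" using s d0 by simp
    have r: "0 < r" "d \<le> r" "2 * r \<le> 1" "2 * r = d / s"
    proof -
      show "0 < r" using d0 s0 by (simp add: r_def)
      show "2 * r = d / s" by (simp add: r_def)
      then show "2 * r \<le> 1" using s s0 by simp
      have "d * (2 * s) \<le> d * 1" using s d0 by (intro mult_left_mono) auto
      then show "d \<le> r" using s0 by (simp add: r_def pos_le_divide_eq)
    qed
    define G where "G = {x \<in> U. x $ i \<in> {r<..<2 * r}}"
    have "wmeasure v G = (\<integral>\<^sup>+ t\<in>{0..1} \<inter> {r<..<2 * r}. ennreal (h t) \<partial>lborel)"
      unfolding v_def G_def U_def by (rule wmeasure_unit_cube_slab) auto
    moreover have "(\<integral>\<^sup>+ t. ennreal (r powr b) * indicator {r<..<2 * r} t \<partial>lborel) \<le> (\<integral>\<^sup>+ t\<in>{0..1} \<inter> {r<..<2 * r}. ennreal (h t) \<partial>lborel)"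
    proof (rule nn_integral_mono)
      fix t :: real
      show "ennreal (r powr b) * indicator {r<..<2 * r} t \<le> ennreal (h t) * indicator ({0..1} \<inter> {r<..<2 * r}) t"
      proof (cases "r < t \<and> t < 2 * r")
        case True
        then have t: "0 < t" "d < t" "t \<le> 1" using r by auto
        have "r powr b \<le> t powr b" using True r b by (intro powr_mono2) auto
        also have "\<dots> = h t" unfolding h_def g_def b_def using t by (intro trunc_power_dual[symmetric] e) auto
        finally show ?thesis using t by (auto simp: indicator_def intro: ennreal_leI)
      qed (auto simp: indicator_def)
    qed
    moreover have "(\<integral>\<^sup>+ t. ennreal (r powr b) * indicator {r<..<2 * r} t \<partial>lborel) = ennreal (r powr (b + 1))"
      using r by (subst nn_integral_cmult_indicator) (auto simp: powr_add simp flip: ennreal_mult)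
    ultimately have "ennreal (r powr (b + 1)) \<le> wmeasure v G" by simp
    also have "\<dots> \<le> wmeasure v {x. ennreal s < hl_maximal (indicator E) x}"
    proof (rule wmeasure_mono, rule subsetI, rule CollectI)
      fix x assume x: "x \<in> G"
      define \<tau> where "\<tau> = x $ i"
      have \<tau>: "r < \<tau>" "\<tau> < 2 * r" "0 < \<tau>" "\<tau> \<le> 1" "d \<le> \<tau>" using x r by (auto simp: G_def \<tau>_def)
      have "\<tau> < d / s" using \<tau>(2) r(4) by simp
      then have "\<tau> * s < d" using s0 by (simp add: pos_less_divide_eq)
      then have "s < d / \<tau>" by (subst pos_less_divide_eq[OF \<tau>(3)]) (simp add: mult.commute)
      then have "ennreal s < ennreal (d / \<tau>)" using s0 by (simp add: ennreal_less_iff)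
      also have "ennreal (d / \<tau>) = (\<integral>\<^sup>+ t\<in>{0..\<tau>}. ennreal (indicat_real {0..d} t) \<partial>lborel) / ennreal \<tau>"
      proof -
        have "(\<integral>\<^sup>+ t\<in>{0..\<tau>}. ennreal (indicat_real {0..d} t) \<partial>lborel) = (\<integral>\<^sup>+ t. indicator {0..d} t \<partial>lborel)"
          using \<tau> by (intro nn_integral_cong) (auto simp: indicator_def)
        then show ?thesis using \<tau> d0 by (simp add: divide_ennreal)
      qed
      also have "\<dots> \<le> hl_maximal (indicator E) x"
        unfolding E_def indicator_slab using x \<tau>
        by (intro hl_maximal_ge_coordinate_avg) (auto simp: G_def U_def \<tau>_def)
      finally show "ennreal s < hl_maximal (indicator E) x" .
    qed
    finally show ?thesis by (simp add: bu r_def)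
  qed
  define \<Phi> where "\<Phi> = (\<lambda>s. ennreal (s powr p) * wmeasure v {x. hl_maximal (indicator E) x > ennreal s})"
  have \<Phi>: "ennreal ((d / 2) powr p) \<le> \<Phi> s" if s: "d \<le> s" "s \<le> 1 / 2" for s
  proof -
    have s0: "s > 0" using s d0 by simp
    have "(d / 2) powr p = (d / 2) powr u * (d / 2) powr (p - u)" by (simp add: powr_add[symmetric])
    also have "\<dots> \<le> s powr u * (d / 2) powr (p - u)"
      using s d0 u by (intro mult_right_mono powr_mono2) auto
    also have "\<dots> = s powr p * (d / (2 * s)) powr (p - u)"
    proof -
      have "(d / 2) powr (p - u) = s powr (p - u) * (d / (2 * s)) powr (p - u)"
        using s0 by (simp flip: powr_mult)
      then show ?thesis by (simp add: powr_add[symmetric] mult.assoc[symmetric])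
    qed
    finally have "ennreal ((d / 2) powr p) \<le> ennreal (s powr p) * ennreal ((d / (2 * s)) powr (p - u))"
      by (simp add: ennreal_leI flip: ennreal_mult)
    also have "\<dots> \<le> \<Phi> s" unfolding \<Phi>_def by (intro mult_left_mono level s) auto
    finally show ?thesis .
  qed
  define \<Lambda> where "\<Lambda> = ln (1 / 2) - ln d"
  have \<Lambda>: "\<Lambda> \<ge> ln 2 / u"
  proof -
    have "ln (4 :: real) = ln (2 ^ 2)" by simp
    also have "\<dots> = 2 * ln 2" by (subst ln_realpow) auto
    finally have ln4: "ln (4 :: real) = 2 * ln 2" .
    have "ln d = 1 / u * ln (1 / 4)" unfolding d u_def[symmetric] by (simp add: ln_powr)
    then have "\<Lambda> = 2 * ln 2 / u - ln 2" by (simp add: \<Lambda>_def ln_div ln4)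
    moreover have "ln 2 * 1 \<le> ln 2 * (1 / u)" using u by (intro mult_left_mono) auto
    ultimately show ?thesis by simp
  qed
  have int: "(\<integral>\<^sup>+ s\<in>{d..1/2}. ennreal (1 / s) \<partial>lborel) = ennreal \<Lambda>"
  proof -
    have "((\<lambda>s. 1 / s) has_integral ln (1/2) - ln d) {d..1/2}"
      using d0 d4 by (intro fundamental_theorem_of_calculus)
        (auto intro!: derivative_eq_intros simp flip: has_real_derivative_iff_has_vector_derivative)
    then have "(\<integral>\<^sup>+ s. ennreal (indicator {d..1/2} s * (1 / s)) \<partial>lborel) = ennreal (ln (1/2) - ln d)"
      using d0 by (intro nn_integral_has_integral_lebesgue) auto
    moreover have "(\<integral>\<^sup>+ s\<in>{d..1/2}. ennreal (1 / s) \<partial>lborel) = (\<integral>\<^sup>+ s. ennreal (indicator {d..1/2} s * (1 / s)) \<partial>lborel)"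
      by (intro nn_integral_cong) (auto simp: indicator_def)
    ultimately show ?thesis by (simp only: \<Lambda>_def)
  qed
  have lower: "ennreal ((p * ((d / 2) powr Q * (ln 2 / u))) powr (1 / Q)) \<le> lorentz_norm p q v (hl_maximal (indicator E))"
  proof -
    have "ennreal ((d / 2) powr Q * (ln 2 / u)) \<le> ennreal ((d / 2) powr Q * \<Lambda>)"
      by (intro ennreal_leI mult_left_mono \<Lambda>) auto
    also have "\<dots> = ennreal ((d / 2) powr Q) * (\<integral>\<^sup>+ s\<in>{d..1/2}. ennreal (1 / s) \<partial>lborel)"
      unfolding int by (simp add: ennreal_mult')
    also have "\<dots> = (\<integral>\<^sup>+ s. ennreal ((d / 2) powr Q) * (ennreal (1 / s) * indicator {d..1/2} s) \<partial>lborel)"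
      by (intro nn_integral_cmult[symmetric]) measurable
    also have "\<dots> \<le> (\<integral>\<^sup>+ s\<in>{0<..}. epowr (\<Phi> s) (Q / p) / ennreal s \<partial>lborel)"
    proof (rule nn_integral_mono)
      fix s :: real
      show "ennreal ((d / 2) powr Q) * (ennreal (1 / s) * indicator {d..1/2} s) \<le> epowr (\<Phi> s) (Q / p) / ennreal s * indicator {0<..} s"
      proof (cases "d \<le> s \<and> s \<le> 1/2")
        case True
        then have s0: "s > 0" using d0 by simp
        have "ennreal ((d / 2) powr Q) = epowr (ennreal ((d / 2) powr p)) (Q / p)"
          using d0 p by (simp add: epowr_ennreal powr_powr)
        also have "\<dots> \<le> epowr (\<Phi> s) (Q / p)" using True Q p by (intro epowr_mono \<Phi>) auto
        finally have "ennreal ((d / 2) powr Q) / ennreal s \<le> epowr (\<Phi> s) (Q / p) / ennreal s"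
          by (rule divide_right_mono_ennreal)
        moreover have "ennreal ((d / 2) powr Q) * ennreal (1 / s) = ennreal ((d / 2) powr Q) / ennreal s"
          using s0 by (simp add: divide_ennreal flip: ennreal_mult)
        ultimately show ?thesis using True s0 by (simp add: indicator_def)
      qed (auto simp: indicator_def)
    qed
    finally have "ennreal p * ennreal ((d / 2) powr Q * (ln 2 / u)) \<le> ennreal p * (\<integral>\<^sup>+ s\<in>{0<..}. epowr (\<Phi> s) (Q / p) / ennreal s \<partial>lborel)"
      by (rule mult_left_mono) simp
    moreover have "ennreal p * ennreal ((d / 2) powr Q * (ln 2 / u)) = ennreal (p * ((d / 2) powr Q * (ln 2 / u)))"
      using p u by (intro ennreal_mult[symmetric]) auto
    ultimately have le: "ennreal (p * ((d / 2) powr Q * (ln 2 / u))) \<le> ennreal p * (\<integral>\<^sup>+ s\<in>{0<..}. epowr (\<Phi> s) (Q / p) / ennreal s \<partial>lborel)"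
      by simp
    have "0 < p * ((d / 2) powr Q * (ln 2 / u))" using p u d0 by simp
    then have "ennreal ((p * ((d / 2) powr Q * (ln 2 / u))) powr (1 / Q)) = epowr (ennreal (p * ((d / 2) powr Q * (ln 2 / u)))) (1 / Q)"
      by (rule epowr_ennreal[symmetric])
    also have "\<dots> \<le> epowr (ennreal p * (\<integral>\<^sup>+ s\<in>{0<..}. epowr (\<Phi> s) (Q / p) / ennreal s \<partial>lborel)) (1 / Q)"
      using Q by (intro epowr_mono le) auto
    also have "\<dots> = lorentz_norm p q v (hl_maximal (indicator E))"
      unfolding lorentz_norm_eq_functional[OF p0 q(1)] lorentz_functional_def if_not_P[OF q(2)] \<Phi>_def Q_def ..
    finally show ?thesis .
  qed
  define c where "c = (Q * ln 2 / (p - 1)) powr (1 / Q) * (1 / 2 * (1 / 4) powr (1 / p)) * (1 / e) powr (1 / Q + (p - 1) / p)"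
  have c: "c \<ge> 0" by (simp add: c_def)
  have real_eq: "c * (k * (e powr (p - 1) * d powr (p - u)) powr (1 / p)) = (p * ((d / 2) powr Q * (ln 2 / u))) powr (1 / Q)"
  proof -
    have 1: "(1 / 4) powr (1 / p) * (d powr (p - u)) powr (1 / p) = d"
    proof -
      have "(1 / 4) powr (1 / p) * (d powr (p - u)) powr (1 / p) = (d powr u) powr (1 / p) * (d powr (p - u)) powr (1 / p)"
        by (simp add: du)
      also have "\<dots> = (d powr u * d powr (p - u)) powr (1 / p)" by (rule powr_mult[symmetric])
      also have "d powr u * d powr (p - u) = d powr p" by (simp add: powr_add[symmetric])
      also have "(d powr p) powr (1 / p) = d" using d0 p by (simp add: powr_powr)
      finally show ?thesis .
    qed
    have 2: "(1 / e) powr ((p - 1) / p) * (e powr (p - 1)) powr (1 / p) = 1"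
      using e by (simp add: powr_powr powr_divide)
    have 3: "(Q * ln 2 / (p - 1)) powr (1 / Q) * (1 / e) powr (1 / Q) * (p / Q) powr (1 / Q) = (p * (ln 2 / u)) powr (1 / Q)"
    proof -
      have "(Q * ln 2 / (p - 1)) powr (1 / Q) * (1 / e) powr (1 / Q) * (p / Q) powr (1 / Q)
         = (Q * ln 2 / (p - 1) * (1 / e) * (p / Q)) powr (1 / Q)" by (simp only: powr_mult)
      also have "Q * ln 2 / (p - 1) * (1 / e) * (p / Q) = p * (ln 2 / u)" using Q by (simp add: u_def)
      finally show ?thesis .
    qed
    have "c * (k * (e powr (p - 1) * d powr (p - u)) powr (1 / p))
      = ((Q * ln 2 / (p - 1)) powr (1 / Q) * (1 / e) powr (1 / Q) * (p / Q) powr (1 / Q))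
        * (1 / 2 * ((1 / 4) powr (1 / p) * (d powr (p - u)) powr (1 / p)))
        * ((1 / e) powr ((p - 1) / p) * (e powr (p - 1)) powr (1 / p))"
      unfolding c_def k_eq powr_add powr_mult[of "e powr (p - 1)" "d powr (p - u)"] by (simp only: mult_ac)
    also have "\<dots> = (p * (ln 2 / u)) powr (1 / Q) * (d / 2)" unfolding 1 2 3 by simp
    also have "d / 2 = ((d / 2) powr Q) powr (1 / Q)" using d0 Q by (simp add: powr_powr)
    also have "(p * (ln 2 / u)) powr (1 / Q) * ((d / 2) powr Q) powr (1 / Q) = (p * (ln 2 / u) * (d / 2) powr Q) powr (1 / Q)"
      by (rule powr_mult[symmetric])
    also have "p * (ln 2 / u) * (d / 2) powr Q = p * ((d / 2) powr Q * (ln 2 / u))" by (simp only: mult_ac)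
    finally show ?thesis .
  qed
  have wE_pos: "e powr (p - 1) * d powr (p - u) > 0" using e d0 by simp
  show ?thesis
    unfolding g_def[symmetric] v_eq[symmetric] c_def[symmetric]
  proof (rule maximal_opnorm_ge_indicator[OF p0 q(1)])
    show "E \<in> sets lebesgue" unfolding E_def by (rule sets_unit_cube_slab) simp
    show "0 < wmeasure v E" unfolding wE using wE_pos by simp
    show "wmeasure v E < top" unfolding wE by simp
    have "ennreal c * (ennreal (lorentz_const p q) * epowr (wmeasure v E) (1 / p))
        = ennreal (c * (k * (e powr (p - 1) * d powr (p - u)) powr (1 / p)))"
      unfolding wE epowr_ennreal[OF wE_pos] k_def[symmetric] using c k by (simp add: ennreal_mult)
    also have "\<dots> \<le> lorentz_norm p q v (hl_maximal (indicator E))"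
      unfolding real_eq by (rule lower)
    finally show "ennreal c * (ennreal (lorentz_const p q) * epowr (wmeasure v E) (1 / p))
        \<le> lorentz_norm p q v (hl_maximal (indicator E))" .
  qed
qed

lemma Ainf_const_positive_power_le:
  fixes i :: "'n::finite"
  assumes w: "weight (\<lambda>x :: real ^ 'n. \<bar>x $ i\<bar> powr c)" and c: "c \<ge> 0"
  shows "Ainf_const (\<lambda>x :: real ^ 'n. \<bar>x $ i\<bar> powr c) \<le> ennreal (4 * 2 powr c)"
proof (rule Ainf_const_le_of_sup_le_avg[OF w])
  fix a x :: "real ^ 'n" and l :: real assume l: "l > 0" and x: "x \<in> cube a l"
  have xi: "a $ i \<le> x $ i" "x $ i \<le> a $ i + l" using x[unfolded mem_cube, rule_format, of i] by auto
  have "ennreal (\<bar>x $ i\<bar> powr c) * ennreal l = ennreal (\<bar>x $ i\<bar> powr c * l)"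
    using l by (intro ennreal_mult[symmetric]) auto
  also have "\<dots> \<le> ennreal (4 * 2 powr c) * (\<integral>\<^sup>+ s\<in>{a $ i..a $ i + l}. ennreal (\<bar>s\<bar> powr c) \<partial>lborel)"
    by (rule abs_powr_le_average[OF l xi c])
  also have "(\<integral>\<^sup>+ s\<in>{a $ i..a $ i + l}. ennreal (\<bar>s\<bar> powr c) \<partial>lborel)
      = avg (cube a l) (\<lambda>y. ennreal (\<bar>y $ i\<bar> powr c)) * ennreal l"
    using avg_cube_coordinate[where h = "\<lambda>s. ennreal (\<bar>s\<bar> powr c)" and a = a and l = l and i = i] l
    by (simp add: ennreal_divide_times)
  finally have "ennreal (\<bar>x $ i\<bar> powr c) * ennreal l \<le> ennreal (4 * 2 powr c) * avg (cube a l) (\<lambda>y. ennreal (\<bar>y $ i\<bar> powr c)) * ennreal l"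
    by (simp only: mult.assoc)
  then show "ennreal (\<bar>x $ i\<bar> powr c) \<le> ennreal (4 * 2 powr c) * avg (cube a l) (\<lambda>y. ennreal (\<bar>y $ i\<bar> powr c))"
    using l by (rule ennreal_mult_right_le_cancel)
qed auto

text \<open>Along the examples, with \<open>x = 1 / e\<close> tending to infinity, the norm grows at least like a power of \<open>x\<close> while a bound with
  smaller exponents grows like a strictly smaller power. Both weight constants are at least 1, so negative \<open>\<alpha>\<close>
  or \<open>\<beta>\<close> may be replaced by 0.\<close>

theorem maximal_opnorm_exponents_optimal:
  fixes p \<alpha> \<beta> C :: real and q :: ennreal
  assumes p: "1 < p" and q: "0 < q" and \<alpha>: "\<alpha> \<le> 1 / p" and \<beta>: "\<beta> \<le> 1 / min_exp p q"
    and strict: "\<alpha> < 1 / p \<or> \<beta> < 1 / min_exp p q"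
    and bound: "\<And>w :: real ^ 'n \<Rightarrow> real. w \<in> Ap p \<Longrightarrow>
       maximal_opnorm p q w \<le> ennreal C * epowr (Ap_const p w) \<alpha> * epowr (Ainf_const (dual_weight p w)) \<beta>"
  shows False
proof -
  fix i :: 'n
  define m where "m = min_exp p q"
  have m: "m > 0" using min_exp_pos[of p q] p q by (simp add: m_def)
  define B where "B = max C 1"
  have B: "B \<ge> 1" "C \<le> B" by (auto simp: B_def)
  have bound': "maximal_opnorm p q w \<le> ennreal (B * K1 powr a * K2 powr b)"
    if w: "w \<in> Ap p" and A: "Ap_const p w \<le> ennreal K1" "\<alpha> \<le> a" "0 \<le> a"
      and S: "Ainf_const (dual_weight p w) \<le> ennreal K2" "\<beta> \<le> b" "0 \<le> b"
    for w :: "real ^ 'n \<Rightarrow> real" and K1 K2 a b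
  proof -
    have "Ap_const p w \<ge> 1" using w by (intro Ap_const_ge_1[OF p]) (simp add: Ap_def)
    moreover have "Ainf_const (dual_weight p w) \<ge> 1" by (intro Ainf_const_ge_1 weight_dual_weight[OF p w])
    ultimately have "ennreal C * epowr (Ap_const p w) \<alpha> * epowr (Ainf_const (dual_weight p w)) \<beta>
        \<le> ennreal B * ennreal (K1 powr a) * ennreal (K2 powr b)"
      using A S B by (intro mult_mono ennreal_leI epowr_le_powr_bound) auto
    also have "\<dots> = ennreal (B * K1 powr a * K2 powr b)" using B by (simp add: ennreal_mult)
    finally show ?thesis using bound[OF w] by (rule order_trans[rotated])
  qed
  show False
  proof (cases "\<alpha> < 1 / p")
    case True
    define a where "a = max \<alpha> 0"
    define b where "b = max \<beta> 0"
    define K where "K = 4 * 2 powr (1 / (p - 1))"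
    have a: "a < 1 / p" "0 \<le> a" "\<alpha> \<le> a" using True p by (auto simp: a_def)
    have b: "0 \<le> b" "\<beta> \<le> b" by (auto simp: b_def)
    obtain x where x: "x \<ge> 2" "(B * 4 powr a * K powr b) * x powr a < 1 / 4 * x powr (1 / p)"
      by (rule powr_growth_separates[of a "1 / p" "1 / 4" 2 "B * 4 powr a * K powr b"]) (use a in auto)
    \<comment> \<open>The weight \<open>|t| powr (e - 1)\<close> has \<open>A\<^sub>p\<close> constant at most \<open>4 / e\<close>, and its dual weight is a positive power with a bounded
      exponent.\<close>
    define e where "e = 1 / x"
    have e: "0 < e" "e < 1" "1 / e = x" using x by (auto simp: e_def)
    define w where "w = (\<lambda>y :: real ^ 'n. trunc_power 0 e (y $ i))"
    have A1: "A1_line (trunc_power 0 e) (4 * (1 / e))" using A1_line_trunc_power[OF e(1,2)] by simp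
    have w: "w \<in> Ap p" "Ap_const p w \<le> ennreal (4 * x)"
      using A1_line_Ap[OF A1 p, of i] e by (auto simp: w_def)
    define c where "c = (1 - e) / (p - 1)"
    have c: "0 \<le> c" "c \<le> 1 / (p - 1)" using e p by (auto simp: c_def divide_right_mono)
    have dual: "dual_weight p w = (\<lambda>y. \<bar>y $ i\<bar> powr c)"
    proof
      fix y
      have "dual_weight p w y = trunc_power 0 e (y $ i) powr (1 - conj_exp p)" by (simp add: dual_weight_def w_def)
      also have "trunc_power 0 e (y $ i) = \<bar>y $ i\<bar> powr (e - 1)" by (simp add: trunc_power_def)
      also have "(\<bar>y $ i\<bar> powr (e - 1)) powr (1 - conj_exp p) = \<bar>y $ i\<bar> powr c"
      proof -
        have "(e - 1) * (1 - conj_exp p) = c"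
          unfolding conj_exp_identities(1)[OF p] c_def using p by (simp add: divide_simps)
        then show ?thesis by (simp only: powr_powr)
      qed
      finally show "dual_weight p w y = \<bar>y $ i\<bar> powr c" .
    qed
    have "Ainf_const (dual_weight p w) \<le> ennreal (4 * 2 powr c)"
      unfolding dual using weight_dual_weight[OF p w(1)] c unfolding dual by (intro Ainf_const_positive_power_le) auto
    also have "\<dots> \<le> ennreal K" unfolding K_def using c by (intro ennreal_leI mult_left_mono powr_mono) auto
    finally have "maximal_opnorm p q w \<le> ennreal (B * (4 * x) powr a * K powr b)"
      using w a b by (intro bound') auto
    moreover have "ennreal (1 / 4 * x powr (1 / p)) \<le> maximal_opnorm p q w"
      using maximal_opnorm_singular_weight[OF e(1,2) p q, of i] by (simp add: w_def e(3))
    ultimately have "ennreal (1 / 4 * x powr (1 / p)) \<le> ennreal (B * (4 * x) powr a * K powr b)" by (rule order_trans[rotated])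
    then have "1 / 4 * x powr (1 / p) \<le> B * (4 * x) powr a * K powr b"
      using B by (subst (asm) ennreal_le_iff) auto
    also have "\<dots> = (B * 4 powr a * K powr b) * x powr a" by (simp add: powr_mult)
    finally show False using x(2) by simp
  next
    case False
    then have \<beta>m: "\<beta> < 1 / m" using strict by (simp add: m_def)
    define b where "b = max \<beta> 0"
    have b: "b < 1 / m" "0 \<le> b" "\<beta> \<le> b" using \<beta>m m by (auto simp: b_def)
    define P where "P = (p - 1) / p"
    \<comment> \<open>With \<open>w = \<sigma> powr (1 - p)\<close> and \<open>\<sigma>\<close> in \<open>A\<^sub>1\<close> with constant \<open>4 / e\<close>, the first weight constant enters with the exponent
      \<open>(p - 1) / p\<close> and the second one with the exponent \<open>b < 1 / min p q\<close>.\<close>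
    have upper: "maximal_opnorm p q (\<lambda>y :: real ^ 'n. trunc_power d e (y $ i) powr (1 - p))
        \<le> ennreal ((B * 4 powr (P + b)) * (1 / e) powr (P + b))"
      if e: "0 < e" "e < 1" and d: "0 \<le> d" for d e
    proof -
      define K where "K = 4 * (1 / e)"
      have A1: "A1_line (trunc_power d e) K" unfolding K_def by (rule A1_line_trunc_power[OF e d])
      note w = A1_line_negative_power_Ap[OF A1 p, of i]
      have "Ainf_const (dual_weight p (\<lambda>y :: real ^ 'n. trunc_power d e (y $ i) powr (1 - p))) \<le> ennreal K"
        unfolding w(3) by (rule A1_line_Ainf_const_le[OF A1])
      then have "maximal_opnorm p q (\<lambda>y :: real ^ 'n. trunc_power d e (y $ i) powr (1 - p))
        \<le> ennreal (B * (K powr (p - 1)) powr (1 / p) * K powr b)"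
        using w(1,2) \<alpha> b p by (intro bound') auto
      also have "B * (K powr (p - 1)) powr (1 / p) * K powr b = B * K powr (P + b)"
        by (simp add: powr_powr P_def powr_add)
      also have "\<dots> = (B * 4 powr (P + b)) * (1 / e) powr (P + b)" by (simp only: K_def powr_mult mult.assoc)
      finally show ?thesis .
    qed
    have contra: False
      if c0: "c0 > 0" and lower: "\<And>e. 0 < e \<Longrightarrow> e < 1 \<Longrightarrow> (p - 1) * e \<le> 1 \<Longrightarrow> \<exists>d\<ge>0. ennreal (c0 * (1 / e) powr (P + 1 / m))
          \<le> maximal_opnorm p q (\<lambda>y :: real ^ 'n. trunc_power d e (y $ i) powr (1 - p))" for c0
    proof -
      have lt: "P + b < P + 1 / m" using b by simp
      obtain x where x: "x \<ge> max 2 p" "(B * 4 powr (P + b)) * x powr (P + b) < c0 * x powr (P + 1 / m)"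
        by (rule powr_growth_separates[OF lt c0])
      define e where "e = 1 / x"
      have e: "0 < e" "e < 1" "1 / e = x" "(p - 1) * e \<le> 1" using x by (auto simp: e_def divide_le_eq)
      obtain d where "d \<ge> 0" "ennreal (c0 * x powr (P + 1 / m)) \<le> maximal_opnorm p q (\<lambda>y :: real ^ 'n. trunc_power d e (y $ i) powr (1 - p))"
        using lower[OF e(1,2,4)] unfolding e(3) by blast
      then have "ennreal (c0 * x powr (P + 1 / m)) \<le> ennreal ((B * 4 powr (P + b)) * x powr (P + b))"
        using upper[OF e(1,2), of d] unfolding e(3) by (blast intro: order_trans)
      then have "c0 * x powr (P + 1 / m) \<le> (B * 4 powr (P + b)) * x powr (P + b)"
        using B by (subst (asm) ennreal_le_iff) auto
      then show False using x(2) by simp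
    qed
    show False
    proof (cases "ennreal p \<le> q")
      case True
      then have "m = p" using p by (simp add: m_def min_exp_def min_def)
      then have exp1: "P + 1 / m = 1" using p by (simp add: P_def field_simps)
      show False
      proof (rule contra[of 1])
        fix e :: real assume e: "0 < e" "e < 1"
        show "\<exists>d\<ge>0. ennreal (1 * (1 / e) powr (P + 1 / m)) \<le> maximal_opnorm p q (\<lambda>y :: real ^ 'n. trunc_power d e (y $ i) powr (1 - p))"
          unfolding exp1 using maximal_opnorm_degenerate_weight[OF e p q, of i] e by (intro exI[of _ 0]) simp
      qed simp
    next
      case False
      have qt: "q \<noteq> top" using False less_ennreal_imp_less_top by auto
      define Q where "Q = enn2real q"
      have Q: "Q > 0" using enn2real_gt_0[OF q qt] by (simp add: Q_def)
      have mQ: "m = Q" using False by (simp add: m_def min_exp_def min_def Q_def)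
      show False
      proof (rule contra)
        show "(Q * ln 2 / (p - 1)) powr (1 / Q) * (1 / 2 * (1 / 4) powr (1 / p)) > 0"
          using Q p by simp
        fix e :: real assume e: "0 < e" "e < 1" "(p - 1) * e \<le> 1"
        show "\<exists>d\<ge>0. ennreal ((Q * ln 2 / (p - 1)) powr (1 / Q) * (1 / 2 * (1 / 4) powr (1 / p)) * (1 / e) powr (P + 1 / m))
            \<le> maximal_opnorm p q (\<lambda>y :: real ^ 'n. trunc_power d e (y $ i) powr (1 - p))"
          using maximal_opnorm_plateau_weight[OF e(1,2) p e(3) q qt refl, of i]
          unfolding mQ P_def Q_def[symmetric]
          by (intro exI[of _ "(1 / 4) powr (1 / ((p - 1) * e))"]) (simp add: add.commute)
      qed
    qed
  qed
qed

theorem corollary2p2: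
  shows "(\<forall>q::ennreal. 0 < q \<longrightarrow>
            (\<exists>C::real. C > 0 \<and>
              (\<forall>p::real. 1 < p \<longrightarrow>
                (\<forall>w :: real ^ 'n \<Rightarrow> real. w \<in> Ap p \<longrightarrow>
                  maximal_opnorm p q w \<le>
                    ennreal (C * conj_exp p powr (1 / min_exp p q)) *
                    epowr (Ap_const p w) (1 / p) *
                    epowr (Ainf_const (dual_weight p w)) (1 / min_exp p q)))))
       \<and>
         (\<forall>(p::real) (q::ennreal) (\<alpha>::real) (\<beta>::real).
            1 < p \<longrightarrow> 0 < q \<longrightarrow>
            \<alpha> \<le> 1 / p \<longrightarrow> \<beta> \<le> 1 / min_exp p q \<longrightarrow>
            (\<alpha> < 1 / p \<or> \<beta> < 1 / min_exp p q) \<longrightarrow>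
            \<not> (\<exists>C::real. \<forall>w :: real ^ 'n \<Rightarrow> real. w \<in> Ap p \<longrightarrow>
                  maximal_opnorm p q w \<le>
                    ennreal C *
                    epowr (Ap_const p w) \<alpha> *
                    epowr (Ainf_const (dual_weight p w)) \<beta>))"
proof (rule conjI; intro allI impI)
  fix q :: ennreal
  assume "0 < q"
  then show "\<exists>C::real. C > 0 \<and>
      (\<forall>p::real. 1 < p \<longrightarrow>
        (\<forall>w :: real ^ 'n \<Rightarrow> real. w \<in> Ap p \<longrightarrow>
          maximal_opnorm p q w \<le>
            ennreal (C * conj_exp p powr (1 / min_exp p q)) *
            epowr (Ap_const p w) (1 / p) *
            epowr (Ainf_const (dual_weight p w)) (1 / min_exp p q)))"
    by (rule maximal_opnorm_upper_bound)
next
  fix p :: real and q :: ennreal and \<alpha> \<beta> :: real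
  assume "1 < p" "0 < q" "\<alpha> \<le> 1 / p" "\<beta> \<le> 1 / min_exp p q"
    "\<alpha> < 1 / p \<or> \<beta> < 1 / min_exp p q"
  then show "\<not> (\<exists>C::real. \<forall>w :: real ^ 'n \<Rightarrow> real. w \<in> Ap p \<longrightarrow>
      maximal_opnorm p q w \<le>
        ennreal C * epowr (Ap_const p w) \<alpha> * epowr (Ainf_const (dual_weight p w)) \<beta>)"
    using maximal_opnorm_exponents_optimal[where 'n = 'n] by blast
qed

end
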